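(* Let $I\subset T_n$ be a nonzero monomial ideal, let $d=\deg(I)$, and let $t\ge n$ be an integer. Then: (1) $T_{nd}/I^{\sigma^n}\cong T_{td}/\big(I^{\sigma^t},\,x_{n+1},\ldots,x_t,\,x_{t+n+1},\ldots,x_{2t},\,\ldots,\,x_{(d-1)t+n+1},\ldots,x_{td}\big)$, i.e. the quotient of $T_{td}$ by the ideal generated by $I^{\sigma^t}$ and all variables $x_{st+r}$ with $0\le s\le d-1$ and $n+1\le r\le t$. (2) $\operatorname{depth}(T_{nd}/I^{\sigma^n})=\operatorname{depth}(T_{td}/I^{\sigma^t})-(t-n)d$. (3) $\operatorname{sdepth}(T_{nd}/I^{\sigma^n})=\operatorname{sdepth}(T_{td}/I^{\sigma^t})-(t-n)d$. (4) $\operatorname{sdepth}(I^{\sigma^n})=\operatorname{sdepth}(I^{\sigma^t})-(t-n)d$.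
   Context: $K$ is a field, $T=K[x_1,x_2,\ldots]$ and $T_n=K[x_1,\ldots,x_n]$. For a monomial $u=x_{i_1}\cdots x_{i_d}$ with $i_1\le\cdots\le i_d$, set $\sigma(u):=x_{i_1}x_{i_2+1}\cdots x_{i_d+d-1}$, and $\sigma^t(u):=\sigma(\sigma^{t-1}(u))$, so $\sigma^t(u)=x_{i_1}x_{i_2+t}\cdots x_{i_d+(d-1)t}$. For a nonzero monomial ideal $I$, $G(I)$ is its set of minimal monomial generators and $\deg(I)$ is the maximal degree of an element of $G(I)$. $I^\sigma$ is the ideal generated by $\sigma(u)$, $u\in G(I)$, for which $G(I^\sigma)=\{\sigma(u):u\in G(I)\}$; $I^{\sigma^t}:=(I^{\sigma^{t-1}})^\sigma$, so $I^{\sigma^t}$ is generated by $\sigma^t(u)$, $u\in G(I)$. For $t\ge n$ and $I\subset T_n$ with $\deg(I)=d$, $I^{\sigma^t}$ is considered as an ideal of $T_{td}$. $\operatorname{sdepth}$ is the Stanley depth: for a finitely generated $\mathbb Z^N$-graded $T_N$-module $M$, a Stanley decomposition is a finite direct sum decomposition $M=\bigoplus_i m_iK[Z_i]$ of $\mathbb Z^N$-graded $K$-vector spaces with $m_i\in M$ homogeneous, $Z_i\subset\{x_1,\ldots,x_N\}$ and each $m_iK[Z_i]$ a free $K[Z_i]$-module; $\operatorname{sdepth}(M)$ is the maximum over all Stanley decompositions of $\min_i|Z_i|$. By the usual convention, depth and sdepth of the zero module are $+\infty$. *)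

theory Defs
  imports
    "HOL-Algebra.Algebra"
    "HOL-Library.Poly_Mapping"
    "HOL-Library.Multiset_Order"
    "HOL-Library.Extended_Real"
begin

text \<open>
  The monomial \<open>x\<^bsub>i1\<^esub> \<cdots> x\<^bsub>id\<^esub>\<close> is the multiset of its indices (with multiplicity), so
  that multiplication is multiset sum, \<open>size\<close> is the degree, and \<open>count u i\<close> is the exponent
  of \<open>x\<^sub>i\<close>.  Polynomials are then finitely supported maps from monomials to coefficients, with
  the convolution product of \<^theory>\<open>HOL-Library.Poly_Mapping\<close>.
\<close>

type_synonym monom = "nat multiset"
type_synonym 'k mpoly = "monom \<Rightarrow>\<^sub>0 'k"

definition mon :: "monom \<Rightarrow> 'k::field mpoly" where
  "mon u = Poly_Mapping.single u 1"

definition cst :: "'k::field \<Rightarrow> 'k mpoly" where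
  "cst c = Poly_Mapping.single {#} c"

definition xvar :: "nat \<Rightarrow> 'k::field mpoly" where
  "xvar i = mon {#i#}"

text \<open>\<open>K[Z]\<close> for a set \<open>Z\<close> of variable indices; variables are numbered from 1.\<close>

definition polyring :: "nat set \<Rightarrow> 'k::field mpoly ring" where
  "polyring Z = \<lparr>carrier = {p. \<forall>u\<in>Poly_Mapping.keys p. set_mset u \<subseteq> Z},
     monoid.mult = (*), one = 1, ring.zero = 0, add = (+)\<rparr>"

definition T :: "nat \<Rightarrow> 'k::field mpoly ring" where
  "T N = polyring {1..N}"

subsection \<open>Monomial ideals and the operator \<open>\<sigma>\<close>\<close>

definition monomial_ideal :: "nat \<Rightarrow> 'k::field mpoly set \<Rightarrow> bool" where
  "monomial_ideal N I \<longleftrightarrow>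
     (\<exists>U. (\<forall>u\<in>U. set_mset u \<subseteq> {1..N}) \<and> I = genideal (T N) (mon ` U))"

text \<open>\<open>G(I)\<close>: the monomials of \<open>I\<close> that are minimal with respect to divisibility.\<close>

definition min_gens :: "'k::field mpoly set \<Rightarrow> monom set" where
  "min_gens I = {u. (mon u :: 'k mpoly) \<in> I \<and>
     (\<forall>v. (mon v :: 'k mpoly) \<in> I \<longrightarrow> (mon v :: 'k mpoly) dvd mon u \<longrightarrow> v = u)}"

definition ideal_deg :: "'k::field mpoly set \<Rightarrow> nat" where
  "ideal_deg I = Max (size ` min_gens I)"

definition sigma :: "monom \<Rightarrow> monom" where
  "sigma u = mset (map2 (+) (sorted_list_of_multiset u) [0..<size u])"

text \<open>
  \<open>I\<^sup>\<sigma>\<close>, and the two descriptions of the \<open>t\<close>-th power \<open>I\<^bsup>\<sigma>^t\<^esup>\<close>, each considered as an ideal of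
  \<open>T\<^sub>N\<close>: the \<open>t\<close>-fold iterate of \<open>I \<mapsto> I\<^sup>\<sigma>\<close>, and the ideal generated by \<open>\<sigma>\<^sup>t(u)\<close>, \<open>u \<in> G(I)\<close>.
  They agree if \<open>\<sigma>\<close> carries minimal generators to minimal generators at every step, which can
  fail: for \<open>G(I) = {x\<^sub>1x\<^sub>2, x\<^sub>1\<^sup>3}\<close> one gets \<open>\<sigma>(x\<^sub>1x\<^sub>2) = x\<^sub>1x\<^sub>3\<close>, which divides
  \<open>\<sigma>(x\<^sub>1\<^sup>3) = x\<^sub>1x\<^sub>2x\<^sub>3\<close>.
\<close>

definition sigma_ideal :: "nat \<Rightarrow> 'k::field mpoly set \<Rightarrow> 'k mpoly set" where
  "sigma_ideal N I = genideal (T N) (mon ` sigma ` min_gens I)"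

definition sigma_ideal_iterated :: "nat \<Rightarrow> nat \<Rightarrow> 'k::field mpoly set \<Rightarrow> 'k mpoly set" where
  "sigma_ideal_iterated N t I = (sigma_ideal N ^^ t) I"

definition sigma_ideal_direct :: "nat \<Rightarrow> nat \<Rightarrow> 'k::field mpoly set \<Rightarrow> 'k mpoly set" where
  "sigma_ideal_direct N t I = genideal (T N) (mon ` (sigma ^^ t) ` min_gens I)"

subsection \<open>Isomorphism of \<open>K\<close>-algebras \<open>T\<^sub>M/I\<close> and \<open>T\<^sub>N/J\<close>\<close>

definition quot_alg_iso ::
    "nat \<Rightarrow> 'k::field mpoly set \<Rightarrow> nat \<Rightarrow> 'k mpoly set \<Rightarrow> bool" where
  "quot_alg_iso M I N J \<longleftrightarrow>
     (\<exists>h \<in> ring_iso (T M Quot I) (T N Quot J).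
        \<forall>c. h (I +>\<^bsub>T M\<^esub> cst c) = J +>\<^bsub>T N\<^esub> cst c)"

subsection \<open>The \<open>T\<^sub>N\<close>-modules \<open>I\<close> and \<open>T\<^sub>N/I\<close> and their multigraded components\<close>

definition ideal_module :: "nat \<Rightarrow> 'k::field mpoly set \<Rightarrow> ('k mpoly, 'k mpoly) module" where
  "ideal_module N I = \<lparr>carrier = I, monoid.mult = (*), one = 1, ring.zero = 0, add = (+), smult = (*)\<rparr>"

definition quot_module :: "nat \<Rightarrow> 'k::field mpoly set \<Rightarrow> ('k mpoly, 'k mpoly set) module" where
  "quot_module N I = (let Q = T N Quot I in
     \<lparr>carrier = carrier Q, monoid.mult = monoid.mult Q, one = one Q, ring.zero = ring.zero Q, add = add Q,
      smult = (\<lambda>f A. (I +>\<^bsub>T N\<^esub> f) \<otimes>\<^bsub>Q\<^esub> A)\<rparr>)"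

text \<open>
  Degrees in \<open>\<int>\<^sup>N\<close> are functions \<open>a :: nat \<Rightarrow> int\<close>; the component of any degree that is negative
  somewhere or does not vanish outside \<open>{1..N}\<close> is zero.
\<close>

definition poly_part :: "nat \<Rightarrow> (nat \<Rightarrow> int) \<Rightarrow> 'k::field mpoly set" where
  "poly_part N a = {f \<in> carrier (T N).
     \<forall>u\<in>Poly_Mapping.keys f. \<forall>i. int (count u i) = a i}"

definition ideal_part ::
    "nat \<Rightarrow> 'k::field mpoly set \<Rightarrow> (nat \<Rightarrow> int) \<Rightarrow> 'k mpoly set" where
  "ideal_part N I a = I \<inter> poly_part N a"

definition quot_part ::
    "nat \<Rightarrow> 'k::field mpoly set \<Rightarrow> (nat \<Rightarrow> int) \<Rightarrow> 'k mpoly set set" where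
  "quot_part N I a = (\<lambda>f. I +>\<^bsub>T N\<^esub> f) ` poly_part N a"

subsection \<open>Depth\<close>

text \<open>The submodule \<open>(f\<^sub>1,\<dots>,f\<^sub>r)M\<close>.\<close>

definition seq_mult :: "('r, 'm, 'b) module_scheme \<Rightarrow> 'r list \<Rightarrow> 'm set" where
  "seq_mult M fs =
     {finsum M (\<lambda>j. fs ! j \<odot>\<^bsub>M\<^esub> g j) {..<length fs} |g. g \<in> {..<length fs} \<rightarrow> carrier M}"

text \<open>
  \<open>f\<^sub>i\<close> is a nonzerodivisor on \<open>M/(f\<^sub>1,\<dots>,f\<^bsub>i-1\<^esub>)M\<close> for all \<open>i\<close>, and \<open>M \<noteq> (f\<^sub>1,\<dots>,f\<^sub>r)M\<close>.
\<close>

definition regular_seq ::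
    "('r, 'a) ring_scheme \<Rightarrow> ('r, 'm, 'b) module_scheme \<Rightarrow> 'r list \<Rightarrow> bool" where
  "regular_seq R M fs \<longleftrightarrow>
     set fs \<subseteq> carrier R \<and>
     (\<forall>i<length fs. \<forall>m\<in>carrier M.
        fs ! i \<odot>\<^bsub>M\<^esub> m \<in> seq_mult M (take i fs) \<longrightarrow> m \<in> seq_mult M (take i fs)) \<and>
     seq_mult M fs \<noteq> carrier M"

text \<open>Depth of a \<open>T\<^sub>N\<close>-module with respect to the graded maximal ideal \<open>(x\<^sub>1,\<dots>,x\<^sub>N)\<close>.\<close>

definition depth :: "nat \<Rightarrow> ('k::field mpoly, 'm, 'b) module_scheme \<Rightarrow> enat" where
  "depth N M = (if carrier M = {\<zero>\<^bsub>M\<^esub>} then \<infinity>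
     else SUP fs \<in> {fs. regular_seq (T N) M fs \<and> set fs \<subseteq> genideal (T N) (xvar ` {1..N})}.
       enat (length fs))"

subsection \<open>Stanley depth\<close>

definition stanley_space ::
    "('k::field mpoly, 'm, 'b) module_scheme \<Rightarrow> 'm \<Rightarrow> nat set \<Rightarrow> 'm set" where
  "stanley_space M m Z = (\<lambda>f. f \<odot>\<^bsub>M\<^esub> m) ` carrier (polyring Z)"

text \<open>
  A decomposition is a list of pairs \<open>(m\<^sub>i, Z\<^sub>i)\<close>, and \<open>gr\<close> is the grading of \<open>M\<close>.  The second
  condition says that \<open>m\<^sub>i\<close> is a basis of \<open>m\<^sub>iK[Z\<^sub>i]\<close>.  The last one says that \<open>M\<close> is the direct
  sum of the subspaces; the sum is automatically one of graded vector spaces because the \<open>m\<^sub>i\<close>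
  are homogeneous.
\<close>

definition stanley_decomposition ::
    "nat \<Rightarrow> ('k::field mpoly, 'm, 'b) module_scheme \<Rightarrow> ((nat \<Rightarrow> int) \<Rightarrow> 'm set)
     \<Rightarrow> ('m \<times> nat set) list \<Rightarrow> bool" where
  "stanley_decomposition N M gr D \<longleftrightarrow>
     (\<forall>(m, Z)\<in>set D. m \<in> carrier M \<and> (\<exists>a. m \<in> gr a) \<and> Z \<subseteq> {1..N}) \<and>
     (\<forall>(m, Z)\<in>set D. \<forall>f\<in>carrier (polyring Z). f \<odot>\<^bsub>M\<^esub> m = \<zero>\<^bsub>M\<^esub> \<longrightarrow> f = 0) \<and>
     (\<forall>x\<in>carrier M. \<exists>!y.
        y \<in> (\<Pi>\<^sub>E i\<in>{..<length D}. stanley_space M (fst (D ! i)) (snd (D ! i))) \<and>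
        x = finsum M y {..<length D})"

text \<open>
  The infimum over a nonempty list is the minimum of the \<open>|Z\<^sub>i|\<close>; over the empty decomposition,
  which exists only for the zero module, it is \<open>\<infinity>\<close>.
\<close>

definition sdepth ::
    "nat \<Rightarrow> ('k::field mpoly, 'm, 'b) module_scheme \<Rightarrow> ((nat \<Rightarrow> int) \<Rightarrow> 'm set) \<Rightarrow> enat" where
  "sdepth N M gr =
     (SUP D \<in> {D. stanley_decomposition N M gr D}. INF (m, Z)\<in>set D. enat (card Z))"

end

theory Submission
  imports Defs
begin

text \<open>
  Let \<open>s \<ge> n\<close>.  The operator \<open>\<sigma>\<^sup>s\<close> moves the \<open>k\<close>-th smallest index \<open>i\<close> (counting from \<open>k = 0\<close>) of a
  monomial of \<open>T\<^sub>n\<close> to \<open>i + k s\<close>.  If one cuts the variables into blocks of \<open>s\<close> consecutive ones, then the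
  \<open>k\<close>-th factor lands in the \<open>k\<close>-th block and occupies one of its first \<open>n\<close> places.  Hence the
  injection \<open>i + k n \<mapsto> i + k t\<close> with \<open>1 \<le> i \<le> n\<close> turns \<open>\<sigma>\<^sup>n(u)\<close> into \<open>\<sigma>\<^sup>t(u)\<close> for all \<open>u\<close> at once, and the
  generators of \<open>J t\<close> are the renamed generators of \<open>J n\<close>, in a polynomial ring with \<open>(t - n) d\<close> variables
  that occur in no generator.  Dividing by these variables gives the isomorphism, and the rest of the
  theorem says that one such variable raises the depth and the Stanley depths by exactly one.

  If \<open>I\<^sup>\<sigma>\<close> is iterated, some generators can become redundant on the way and are then lost.  But for
  \<open>s \<ge> n\<close> the blocks do not mix, so that \<open>\<sigma>\<^sup>s(u)\<close> divides \<open>\<sigma>\<^sup>s(v)\<close> only if \<open>u\<close> divides \<open>v\<close>, and nothing is lost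
  after step \<open>n\<close>.  Thus in both readings \<open>J s\<close> is generated by \<open>\<sigma>\<^sup>s(V)\<close>, for a set \<open>V \<subseteq> G(I)\<close> that is the
  same for all \<open>s \<ge> n\<close> (\<open>sigma_ideal_iterated_eq\<close>, \<open>sigma_ideal_direct_eq\<close>).

  Depth.  All modules in sight are cyclic, so that regular sequences can be discussed in terms of ideals.
  A new variable \<open>y\<close> can be put in front of a regular sequence.  For the converse a regular sequence of
  length \<open>r + 1\<close> has to be replaced by one of the same length that begins with \<open>y\<close>; then one divides by
  \<open>y\<close>.  This is Rees' theorem on the length of maximal regular sequences (\<open>regular_exchange\<close>), proved
  here without homological algebra: if the maximal ideal \<open>m\<close> annihilates no nonzero element modulo
  \<open>A + (f)\<close>, then it annihilates none modulo \<open>A + (y)\<close> either (\<open>socle_exchange\<close>), and prime avoidance in a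
  Noetherian ring yields an \<open>h \<in> m\<close> that is regular modulo \<open>A\<close>, \<open>A + (f)\<close> and \<open>A + (y)\<close> simultaneously.  Two
  inductive steps through \<open>h\<close> replace \<open>f\<close> by \<open>y\<close>.  The regular sequences need not be homogeneous, so the
  argument concerns arbitrary ideals of the polynomial ring.

  Stanley depth.  The multigraded components of an ideal \<open>J\<close> generated by monomials and of \<open>T/J\<close> are at
  most one-dimensional.  So a Stanley decomposition amounts to a partition of the monomials in \<open>J\<close>,
  respectively outside \<open>J\<close>, into blocks \<open>v \<cdot> Mon(W)\<close> (\<open>sdepth_eq_partition_depth\<close>).  Adding the new
  variables to every \<open>W\<close>, or keeping only the part of a partition in which they have exponent zero,
  shows that the maximum shifts by their number (\<open>partition_depth_extend\<close>).
\<close>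

section \<open>Associated primes and prime avoidance\<close>

text \<open>
  The polynomial rings \<open>K[Z]\<close> are subrings of one ambient type, so commutative algebra is done for the
  ideals of a subring \<open>S\<close> of a commutative ring.
\<close>

locale unital_subring =
  fixes S :: "'a::comm_ring_1 set"
  assumes zero_mem [simp, intro]: "0 \<in> S"
    and one_mem [simp, intro]: "1 \<in> S"
    and add_mem [simp, intro]: "a \<in> S \<Longrightarrow> b \<in> S \<Longrightarrow> a + b \<in> S"
    and mult_mem [simp, intro]: "a \<in> S \<Longrightarrow> b \<in> S \<Longrightarrow> a * b \<in> S"
    and uminus_mem [simp, intro]: "a \<in> S \<Longrightarrow> - a \<in> S"
begin

definition idl :: "'a set \<Rightarrow> bool" where
  "idl A \<longleftrightarrow> A \<subseteq> S \<and> 0 \<in> A \<and> (\<forall>a\<in>A. \<forall>b\<in>A. a + b \<in> A) \<and> (\<forall>r\<in>S. \<forall>a\<in>A. r * a \<in> A)"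

definition colon :: "'a set \<Rightarrow> 'a \<Rightarrow> 'a set" where
  "colon A x = {r \<in> S. r * x \<in> A}"

definition adjoin :: "'a set \<Rightarrow> 'a \<Rightarrow> 'a set" where
  "adjoin A f = {a + r * f | a r. a \<in> A \<and> r \<in> S}"

definition nonzerodivisor_mod :: "'a set \<Rightarrow> 'a \<Rightarrow> bool" where
  "nonzerodivisor_mod A f \<longleftrightarrow> f \<in> S \<and> (\<forall>g\<in>S. f * g \<in> A \<longrightarrow> g \<in> A)"

definition prime_idl :: "'a set \<Rightarrow> bool" where
  "prime_idl p \<longleftrightarrow> idl p \<and> 1 \<notin> p \<and> (\<forall>a\<in>S. \<forall>b\<in>S. a * b \<in> p \<longrightarrow> a \<in> p \<or> b \<in> p)"

definition associated_primes :: "'a set \<Rightarrow> 'a set set" where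
  "associated_primes A = {p. prime_idl p \<and> (\<exists>x\<in>S. p = colon A x)}"

definition noetherian :: bool where
  "noetherian \<longleftrightarrow> wf {(B, A). idl A \<and> idl B \<and> A \<subset> B}"

lemma idlD:
  assumes "idl A"
  shows "a \<in> A \<Longrightarrow> a \<in> S" "0 \<in> A" "a \<in> A \<Longrightarrow> b \<in> A \<Longrightarrow> a + b \<in> A"
    "r \<in> S \<Longrightarrow> a \<in> A \<Longrightarrow> r * a \<in> A" "r \<in> S \<Longrightarrow> a \<in> A \<Longrightarrow> a * r \<in> A"
  using assms by (auto simp: idl_def mult.commute)

lemma idl_uminus: "idl A \<Longrightarrow> a \<in> A \<Longrightarrow> - a \<in> A"
  using idlD(4)[of A "-1" a] by auto

lemma idl_diff: "idl A \<Longrightarrow> a \<in> A \<Longrightarrow> b \<in> A \<Longrightarrow> a - b \<in> A"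
  using idlD(3)[of A a "- b"] idl_uminus[of A b] by simp

lemma diff_mem [simp, intro]: "a \<in> S \<Longrightarrow> b \<in> S \<Longrightarrow> a - b \<in> S"
  using add_mem[of a "- b"] by simp

lemma idl_add_cancel: "idl A \<Longrightarrow> a \<in> A \<Longrightarrow> a + b \<in> A \<longleftrightarrow> b \<in> A"
  using idl_diff[of A "a + b" a] idlD(3)[of A a b] by auto

lemma idl_colon: "idl A \<Longrightarrow> x \<in> S \<Longrightarrow> idl (colon A x)"
  unfolding colon_def idl_def[of "{r \<in> S. r * x \<in> A}"]
  by (auto simp: distrib_right mult.assoc idlD)

lemma idl_adjoin:
  assumes "idl A" "f \<in> S"
  shows "idl (adjoin A f)"
  unfolding idl_def
proof (intro conjI ballI)
  show "adjoin A f \<subseteq> S"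
    using assms idlD(1)[OF assms(1)] by (auto simp: adjoin_def)
  have "0 + 0 * f \<in> adjoin A f"
    unfolding adjoin_def using idlD(2)[OF assms(1)] by blast
  then show "0 \<in> adjoin A f" by simp
next
  fix x y assume "x \<in> adjoin A f" "y \<in> adjoin A f"
  then obtain a r b s where *: "x = a + r * f" "y = b + s * f" "a \<in> A" "r \<in> S" "b \<in> A" "s \<in> S"
    by (auto simp: adjoin_def)
  then have "x + y = (a + b) + (r + s) * f" by (simp add: algebra_simps)
  then show "x + y \<in> adjoin A f"
    unfolding adjoin_def using * idlD(3)[OF assms(1)] by blast
next
  fix q x assume "q \<in> S" "x \<in> adjoin A f"
  then obtain a r where *: "x = a + r * f" "a \<in> A" "r \<in> S"
    by (auto simp: adjoin_def)
  then have "q * x = q * a + (q * r) * f" by (simp add: algebra_simps)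
  then show "q * x \<in> adjoin A f"
    unfolding adjoin_def using * \<open>q \<in> S\<close> idlD(4)[OF assms(1)] by blast
qed

lemma subset_adjoin: "a \<in> A \<Longrightarrow> a \<in> adjoin A f"
  unfolding adjoin_def using zero_mem by force

lemma adjoin_self: "idl A \<Longrightarrow> r \<in> S \<Longrightarrow> r * f \<in> adjoin A f"
  unfolding adjoin_def using idlD(2) by force

lemma adjoinE:
  assumes "x \<in> adjoin A f"
  obtains a r where "a \<in> A" "r \<in> S" "x = a + r * f"
  using assms by (auto simp: adjoin_def)

lemma adjoin_commute: "adjoin (adjoin A f) g = adjoin (adjoin A g) f"
proof -
  have "adjoin (adjoin A f) g \<subseteq> adjoin (adjoin A g) f" for f g
  proof
    fix x assume "x \<in> adjoin (adjoin A f) g"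
    then obtain a r s where *: "x = (a + r * f) + s * g" "a \<in> A" "r \<in> S" "s \<in> S"
      by (auto elim!: adjoinE)
    then have "x = (a + s * g) + r * f" by (simp add: algebra_simps)
    then show "x \<in> adjoin (adjoin A g) f"
      unfolding adjoin_def using * by blast
  qed
  then show ?thesis by blast
qed

text \<open>
  Among the annihilators \<open>colon A y\<close> with \<open>y \<notin> A\<close> that contain \<open>f\<close>, a maximal one is prime: if it contains
  \<open>a b\<close> but not \<open>b\<close>, then \<open>a\<close> belongs to the annihilator of \<open>b y\<close>, which contains it and equals it by
  maximality.
\<close>

lemma zero_divisor_in_associated_prime:
  assumes "noetherian" and A: "idl A" and x: "x \<in> S" "x \<notin> A" and f: "f \<in> S" "f * x \<in> A"
  shows "\<exists>p\<in>associated_primes A. f \<in> p"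
proof -
  let ?F = "{colon A y | y. y \<in> S \<and> y \<notin> A \<and> f \<in> colon A y}"
  have "colon A x \<in> ?F" using x f by (auto simp: colon_def)
  then obtain p where p: "p \<in> ?F" and max: "\<And>q. (q, p) \<in> {(B, A). idl A \<and> idl B \<and> A \<subset> B} \<Longrightarrow> q \<notin> ?F"
    using assms(1) unfolding noetherian_def by (metis (no_types, lifting) wfE_min)
  obtain y where y: "p = colon A y" "y \<in> S" "y \<notin> A" "f \<in> p" using p by auto
  have ip: "idl p" using y idl_colon[OF A] by auto
  have "prime_idl p"
    unfolding prime_idl_def
  proof (intro conjI ballI impI)
    show "1 \<notin> p" using y by (simp add: colon_def)
  next
    fix a b assume ab: "a \<in> S" "b \<in> S" "a * b \<in> p"
    show "a \<in> p \<or> b \<in> p"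
    proof (rule ccontr)
      assume n: "\<not> (a \<in> p \<or> b \<in> p)"
      have "p \<subseteq> colon A (b * y)"
        using ab idlD(4)[OF A, of b] by (auto simp: y(1) colon_def mult.left_commute[of _ b y])
      moreover have "a \<in> colon A (b * y)" using ab by (auto simp: y(1) colon_def mult.assoc)
      ultimately have "p \<subset> colon A (b * y)" using n by auto
      moreover have "b * y \<notin> A" using n ab by (auto simp: y(1) colon_def)
      ultimately show False
        using max[of "colon A (b * y)"] ip idl_colon[OF A, of "b * y"] y ab by blast
    qed
  qed (rule ip)
  then show ?thesis using y by (auto simp: associated_primes_def)
qed

text \<open>
  Noetherian induction.  Let \<open>p = colon A x\<close> be associated and \<open>q = colon A z\<close> another associated prime.  If
  the submodules generated by \<open>x\<close> and \<open>z\<close> meet modulo \<open>A\<close>, a common nonzero element has both \<open>p\<close> and \<open>q\<close> as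
  its annihilator; otherwise \<open>q\<close> is still associated to the larger ideal \<open>A + (x)\<close>.
\<close>

lemma finite_associated_primes:
  assumes noeth: "noetherian" and A: "idl A"
  shows "finite (associated_primes A)"
  using noeth[unfolded noetherian_def] A
proof (induction A rule: wf_induct_rule)
  case (less A)
  note A = less.prems
  show ?case
  proof (cases "associated_primes A = {}")
    case False
    then obtain p x where p: "prime_idl p" "p = colon A x" "x \<in> S" by (auto simp: associated_primes_def)
    have xA: "x \<notin> A" using p by (auto simp: prime_idl_def colon_def)
    let ?B = "adjoin A x"
    have B: "idl ?B" using idl_adjoin[OF A p(3)] .
    have "x \<in> ?B" using adjoin_self[OF A, of 1 x] by simp
    then have "A \<subset> ?B" using xA subset_adjoin by auto
    then have fin: "finite (associated_primes ?B)" using less.IH[of ?B] A B by auto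
    have "associated_primes A \<subseteq> insert p (associated_primes ?B)"
    proof
      fix q assume q: "q \<in> associated_primes A"
      then obtain z where z: "prime_idl q" "q = colon A z" "z \<in> S" by (auto simp: associated_primes_def)
      show "q \<in> insert p (associated_primes ?B)"
      \<comment> \<open>the element r * z is nonzero modulo A and lies in both cyclic submodules\<close>
      proof (cases "\<exists>r\<in>S. r * z \<in> ?B \<and> r * z \<notin> A")
        case True
        then obtain r a s where r: "r \<in> S" "r * z \<notin> A" "r * z = a + s * x" "a \<in> A" "s \<in> S"
          by (auto elim: adjoinE)
        have rq: "r \<notin> q" using r z by (auto simp: colon_def)
        have "s * x = r * z - a" using r by simp
        then have sx: "s * x \<notin> A" using r idl_add_cancel[OF A, of a "s * x"] by simp
        then have sp: "s \<notin> p" using r p by (auto simp: colon_def)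
        have "b \<in> q \<longleftrightarrow> b \<in> p" if "b \<in> S" for b
        proof -
          have "b \<in> q \<longleftrightarrow> b * r \<in> q"
            using z(1) rq that r idlD(4)[of q r b] unfolding prime_idl_def
            by (auto simp: mult.commute)
          also have "\<dots> \<longleftrightarrow> b * (r * z) \<in> A" using that r z by (auto simp: colon_def mult.assoc)
          also have "b * (r * z) = b * a + b * (s * x)" using r by (simp add: algebra_simps)
          also have "\<dots> \<in> A \<longleftrightarrow> b * (s * x) \<in> A"
            using idl_add_cancel[OF A, of "b * a"] idlD(4)[OF A, of b a] that r by auto
          also have "\<dots> \<longleftrightarrow> b * s \<in> p" using that r p by (auto simp: colon_def mult.assoc)
          also have "\<dots> \<longleftrightarrow> b \<in> p"
            using p(1) sp that r idlD(4)[of p s b] unfolding prime_idl_def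
            by (auto simp: mult.commute)
          finally show ?thesis .
        qed
        then have "p = q" using z(2) p(2) by (auto simp: colon_def)
        then show ?thesis by simp
      next
        case False
        then have "q = colon ?B z" using z subset_adjoin by (auto simp: colon_def)
        then show ?thesis using z by (auto simp: associated_primes_def)
      qed
    qed
    then show ?thesis using fin finite_subset by blast
  qed simp
qed

lemma prime_idl_prod_notin:
  assumes "prime_idl p" "finite Q" "\<And>q. q \<in> Q \<Longrightarrow> g q \<in> S - p"
  shows "prod g Q \<in> S - p"
  using assms(2,3) by induction (use assms(1) in \<open>auto simp: prime_idl_def\<close>)


lemma prod_mem: "(\<And>q. q \<in> Q \<Longrightarrow> g q \<in> S) \<Longrightarrow> prod g Q \<in> S"
  by (induction Q rule: infinite_finite_induct) auto

text \<open>
  The induction removes a prime \<open>p\<close> that is minimal among the given ones.  Then every other prime \<open>q\<close>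
  contains some \<open>g q \<notin> p\<close>, and the product of the \<open>g q\<close> corrects an element that avoids all primes except \<open>p\<close>.
\<close>

lemma prime_avoidance:
  assumes m: "idl m" and "finite P" "\<And>p. p \<in> P \<Longrightarrow> prime_idl p" "\<And>p. p \<in> P \<Longrightarrow> \<not> m \<subseteq> p"
  shows "\<exists>f\<in>m. \<forall>p\<in>P. f \<notin> p"
  using assms(2-)
proof (induction P rule: finite_psubset_induct)
  case (psubset P)
  show ?case
  proof (cases "P = {}")
    case True
    then show ?thesis using idlD(2)[OF m] by auto
  next
    case False
    then obtain p where p: "p \<in> P" "\<And>q. q \<in> P \<Longrightarrow> q \<subseteq> p \<Longrightarrow> q = p"
      using finite_has_minimal[OF psubset.hyps] by metis
    let ?Q = "P - {p}"
    obtain f where f: "f \<in> m" "\<forall>q\<in>?Q. f \<notin> q"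
      using psubset.IH[of ?Q] psubset.prems p(1) by blast
    show ?thesis
    proof (cases "f \<in> p")
      case True
      obtain m0 where m0: "m0 \<in> m" "m0 \<notin> p" using psubset.prems p(1) by blast
      have "\<forall>q\<in>?Q. \<exists>a. a \<in> q - p" using p by blast
      then obtain g where g: "\<And>q. q \<in> ?Q \<Longrightarrow> g q \<in> q - p" by metis
      have idQ: "idl q" if "q \<in> P" for q using psubset.prems that by (auto simp: prime_idl_def)
      have gS: "g q \<in> S" if "q \<in> ?Q" for q using idQ g that idlD(1) by blast
      define h where "h = m0 * prod g ?Q"
      have pp: "prime_idl p" "idl p" using psubset.prems p idQ by auto
      have "prod g ?Q \<in> S - p"
        by (rule prime_idl_prod_notin) (use pp psubset.hyps g gS in auto)
      then have hp: "h \<notin> p" using pp m0 idlD(1)[OF m] unfolding h_def prime_idl_def by auto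
      have hm: "h \<in> m" unfolding h_def using \<open>prod g ?Q \<in> S - p\<close> m0 idlD(5)[OF m] by auto
      have hq: "h \<in> q" if q: "q \<in> ?Q" for q
      proof -
        have "prod g ?Q = g q * prod g (?Q - {q})"
          using q psubset.hyps by (simp add: prod.remove)
        moreover have "prod g (?Q - {q}) \<in> S" using gS by (intro prod_mem) auto
        moreover have "g q \<in> q" using g[OF q] by simp
        ultimately show ?thesis unfolding h_def using idQ[of q] q m0 idlD(1)[OF m]
          by (simp add: idlD)
      qed
      have "f + h \<in> m" using idlD(3)[OF m] f hm by auto
      moreover have "f + h \<notin> p" using hp True idl_add_cancel[OF pp(2)] by auto
      moreover have "f + h \<notin> q" if "q \<in> ?Q" for q
        using hq[OF that] f that idl_add_cancel[of q h f] idQ[of q] by (auto simp: add.commute)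
      ultimately show ?thesis by blast
    qed (use f in blast)
  qed
qed

text \<open>
  For a local ring \<open>S\<close> with maximal ideal \<open>m\<close> this says that the socle of \<open>S/A\<close> vanishes.
\<close>

definition no_socle :: "'a set \<Rightarrow> 'a set \<Rightarrow> bool" where
  "no_socle m A \<longleftrightarrow> (\<forall>x\<in>S. (\<forall>f\<in>m. f * x \<in> A) \<longrightarrow> x \<in> A)"

text \<open>
  An associated prime that contains \<open>m\<close> would be the annihilator of an element which \<open>m\<close> kills.  So \<open>m\<close>
  is contained in none of the finitely many associated primes, and prime avoidance applies to all ideals
  of the family at once.
\<close>

lemma common_nonzerodivisor:
  assumes noetherian and m: "idl m" and fin: "finite \<A>"
    and A: "\<And>A. A \<in> \<A> \<Longrightarrow> idl A" "\<And>A. A \<in> \<A> \<Longrightarrow> no_socle m A"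
  shows "\<exists>f\<in>m. \<forall>A\<in>\<A>. nonzerodivisor_mod A f"
proof -
  let ?P = "\<Union>(associated_primes ` \<A>)"
  have "\<not> m \<subseteq> p" if pP: "p \<in> ?P" for p
  proof
    assume "m \<subseteq> p"
    obtain A x where x: "A \<in> \<A>" "prime_idl p" "p = colon A x" "x \<in> S"
      using pP unfolding associated_primes_def by blast
    have "x \<in> A" using A(2)[OF x(1)] x(3,4) \<open>m \<subseteq> p\<close> by (auto simp: no_socle_def colon_def)
    then show False using x by (auto simp: prime_idl_def colon_def)
  qed
  moreover have "finite ?P" using fin finite_associated_primes[OF assms(1)] A by auto
  moreover have "prime_idl p" if "p \<in> ?P" for p using that by (auto simp: associated_primes_def)
  ultimately obtain f where f: "f \<in> m" "\<forall>p\<in>?P. f \<notin> p" using prime_avoidance[OF m, of ?P] by blast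
  have "nonzerodivisor_mod A f" if "A \<in> \<A>" for A
    unfolding nonzerodivisor_mod_def
    using zero_divisor_in_associated_prime[OF assms(1) A(1)[OF that], of _ f] f that idlD(1)[OF m]
    by blast
  then show ?thesis using f by blast
qed

section \<open>Exchange of regular sequences\<close>

lemma nonzerodivisor_no_socle: "f \<in> m \<Longrightarrow> nonzerodivisor_mod A f \<Longrightarrow> no_socle m A"
  by (auto simp: no_socle_def nonzerodivisor_mod_def)

text \<open>
  If \<open>m\<close> kills \<open>x\<close> modulo \<open>A + (y)\<close>, write \<open>f x \<equiv> z y\<close> modulo \<open>A\<close>.  Then \<open>m\<close> kills \<open>z\<close> modulo \<open>A + (f)\<close>, because
  \<open>y s z \<equiv> s f x\<close> is a multiple of \<open>f y\<close> for all \<open>s \<in> m\<close> and \<open>y\<close> can be cancelled.  So \<open>z\<close> is a multiple of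
  \<open>f\<close>, and cancelling \<open>f\<close> shows that \<open>x\<close> is a multiple of \<open>y\<close>.
\<close>

lemma socle_exchange:
  assumes A: "idl A" and m: "idl m" and f: "f \<in> m" "nonzerodivisor_mod A f"
    and y: "y \<in> m" "nonzerodivisor_mod A y" and soc: "no_socle m (adjoin A f)"
  shows "no_socle m (adjoin A y)"
  unfolding no_socle_def
proof (intro ballI impI)
  fix x assume x: "x \<in> S" "\<forall>s\<in>m. s * x \<in> adjoin A y"
  have fS: "f \<in> S" and yS: "y \<in> S" using f y idlD(1)[OF m] by auto
  obtain a z where z: "a \<in> A" "z \<in> S" "f * x = a + z * y"
    using x f(1) adjoinE by metis
  have "\<forall>s\<in>m. s * z \<in> adjoin A f"
  proof
    fix s assume s: "s \<in> m"
    then have sS: "s \<in> S" using idlD(1)[OF m] by auto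
    obtain b w where w: "b \<in> A" "w \<in> S" "s * x = b + w * y"
      using x s adjoinE by metis
    have "y * (s * z - w * f) = s * (z * y) - f * (w * y)" by (simp add: algebra_simps)
    also have "\<dots> = s * (f * x - a) - f * (s * x - b)" using z w by simp
    also have "\<dots> = f * b - s * a" by (simp add: algebra_simps)
    finally have "y * (s * z - w * f) \<in> A"
      using idl_diff[OF A] idlD(4)[OF A] z w fS sS by auto
    then have "s * z - w * f \<in> A" using y(2) sS z w fS by (auto simp: nonzerodivisor_mod_def)
    moreover have "s * z = (s * z - w * f) + w * f" by simp
    ultimately show "s * z \<in> adjoin A f" unfolding adjoin_def using w by blast
  qed
  then have "z \<in> adjoin A f" using soc z by (auto simp: no_socle_def)
  then obtain c v where v: "c \<in> A" "v \<in> S" "z = c + v * f" by (auto elim: adjoinE)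
  have "f * (x - v * y) = a + c * y" using z v by (simp add: algebra_simps)
  then have "f * (x - v * y) \<in> A" using idlD(3,5)[OF A] z v yS by auto
  then have "x - v * y \<in> A" using f(2) x yS v by (auto simp: nonzerodivisor_mod_def)
  moreover have "x = (x - v * y) + v * y" by simp
  ultimately show "x \<in> adjoin A y" unfolding adjoin_def using v by blast
qed

text \<open>
  One half of the permutability of \<open>f, h\<close>.  The other half, that \<open>h\<close> is regular modulo \<open>A\<close>, can fail and has
  to come from the choice of \<open>h\<close>.
\<close>

lemma nonzerodivisor_swap:
  assumes A: "idl A" and f: "nonzerodivisor_mod A f" and h: "nonzerodivisor_mod (adjoin A f) h"
  shows "nonzerodivisor_mod (adjoin A h) f"
  unfolding nonzerodivisor_mod_def
proof (intro conjI ballI impI)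
  show fS: "f \<in> S" using f by (simp add: nonzerodivisor_mod_def)
  have hS: "h \<in> S" using h by (simp add: nonzerodivisor_mod_def)
  fix u assume u: "u \<in> S" "f * u \<in> adjoin A h"
  then obtain a v where v: "a \<in> A" "v \<in> S" "f * u = a + v * h" by (auto elim: adjoinE)
  have "h * v = - a + u * f" using v by (simp add: algebra_simps)
  then have "h * v \<in> adjoin A f" unfolding adjoin_def using u v idl_uminus[OF A] by blast
  then have "v \<in> adjoin A f" using h v by (auto simp: nonzerodivisor_mod_def)
  then obtain b w where w: "b \<in> A" "w \<in> S" "v = b + w * f" by (auto elim: adjoinE)
  have "f * (u - w * h) = a + b * h" using v w by (simp add: algebra_simps)
  then have "f * (u - w * h) \<in> A" using idlD(3,5)[OF A] v w hS by auto
  then have "u - w * h \<in> A" using f u w hS by (auto simp: nonzerodivisor_mod_def)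
  moreover have "u = (u - w * h) + w * h" by simp
  ultimately show "u \<in> adjoin A h" unfolding adjoin_def using w by blast
qed

text \<open>
  Regular sequences on \<open>S/A\<close>, without the condition that the quotient by the sequence is nonzero.
\<close>

fun regular_mod :: "'a set \<Rightarrow> 'a list \<Rightarrow> bool" where
  "regular_mod A [] \<longleftrightarrow> True"
| "regular_mod A (f # fs) \<longleftrightarrow> nonzerodivisor_mod A f \<and> regular_mod (adjoin A f) fs"

text \<open>
  Rees' theorem in the form of an exchange property.  By induction any element \<open>h\<close> that is regular modulo
  \<open>A + (f)\<close> can be brought into the second place; if it is also regular modulo \<open>A\<close> it can be swapped with \<open>f\<close>.
  A second inductive step, modulo \<open>A + (h)\<close>, replaces \<open>f\<close> by \<open>y\<close>, and swapping \<open>h\<close> with \<open>y\<close> puts \<open>y\<close> in front.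
\<close>

theorem regular_exchange:
  assumes noetherian and m: "idl m"
  shows "idl A \<Longrightarrow> regular_mod A fs \<Longrightarrow> set fs \<subseteq> m \<Longrightarrow> length fs = Suc r \<Longrightarrow>
    y \<in> m \<Longrightarrow> nonzerodivisor_mod A y \<Longrightarrow>
    \<exists>gs. length gs = r \<and> set gs \<subseteq> m \<and> regular_mod (adjoin A y) gs"
proof (induction r arbitrary: A fs y)
  case 0
  show ?case by (rule exI[of _ "[]"]) simp
next
  case (Suc r)
  obtain f f2 rest where fs: "fs = f # f2 # rest" using Suc.prems(4)
    by (metis length_Suc_conv)
  note A = Suc.prems(1)
  have f: "f \<in> m" "nonzerodivisor_mod A f" "f \<in> S"
    and f2: "f2 \<in> m" "nonzerodivisor_mod (adjoin A f) f2"
    and y: "y \<in> m" "nonzerodivisor_mod A y" "y \<in> S"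
    using Suc.prems fs idlD(1)[OF m] by auto
  have Af: "idl (adjoin A f)" and Ay: "idl (adjoin A y)" using idl_adjoin[OF A] f y by auto
  have "no_socle m A" "no_socle m (adjoin A f)"
    using nonzerodivisor_no_socle f f2 by auto
  moreover have "no_socle m (adjoin A y)"
    using socle_exchange[OF A m f(1,2) y(1,2)] calculation by auto
  \<comment> \<open>h is the bridge from f to y: first f, h, ..., then h, f, ..., then h, y, ..., then y, h, ...\<close>
  ultimately obtain h where h: "h \<in> m" "nonzerodivisor_mod A h"
      "nonzerodivisor_mod (adjoin A f) h" "nonzerodivisor_mod (adjoin A y) h"
    using common_nonzerodivisor[OF assms(1) m, of "{A, adjoin A f, adjoin A y}"] A Af Ay by auto
  have Ah: "idl (adjoin A h)" using idl_adjoin[OF A] h idlD(1)[OF m] by auto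
  obtain gs1 where gs1: "length gs1 = r" "set gs1 \<subseteq> m" "regular_mod (adjoin (adjoin A f) h) gs1"
    using Suc.IH[OF Af, of "f2 # rest" h] Suc.prems fs h by auto
  have "regular_mod (adjoin A h) (f # gs1)"
    using gs1 nonzerodivisor_swap[OF A f(2) h(3)] adjoin_commute[of A f h] by simp
  then obtain gs2 where gs2: "length gs2 = r" "set gs2 \<subseteq> m" "regular_mod (adjoin (adjoin A h) y) gs2"
    using Suc.IH[OF Ah, of "f # gs1" y] gs1 f(1) y(1) nonzerodivisor_swap[OF A y(2) h(4)] by auto
  show ?case
    by (rule exI[of _ "h # gs2"]) (use gs2 h adjoin_commute[of A y h] in auto)
qed

end

text \<open>
  A surjective homomorphism whose kernel lies in \<open>A\<close> induces an isomorphism of the quotients modulo \<open>A\<close>.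
  The condition on the kernel is stated in the form that survives adjoining elements to \<open>A\<close>.
\<close>

lemma regular_mod_hom:
  fixes \<pi> :: "'a::comm_ring_1 \<Rightarrow> 'b::comm_ring_1"
  assumes "unital_subring S" "unital_subring S'"
    and surj: "\<pi> ` S = S'"
    and hom: "\<And>a b. a \<in> S \<Longrightarrow> b \<in> S \<Longrightarrow> \<pi> (a + b) = \<pi> a + \<pi> b" 
      "\<And>a b. a \<in> S \<Longrightarrow> b \<in> S \<Longrightarrow> \<pi> (a * b) = \<pi> a * \<pi> b"
  shows "unital_subring.idl S A \<Longrightarrow> (\<And>a b. a \<in> A \<Longrightarrow> b \<in> S \<Longrightarrow> \<pi> a = \<pi> b \<Longrightarrow> b \<in> A) \<Longrightarrow>
    set gs \<subseteq> S \<Longrightarrow>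
    unital_subring.regular_mod S' (\<pi> ` A) (map \<pi> gs) \<longleftrightarrow> unital_subring.regular_mod S A gs"
proof (induction gs arbitrary: A)
  case Nil
  then show ?case using assms(1,2) by (simp add: unital_subring.regular_mod.simps)
next
  case (Cons f gs)
  interpret S: unital_subring S by fact
  interpret S': unital_subring S' by fact
  note A = Cons.prems(1) and sat = Cons.prems(2)
  have f: "f \<in> S" and gs: "set gs \<subseteq> S" using Cons.prems by auto
  have mem: "\<pi> x \<in> \<pi> ` A \<longleftrightarrow> x \<in> A" if "x \<in> S" for x
    using sat that by fastforce
  have im: "\<pi> ` S.adjoin A f = S'.adjoin (\<pi> ` A) (\<pi> f)"
  proof -
    have "\<pi> ` S.adjoin A f = (\<lambda>(a, r). \<pi> (a + r * f)) ` (A \<times> S)"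
      by (force simp: S.adjoin_def)
    also have "\<dots> = (\<lambda>(a, r). \<pi> a + \<pi> r * \<pi> f) ` (A \<times> S)"
      using f S.idlD(1)[OF A] by (intro image_cong) (auto simp: hom)
    also have "\<dots> = S'.adjoin (\<pi> ` A) (\<pi> f)" 
    proof -
      have "S'.adjoin (\<pi> ` A) (\<pi> f) = {a + r * \<pi> f | a r. a \<in> \<pi> ` A \<and> r \<in> \<pi> ` S}"
        unfolding S'.adjoin_def surj ..
      then show ?thesis by force
    qed
    finally show ?thesis .
  qed
  have "b \<in> S.adjoin A f" if ab: "a \<in> S.adjoin A f" "b \<in> S" "\<pi> a = \<pi> b" for a b
  proof -
    obtain c r where c: "c \<in> A" "r \<in> S" "a = c + r * f" using ab(1) by (auto elim: S.adjoinE)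
    then have aS: "a \<in> S" using S.idlD(1)[OF A] f by auto
    have "\<pi> 0 = \<pi> 0 + \<pi> 0" using hom(1)[of 0 0] by simp
    then have "\<pi> 0 = 0" by simp
    moreover have "\<pi> ((b - a) + a) = \<pi> (b - a) + \<pi> a" using aS that by (intro hom) auto
    ultimately have "\<pi> (b - a) = \<pi> 0" using that by simp
    then have "b - a \<in> A" using sat[of 0 "b - a"] S.idlD(2)[OF A] aS that by auto
    then have "(b - a) + c \<in> A" by (rule S.idlD(3)[OF A _ c(1)])
    moreover have "b = ((b - a) + c) + r * f" using c by simp
    ultimately show ?thesis unfolding S.adjoin_def using c by blast
  qed
  then have "S'.regular_mod (\<pi> ` S.adjoin A f) (map \<pi> gs) \<longleftrightarrow> S.regular_mod (S.adjoin A f) gs"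
    by (intro Cons.IH S.idl_adjoin A f gs)
  moreover have "S'.nonzerodivisor_mod (\<pi> ` A) (\<pi> f) \<longleftrightarrow> S.nonzerodivisor_mod A f"
  proof -
    have "S'.nonzerodivisor_mod (\<pi> ` A) (\<pi> f) \<longleftrightarrow>
        \<pi> f \<in> \<pi> ` S \<and> (\<forall>g\<in>\<pi> ` S. \<pi> f * g \<in> \<pi> ` A \<longrightarrow> g \<in> \<pi> ` A)"
      unfolding S'.nonzerodivisor_mod_def surj ..
    then show ?thesis
      unfolding S.nonzerodivisor_mod_def using f by (auto simp: mem hom(2)[symmetric])
  qed
  ultimately show ?case by (simp add: im)
qed

section \<open>Subspaces spanned by monomials\<close>

definition mons :: "nat set \<Rightarrow> monom set" where
  "mons Z = {u. set_mset u \<subseteq> Z}"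

definition kspan :: "monom set \<Rightarrow> 'k::field mpoly set" where
  "kspan E = {p. Poly_Mapping.keys p \<subseteq> E}"

text \<open>
  The projection onto the subspace spanned by \<open>E\<close> along the other monomials.
\<close>

definition restr :: "monom set \<Rightarrow> 'k::field mpoly \<Rightarrow> 'k mpoly" where
  "restr E = Poly_Mapping.mapp (\<lambda>u c. if u \<in> E then c else 0)"

text \<open>
  The monomials in the ideal of \<open>K[Z]\<close> that is generated by the monomials of \<open>U\<close>.
\<close>

definition multiples :: "nat set \<Rightarrow> monom set \<Rightarrow> monom set" where
  "multiples Z U = {u \<in> mons Z. \<exists>g\<in>U. g \<subseteq># u}"

lemma carrier_polyring: "carrier (polyring Z) = kspan (mons Z)"
  by (auto simp: polyring_def kspan_def mons_def)

lemma polyring_sel [simp]: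
  "(\<otimes>\<^bsub>polyring Z\<^esub>) = (*)" "(\<oplus>\<^bsub>polyring Z\<^esub>) = (+)"
  "\<one>\<^bsub>polyring Z\<^esub> = 1" "\<zero>\<^bsub>polyring Z\<^esub> = 0"
  by (simp_all add: polyring_def)

lemma mons_add [simp]: "u + v \<in> mons Z \<longleftrightarrow> u \<in> mons Z \<and> v \<in> mons Z"
  by (auto simp: mons_def)

lemma mons_empty [simp]: "{#} \<in> mons Z"
  by (simp add: mons_def)

lemma mons_subset_mset: "u \<in> mons Z \<Longrightarrow> v \<subseteq># u \<Longrightarrow> v \<in> mons Z"
  by (auto simp: mons_def dest: set_mset_mono)

lemma lookup_restr [simp]:
  "Poly_Mapping.lookup (restr E p) u = (if u \<in> E then Poly_Mapping.lookup p u else 0)"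
  by (auto simp: restr_def lookup_mapp when_def in_keys_iff)

lemma keys_restr [simp]: "Poly_Mapping.keys (restr E p) = Poly_Mapping.keys p \<inter> E"
  by (auto simp: in_keys_iff split: if_splits)

lemma restr_add: "restr E (p + q) = restr E p + restr E q"
  by (rule poly_mapping_eqI) (simp add: lookup_add)

lemma restr_zero [simp]: "restr E 0 = 0"
  by (rule poly_mapping_eqI) simp

lemma restr_eq_self: "p \<in> kspan E \<Longrightarrow> restr E p = p"
  by (rule poly_mapping_eqI) (auto simp: kspan_def in_keys_iff)

lemma restr_eq_zero_iff: "restr E p = 0 \<longleftrightarrow> Poly_Mapping.keys p \<inter> E = {}"
  by (metis keys_eq_empty keys_restr)

lemma restr_single: "restr E (Poly_Mapping.single u c) = (if u \<in> E then Poly_Mapping.single u c else 0)"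
  by (rule poly_mapping_eqI) (auto simp: lookup_single when_def)

lemma restr_mem_kspan: "restr E p \<in> kspan E"
  by (auto simp: kspan_def)

lemma kspan_zero [simp]: "0 \<in> kspan E"
  by (simp add: kspan_def)

lemma kspan_add [simp]: "p \<in> kspan E \<Longrightarrow> q \<in> kspan E \<Longrightarrow> p + q \<in> kspan E"
  using Poly_Mapping.keys_add[of p q] by (auto simp: kspan_def)

lemma keys_uminus_mpoly [simp]: "Poly_Mapping.keys (- (p::'k::field mpoly)) = Poly_Mapping.keys p"
  by (auto simp: in_keys_iff)

lemma kspan_uminus [simp]: "- p \<in> kspan E \<longleftrightarrow> p \<in> kspan E"
  by (simp add: kspan_def)

lemma kspan_sum: "(\<And>i. i \<in> A \<Longrightarrow> f i \<in> kspan E) \<Longrightarrow> sum f A \<in> kspan E"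
  by (induction A rule: infinite_finite_induct) auto

lemma kspan_mono: "E \<subseteq> F \<Longrightarrow> p \<in> kspan E \<Longrightarrow> p \<in> kspan F"
  by (auto simp: kspan_def)

lemma kspan_mult:
  assumes "p \<in> kspan E" "q \<in> kspan F" "\<And>u v. u \<in> E \<Longrightarrow> v \<in> F \<Longrightarrow> u + v \<in> G"
  shows "p * q \<in> kspan G"
  using assms keys_mult[of p q] unfolding kspan_def by blast

lemma single_mem_kspan: "c \<noteq> 0 \<Longrightarrow> Poly_Mapping.single u c \<in> kspan E \<longleftrightarrow> u \<in> E"
  by (simp add: kspan_def)

lemma mon_mem_kspan [simp]: "mon u \<in> kspan E \<longleftrightarrow> u \<in> E"
  by (simp add: mon_def single_mem_kspan)

lemma keys_mon [simp]: "Poly_Mapping.keys (mon u :: 'k::field mpoly) = {u}"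
  by (simp add: mon_def)

lemma mon_mult: "mon u * mon v = mon (u + v)"
  by (simp add: mon_def mult_single)

lemma mon_empty [simp]: "mon {#} = 1"
  by (simp add: mon_def zero_multiset_def[symmetric])

lemma one_mem_kspan [simp]: "(1 :: 'k::field mpoly) \<in> kspan E \<longleftrightarrow> {#} \<in> E"
  using mon_mem_kspan[of "{#}", where 'a = 'k] by simp

lemma poly_eq_sum_single:
  "(p :: 'k::field mpoly) = (\<Sum>u\<in>Poly_Mapping.keys p. Poly_Mapping.single u (Poly_Mapping.lookup p u))"
  by (rule poly_mapping_eqI)
    (auto simp: lookup_sum lookup_single when_def in_keys_iff sum.delta')

lemma mpoly_induct [case_names single zero add]:
  fixes p :: "'k::field mpoly"
  assumes "\<And>u c. u \<in> Poly_Mapping.keys p \<Longrightarrow> P (Poly_Mapping.single u c)" "P 0"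
    "\<And>p q. P p \<Longrightarrow> P q \<Longrightarrow> P (p + q)"
  shows "P p"
proof -
  have "finite A \<Longrightarrow> A \<subseteq> Poly_Mapping.keys p \<Longrightarrow>
    P (\<Sum>u\<in>A. Poly_Mapping.single u (Poly_Mapping.lookup p u))" for A
    by (induction A rule: finite_induct) (auto intro: assms)
  from this[of "Poly_Mapping.keys p"] show ?thesis
    by (simp add: poly_eq_sum_single[symmetric])
qed

lemma lookup_single_mult:
  fixes p :: "'k::field mpoly"
  shows "Poly_Mapping.lookup (Poly_Mapping.single v c * p) u =
    (if v \<subseteq># u then c * Poly_Mapping.lookup p (u - v) else 0)"
proof (induction p rule: mpoly_induct)
  case (single w d)
  have "v + w = u \<longleftrightarrow> v \<subseteq># u \<and> w = u - v" by auto
  then show ?case by (auto simp: mult_single lookup_single when_def)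
next
  case (add p q)
  then show ?case by (auto simp: distrib_left lookup_add)
qed simp

lemma keys_single_mult:
  "c \<noteq> 0 \<Longrightarrow> Poly_Mapping.keys (Poly_Mapping.single v c * p) = (+) v ` Poly_Mapping.keys (p::'k::field mpoly)"
  by (auto simp: in_keys_iff lookup_single_mult image_iff mset_subset_eq_exists_conv split: if_splits)

lemma mon_dvd_iff: "(mon v :: 'k::field mpoly) dvd mon u \<longleftrightarrow> v \<subseteq># u"
proof
  assume "(mon v :: 'k mpoly) dvd mon u"
  then obtain q :: "'k mpoly" where q: "mon u = mon v * q" by (auto elim: dvdE)
  have "u \<in> (+) v ` Poly_Mapping.keys q"
    using keys_single_mult[of 1 v q] q keys_mon[where 'k = 'k, of u] unfolding mon_def by auto
  then show "v \<subseteq># u" by auto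
next
  assume "v \<subseteq># u"
  then show "(mon v :: 'k mpoly) dvd mon u"
    by (metis dvdI mon_mult subset_mset.add_diff_inverse)
qed

lemma unital_subring_kspan_mons: "unital_subring (kspan (mons Z) :: 'k::field mpoly set)"
proof
qed (auto intro: kspan_mult)

interpretation polys: unital_subring "kspan (mons Z) :: 'k::field mpoly set" for Z
  by (rule unital_subring_kspan_mons)

lemma cring_polyring: "cring (polyring Z :: 'k::field mpoly ring)"
proof (rule cringI)
  show "abelian_group (polyring Z :: 'k mpoly ring)"
  proof (rule abelian_groupI)
    fix x assume "x \<in> carrier (polyring Z :: 'k mpoly ring)"
    then show "\<exists>y\<in>carrier (polyring Z). y \<oplus>\<^bsub>polyring Z\<^esub> x = \<zero>\<^bsub>polyring Z\<^esub>"
      by (intro bexI[of _ "- x"]) (auto simp: carrier_polyring)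
  qed (auto simp: carrier_polyring algebra_simps)
  show "Group.comm_monoid (polyring Z :: 'k mpoly ring)"
    by (rule comm_monoidI) (auto simp: carrier_polyring algebra_simps)
qed (auto simp: carrier_polyring algebra_simps)

lemma ideal_polyring:
  assumes "polys.idl Z A"
  shows "ideal A (polyring Z :: 'k::field mpoly ring)"
proof (rule idealI)
  interpret R: cring "polyring Z :: 'k mpoly ring" by (rule cring_polyring)
  show "ring (polyring Z :: 'k mpoly ring)" by (rule R.ring_axioms)
  have "a \<ominus>\<^bsub>polyring Z\<^esub> b = a - b" if "a \<in> kspan (mons Z)" "b \<in> kspan (mons Z)" for a b :: "'k mpoly"
  proof -
    have "\<ominus>\<^bsub>polyring Z\<^esub> b = - b"
      using that by (intro R.minus_equality) (auto simp: carrier_polyring)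
    then show ?thesis by (simp add: a_minus_def)
  qed
  show "subgroup A (add_monoid (polyring Z :: 'k mpoly ring))"
  proof (rule R.add.subgroupI)
    fix a assume "a \<in> A"
    then have "a \<in> kspan (mons Z)" using polys.idlD(1)[OF assms] by auto
    then have "\<ominus>\<^bsub>polyring Z\<^esub> a = - a" by (intro R.minus_equality) (auto simp: carrier_polyring)
    then show "\<ominus>\<^bsub>polyring Z\<^esub> a \<in> A" using polys.idl_uminus[OF assms \<open>a \<in> A\<close>] by simp
  qed (use polys.idlD[OF assms] in \<open>auto simp: carrier_polyring\<close>)
qed (use polys.idlD[OF assms] in \<open>auto simp: carrier_polyring\<close>)

lemma idl_kspan_multiples: "polys.idl Z (kspan (multiples Z U) :: 'k::field mpoly set)"
proof -
  have "r * a \<in> kspan (multiples Z U)" if "r \<in> kspan (mons Z)" "a \<in> kspan (multiples Z U)" for r a :: "'k mpoly"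
    using that by (rule kspan_mult) (auto simp: multiples_def intro: subset_mset.order_trans[OF _ mset_subset_eq_add_right])
  then show ?thesis
    unfolding polys.idl_def by (auto simp: kspan_def multiples_def dest: keys_add[THEN subsetD])
qed

lemma genideal_mon:
  assumes "U \<subseteq> mons Z"
  shows "genideal (polyring Z) (mon ` U) = (kspan (multiples Z U) :: 'k::field mpoly set)"
proof
  interpret R: cring "polyring Z :: 'k mpoly ring" by (rule cring_polyring)
  have sub: "mon ` U \<subseteq> carrier (polyring Z :: 'k mpoly ring)"
    using assms by (auto simp: carrier_polyring)
  show "genideal (polyring Z) (mon ` U) \<subseteq> (kspan (multiples Z U) :: 'k mpoly set)"
    using assms by (intro R.genideal_minimal ideal_polyring idl_kspan_multiples) (auto simp: multiples_def)
  interpret I: ideal "genideal (polyring Z) (mon ` U :: 'k mpoly set)" "polyring Z"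
    by (rule R.genideal_ideal[OF sub])
  have 0: "0 \<in> genideal (polyring Z) (mon ` U :: 'k mpoly set)"
    using I.zero_closed by simp
  show "(kspan (multiples Z U) :: 'k mpoly set) \<subseteq> genideal (polyring Z) (mon ` U)"
  proof
    fix p :: "'k mpoly" assume p: "p \<in> kspan (multiples Z U)"
    show "p \<in> genideal (polyring Z) (mon ` U)"
    proof (induction p rule: mpoly_induct)
      case (single u c)
      then have "u \<in> multiples Z U" using p by (auto simp: kspan_def)
      then obtain g where g: "u \<in> mons Z" "g \<in> U" "g \<subseteq># u" by (auto simp: multiples_def)
      have "Poly_Mapping.single (u - g) c \<in> kspan (mons Z)"
        using g mons_subset_mset[OF g(1), of "u - g"] by (cases "c = 0") (auto simp: single_mem_kspan)
      then have "Poly_Mapping.single (u - g) c * mon g \<in> genideal (polyring Z) (mon ` U)"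
        using I.I_l_closed[of "mon g" "Poly_Mapping.single (u - g) c"] R.genideal_self[OF sub] g(2)
        by (auto simp: carrier_polyring)
      then show ?case using g by (simp add: mon_def mult_single)
    next
      case (add p q)
      then show ?case using I.a_closed by simp
    qed (rule 0)
  qed
qed

section \<open>Polynomial rings are Noetherian\<close>

text \<open>
  Passing to a subsequence once for every variable makes all exponents nondecreasing.
\<close>

lemma dickson:
  fixes u :: "nat \<Rightarrow> monom"
  assumes Z: "finite Z" and u: "\<And>i. u i \<in> mons Z"
  shows "\<exists>i j. i < j \<and> u i \<subseteq># u j"
proof -
  have mono: "\<exists>r. strict_mono r \<and> incseq (\<lambda>i. a (r i))" for a :: "nat \<Rightarrow> nat"
  proof -
    obtain r where r: "strict_mono (r :: nat \<Rightarrow> nat)" "monoseq (\<lambda>i. a (r i))" using seq_monosub by blast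
    \<comment> \<open>a nonincreasing sequence of natural numbers is constant from its minimum on\<close>
    show ?thesis
    proof (cases "incseq (\<lambda>i. a (r i))")
      case False
      then have dec: "decseq (\<lambda>i. a (r i))" using r(2) by (simp add: monoseq_iff)
      obtain k where k: "\<And>i. a (r k) \<le> a (r i)"
        using ex_has_least_nat[of "\<lambda>_. True" 0 "\<lambda>i. a (r i)"] by auto
      have "a (r (k + i)) = a (r k)" for i
        using k[of "k + i"] decseqD[OF dec, of k "k + i"] by simp
      then have "incseq (\<lambda>i. a (r (k + i)))" by (simp add: incseq_def)
      moreover have "strict_mono (\<lambda>i. r (k + i))" using r(1) by (simp add: strict_mono_def)
      ultimately show ?thesis by blast
    qed (use r in blast)
  qed
  have "\<exists>r. strict_mono r \<and> (\<forall>z\<in>Z. incseq (\<lambda>i. count (u (r i)) z))"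
    using Z
  proof induction
    case empty
    show ?case by (rule exI[of _ id]) (simp add: strict_mono_def)
  next
    case (insert z Z)
    then obtain r where r: "strict_mono r" "\<forall>z\<in>Z. incseq (\<lambda>i. count (u (r i)) z)" by blast
    obtain s where s: "strict_mono s" "incseq (\<lambda>i. count (u (r (s i))) z)"
      using mono[of "\<lambda>i. count (u (r i)) z"] by blast
    have "incseq (\<lambda>i. count (u (r (s i))) z')" if "z' \<in> Z" for z'
      using r(2) that s(1) by (auto simp: incseq_def strict_mono_less_eq)
    then show ?case using r s by (intro exI[of _ "r \<circ> s"]) (auto simp: strict_mono_def)
  qed
  then obtain r where r: "strict_mono r" "\<forall>z\<in>Z. incseq (\<lambda>i. count (u (r i)) z)" by blast
  have "count (u (r 0)) z \<le> count (u (r 1)) z" for z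
  proof (cases "z \<in> Z")
    case False
    then have "z \<notin># u (r 0)" using u by (auto simp: mons_def)
    then show ?thesis by (simp add: not_in_iff)
  qed (use r(2) in \<open>auto simp: incseq_def\<close>)
  then have "u (r 0) \<subseteq># u (r 1)" by (simp add: subseteq_mset_def)
  moreover have "r 0 < r 1" using r(1) by (simp add: strict_mono_def)
  ultimately show ?thesis by blast
qed

lemma finite_antichain:
  assumes "finite Z" "U \<subseteq> mons Z" "\<And>u v. u \<in> U \<Longrightarrow> v \<in> U \<Longrightarrow> u \<subseteq># v \<Longrightarrow> u = v"
  shows "finite U"
proof (rule ccontr)
  assume "infinite U"
  then obtain f :: "nat \<Rightarrow> monom" where f: "inj f" "range f \<subseteq> U" using infinite_countable_subset by blast
  then obtain i j where "i < j" "f i \<subseteq># f j" using dickson[OF assms(1), of f] assms(2) by blast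
  then show False using assms(3)[of "f i" "f j"] f by (auto dest: injD)
qed

text \<open>
  The leading monomial with respect to the well-ordering of multisets (for \<open>p = 0\<close> the value is arbitrary).
\<close>

definition lead :: "'k::field mpoly \<Rightarrow> monom" where
  "lead p = Max (Poly_Mapping.keys p)"

text \<open>
  In a strictly ascending chain of ideals choose \<open>p i\<close> in the \<open>i\<close>-th step with the smallest leading
  monomial.  By Dickson's lemma one leading monomial divides a later one, and cancelling the later one
  contradicts its minimality.
\<close>

lemma noetherian_polys:
  assumes "finite Z"
  shows "unital_subring.noetherian (kspan (mons Z) :: 'k::field mpoly set)"
  unfolding polys.noetherian_def wf_iff_no_infinite_down_chain
proof
  assume "\<exists>f. \<forall>i. (f (Suc i), f i) \<in> {(B, A). polys.idl Z A \<and> polys.idl Z B \<and> A \<subset> (B :: 'k mpoly set)}"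
  then obtain f :: "nat \<Rightarrow> 'k mpoly set" where
    "\<forall>i. (f (Suc i), f i) \<in> {(B, A). polys.idl Z A \<and> polys.idl Z B \<and> A \<subset> B}" by blast
  then have f: "\<And>i. polys.idl Z (f i)" "\<And>i. f i \<subset> f (Suc i)" by auto
  have mono: "f i \<subseteq> f j" if "i \<le> j" for i j
    by (rule lift_Suc_mono_le[of f, OF psubset_imp_subset[OF f(2)] that])
  have "\<exists>p. p \<in> f (Suc i) - f i \<and> (\<forall>q\<in>f (Suc i) - f i. lead p \<le> lead q)" for i
  proof -
    obtain p0 where "p0 \<in> f (Suc i) - f i" using f(2) by blast
    then have "\<exists>m. m \<in> lead ` (f (Suc i) - f i)" by blast
    then have "(LEAST m. m \<in> lead ` (f (Suc i) - f i)) \<in> lead ` (f (Suc i) - f i)" by (rule LeastI_ex)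
    then obtain p where "p \<in> f (Suc i) - f i" "lead p = (LEAST m. m \<in> lead ` (f (Suc i) - f i))" by auto
    then show ?thesis by (metis (no_types, lifting) Least_le imageI)
  qed
  then obtain p where p: "\<And>i. p i \<in> f (Suc i)" "\<And>i. p i \<notin> f i"
      "\<And>i q. q \<in> f (Suc i) \<Longrightarrow> q \<notin> f i \<Longrightarrow> lead (p i) \<le> lead q"
    by (metis DiffD1 DiffD2 DiffI)
  have nz: "q \<noteq> 0" if "q \<notin> f i" for q i using polys.idlD(2)[OF f(1)] that by auto
  have lead_in: "lead q \<in> Poly_Mapping.keys q" if "q \<noteq> 0" for q :: "'k mpoly"
    unfolding lead_def using that by (intro Max_in) auto
  have lead_ge: "u \<le> lead q" if "u \<in> Poly_Mapping.keys q" for q :: "'k mpoly" and u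
    unfolding lead_def using that by (intro Max_ge) auto
  have "lead (p i) \<in> mons Z" for i
    using lead_in[OF nz[OF p(2)]] polys.idlD(1)[OF f(1) p(1)] by (auto simp: kspan_def)
  then obtain i j where ij: "i < j" "lead (p i) \<subseteq># lead (p j)"
    using dickson[OF assms, of "\<lambda>i. lead (p i)"] by blast
  define w where "w = lead (p j) - lead (p i)"
  define c where "c = Poly_Mapping.lookup (p j) (lead (p j)) / Poly_Mapping.lookup (p i) (lead (p i))"
  define g where "g = Poly_Mapping.single w c * p i"
  define q where "q = p j - g"
  have lc: "Poly_Mapping.lookup (p i) (lead (p i)) \<noteq> 0" "Poly_Mapping.lookup (p j) (lead (p j)) \<noteq> 0"
    using lead_in[OF nz[OF p(2)]] by (auto simp: in_keys_iff)
  then have c0: "c \<noteq> 0" by (simp add: c_def)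
  have wlead: "w + lead (p i) = lead (p j)" using ij by (simp add: w_def)
  have "w \<in> mons Z" using \<open>\<And>i. lead (p i) \<in> mons Z\<close>[of j] unfolding wlead[symmetric] by simp
  then have "g \<in> f (Suc i)"
    unfolding g_def using c0 by (intro polys.idlD(4)[OF f(1)] p(1)) (simp add: single_mem_kspan)
  then have g: "g \<in> f j" using mono[of "Suc i" j] ij by auto
  then have q: "q \<in> f (Suc j)" "q \<notin> f j"
    using mono[of j "Suc j"] p polys.idl_diff[OF f(1) p(1)[of j], of g] polys.idlD(3)[OF f(1) _ g, of q]
    by (auto simp: q_def)
  have "Poly_Mapping.keys g = (+) w ` Poly_Mapping.keys (p i)"
    unfolding g_def by (rule keys_single_mult[OF c0])
  then have gle: "u \<le> lead (p j)" if "u \<in> Poly_Mapping.keys g" for u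
    using that lead_ge[of _ "p i"] by (auto simp: wlead[symmetric] intro: add_left_mono)
  have "Poly_Mapping.lookup q (lead (p j)) = 0"
    unfolding q_def g_def lookup_minus lookup_single_mult
    using ij lc by (simp add: c_def w_def subset_mset.diff_diff_right)
  moreover have "lead q \<in> Poly_Mapping.keys q" using lead_in[OF nz[OF q(2)]] .
  moreover have "lead q \<in> Poly_Mapping.keys (p j) \<union> Poly_Mapping.keys g"
    using calculation(2) by (auto simp: q_def in_keys_iff lookup_minus)
  ultimately have "lead q < lead (p j)"
    using gle lead_ge[of "lead q" "p j"] by (auto simp: in_keys_iff order_less_le)
  then show False using p(3)[OF q] by auto
qed

section \<open>Regular sequences and new variables\<close>

lemma (in unital_subring) idl_foldl:
  "idl A \<Longrightarrow> set fs \<subseteq> S \<Longrightarrow> idl (foldl adjoin A fs)"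
  by (induction fs arbitrary: A) (auto simp: idl_adjoin)

lemma (in unital_subring) regular_mod_iff_nth:
  "set fs \<subseteq> S \<Longrightarrow> regular_mod A fs \<longleftrightarrow>
    (\<forall>i<length fs. \<forall>g\<in>S. fs ! i * g \<in> foldl adjoin A (take i fs) \<longrightarrow> g \<in> foldl adjoin A (take i fs))"
  by (induction fs arbitrary: A) (auto simp: All_less_Suc2 nonzerodivisor_mod_def)

lemma (in unital_subring) foldl_adjoin_eq:
  "set fs \<subseteq> S \<Longrightarrow> foldl adjoin A fs =
    {a + (\<Sum>i<length fs. fs ! i * h i) | a h. a \<in> A \<and> h \<in> {..<length fs} \<rightarrow> S}"
proof (induction fs rule: rev_induct)
  case Nil
  then show ?case by auto
next
  case (snoc f fs)
  let ?n = "length fs"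
  have IH: "foldl adjoin A fs = {a + (\<Sum>i<?n. fs ! i * h i) | a h. a \<in> A \<and> h \<in> {..<?n} \<rightarrow> S}"
    using snoc by simp
  have eq: "(\<Sum>i<?n. (fs @ [f]) ! i * h i) = (\<Sum>i<?n. fs ! i * h i)" for h
    by (intro sum.cong) (auto simp: nth_append)
  show ?case (is "?L = ?R")
  proof
    show "?L \<subseteq> ?R"
    proof
      fix x assume "x \<in> ?L"
      then obtain a h r where x: "x = a + (\<Sum>i<?n. fs ! i * h i) + r * f" "a \<in> A" "r \<in> S"
          "h \<in> {..<?n} \<rightarrow> S"
        by (auto simp: IH elim!: adjoinE)
      let ?h = "h(?n := r)"
      have "x = a + (\<Sum>i<length (fs @ [f]). (fs @ [f]) ! i * ?h i)"
        using x(1) eq[of ?h] by (simp add: algebra_simps)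
      moreover have "?h \<in> {..<length (fs @ [f])} \<rightarrow> S" using x(3,4) by (auto simp: Pi_iff less_Suc_eq)
      ultimately show "x \<in> ?R" using x(2) by blast
    qed
    show "?R \<subseteq> ?L"
    proof
      fix x assume "x \<in> ?R"
      then obtain a h where x: "x = a + (\<Sum>i<?n. fs ! i * h i) + h ?n * f" "a \<in> A"
          "h \<in> {..<Suc ?n} \<rightarrow> S"
      proof -
        obtain a h where "x = a + (\<Sum>i<Suc ?n. (fs @ [f]) ! i * h i)" "a \<in> A" "h \<in> {..<Suc ?n} \<rightarrow> S"
          using \<open>x \<in> ?R\<close> by auto
        then show thesis using eq[of h] by (intro that[of a h]) (auto simp: algebra_simps)
      qed
      moreover have "h \<in> {..<?n} \<rightarrow> S" using x(3) by auto
      then have "a + (\<Sum>i<?n. fs ! i * h i) \<in> foldl adjoin A fs"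
        unfolding IH using x(2) by blast
      ultimately show "x \<in> ?L" by (auto simp: adjoin_def[of "foldl adjoin A fs"])
    qed
  qed
qed

text \<open>
  A regular sequence of length \<open>r\<close> in the maximal ideal generated by the variables, on the quotient of \<open>K[Z]\<close>
  by the ideal generated by \<open>U\<close>.  The coefficient field enters only as a type, hence the type argument.
\<close>

definition has_regular_seq :: "'k::field itself \<Rightarrow> nat set \<Rightarrow> monom set \<Rightarrow> nat \<Rightarrow> bool" where
  "has_regular_seq TYPE('k) Z U r \<longleftrightarrow> (\<exists>fs :: 'k mpoly list. length fs = r \<and>
     set fs \<subseteq> kspan (mons Z - {{#}}) \<and> polys.regular_mod Z (kspan (multiples Z U)) fs)"

lemma multiples_insert: "multiples Z (insert v U) = multiples Z U \<union> {u \<in> mons Z. v \<subseteq># u}"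
  by (auto simp: multiples_def)

lemma multiples_subset: "multiples Z U \<subseteq> mons Z"
  by (auto simp: multiples_def)

lemma adjoin_mon:
  assumes "v \<in> mons Z"
  shows "polys.adjoin Z (kspan (multiples Z U)) (mon v) = (kspan (multiples Z (insert v U)) :: 'k::field mpoly set)"
proof (intro equalityI subsetI)
  fix p :: "'k mpoly" assume "p \<in> polys.adjoin Z (kspan (multiples Z U)) (mon v)"
  then obtain a r where *: "a \<in> kspan (multiples Z U)" "r \<in> kspan (mons Z)" "p = a + r * mon v"
    by (auto simp: polys.adjoin_def)
  have "r * mon v \<in> kspan (multiples Z (insert v U))"
    by (rule kspan_mult[OF *(2), of _ "{v}"]) (use assms in \<open>auto simp: multiples_def\<close>)
  moreover have "a \<in> kspan (multiples Z (insert v U))"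
    by (rule kspan_mono[OF _ *(1)]) (auto simp: multiples_insert)
  ultimately show "p \<in> kspan (multiples Z (insert v U))" unfolding *(3) by (rule kspan_add[rotated])
next
  fix p :: "'k mpoly" assume p: "p \<in> kspan (multiples Z (insert v U))"
  let ?B = "polys.adjoin Z (kspan (multiples Z U)) (mon v) :: 'k mpoly set"
  have B: "polys.idl Z ?B" using assms by (intro polys.idl_adjoin idl_kspan_multiples) auto
  show "p \<in> ?B"
  proof (induction p rule: mpoly_induct)
    case (single u c)
    then have u: "u \<in> multiples Z (insert v U)" using p by (auto simp: kspan_def)
    show ?case
    proof (cases "u \<in> multiples Z U")
      case True
      then show ?thesis by (intro polys.subset_adjoin) (auto simp: kspan_def)
    next
      case False
      then have v: "v \<subseteq># u" "u \<in> mons Z" using u by (auto simp: multiples_def)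
      have "Poly_Mapping.single (u - v) c * mon v \<in> ?B"
        using mons_subset_mset[OF v(2), of "u - v"]
        by (intro polys.adjoin_self idl_kspan_multiples) (auto simp: kspan_def)
      then show ?thesis using v by (simp add: mon_def mult_single)
    qed
  qed (use polys.idlD[OF B] in auto)
qed

text \<open>
  Setting the variables outside \<open>Z\<close> to zero is multiplicative.
\<close>

lemma restr_mons_mult: "restr (mons Z) (p * q) = restr (mons Z) p * restr (mons Z) (q :: 'k::field mpoly)"
proof (induction p rule: mpoly_induct)
  case (single u c)
  show ?case
    by (induction q rule: mpoly_induct) (auto simp: mult_single restr_single restr_add distrib_left)
qed (auto simp: restr_add distrib_right)

lemma kspan_nonunits_idl: "polys.idl Z (kspan (mons Z - {{#}}) :: 'k::field mpoly set)"
proof -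
  have "r * a \<in> kspan (mons Z - {{#}})" if "r \<in> kspan (mons Z)" "a \<in> kspan (mons Z - {{#}})"
    for r a :: "'k mpoly"
    using that by (rule kspan_mult) auto
  then show ?thesis unfolding polys.idl_def by (auto simp: kspan_def dest: keys_add[THEN subsetD])
qed

text \<open>
  Both directions compare with the ideal \<open>B = A' + (y)\<close>, whose quotient is the one in the smaller ring:
  from the smaller ring a regular sequence is lifted and \<open>y\<close> is put in front; from the larger ring the
  sequence is exchanged for one that begins with \<open>y\<close>, and the rest is taken modulo \<open>y\<close>.
\<close>

lemma has_regular_seq_insert:
  fixes Z :: "nat set"
  assumes fin: "finite Z" and y: "y \<notin> Z" and U: "U \<subseteq> mons Z"
  shows "has_regular_seq TYPE('k::field) (insert y Z) U (Suc r) \<longleftrightarrow> has_regular_seq TYPE('k) Z U r"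
proof -
  let ?Z = "insert y Z" and ?\<pi> = "restr (mons Z) :: 'k mpoly \<Rightarrow> 'k mpoly"
  let ?A = "kspan (multiples Z U) :: 'k mpoly set" and ?A' = "kspan (multiples ?Z U) :: 'k mpoly set"
  let ?y = "mon {#y#} :: 'k mpoly"
  define B where "B = polys.adjoin ?Z ?A' ?y"
  have yZ: "{#y#} \<in> mons ?Z" by (simp add: mons_def)
  have B: "B = kspan (multiples ?Z (insert {#y#} U))" unfolding B_def by (rule adjoin_mon[OF yZ])
  have mons_insert: "u \<in> mons Z \<or> {#y#} \<subseteq># u" if "u \<in> mons ?Z" for u
    using that by (auto simp: mons_def)
  have disj: "mons Z \<inter> {u \<in> mons ?Z. {#y#} \<subseteq># u} = {}"
    using y by (auto simp: mons_def)
  have mult: "mons Z \<inter> multiples ?Z U = multiples Z U"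
    unfolding mons_def multiples_def by blast
  have \<pi>B: "?\<pi> ` B = ?A"
  proof (intro equalityI subsetI)
    fix p assume "p \<in> ?\<pi> ` B"
    then obtain b where b: "p = ?\<pi> b" "b \<in> B" by blast
    have "Poly_Mapping.keys b \<subseteq> multiples ?Z U \<union> {u \<in> mons ?Z. {#y#} \<subseteq># u}"
      using b(2) unfolding B multiples_insert[of ?Z "{#y#}" U] kspan_def by blast
    then have "Poly_Mapping.keys p \<subseteq> multiples Z U"
      unfolding b(1) keys_restr mult[symmetric] using disj by blast
    then show "p \<in> ?A" by (simp add: kspan_def)
  next
    fix p assume p: "p \<in> ?A"
    have "p \<in> B" unfolding B
      by (rule kspan_mono[OF _ p]) (use mult in \<open>auto simp only: multiples_insert[of ?Z "{#y#}" U]\<close>)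
    moreover have "?\<pi> p = p" by (rule restr_eq_self[OF kspan_mono[OF multiples_subset p]])
    ultimately show "p \<in> ?\<pi> ` B" by force
  qed
  have sat: "b \<in> B" if "a \<in> B" "b \<in> kspan (mons ?Z)" "?\<pi> a = ?\<pi> b" for a b
  proof -
    have "u \<in> multiples ?Z (insert {#y#} U)" if u: "u \<in> Poly_Mapping.keys b" for u
    proof (cases "u \<in> mons Z")
      case True
      then have "u \<in> Poly_Mapping.keys (?\<pi> b)" using u by simp
      then have "u \<in> Poly_Mapping.keys a" using \<open>?\<pi> a = ?\<pi> b\<close>[symmetric] by simp
      then show ?thesis using \<open>a \<in> B\<close> by (auto simp: B kspan_def)
    next
      case False
      have "u \<in> mons ?Z" using u \<open>b \<in> kspan (mons ?Z)\<close> by (auto simp: kspan_def)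
      then show ?thesis
        using False mons_insert unfolding multiples_insert[of ?Z "{#y#}" U] by blast
    qed
    then show ?thesis by (auto simp: B kspan_def)
  qed
  have surj: "?\<pi> ` kspan (mons ?Z) = kspan (mons Z)"
  proof (intro equalityI subsetI)
    fix p :: "'k mpoly" assume p: "p \<in> kspan (mons Z)"
    then have "p \<in> kspan (mons ?Z)" by (rule kspan_mono[rotated]) (auto simp: mons_def)
    then show "p \<in> ?\<pi> ` kspan (mons ?Z)" using restr_eq_self[OF p] by force
  qed (auto simp: kspan_def)
  have reg: "polys.regular_mod Z ?A (map ?\<pi> gs) \<longleftrightarrow> polys.regular_mod ?Z B gs"
    if "set gs \<subseteq> kspan (mons ?Z)" for gs
    unfolding \<pi>B[symmetric]
    by (rule regular_mod_hom[OF unital_subring_kspan_mons unital_subring_kspan_mons surj])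
      (use that sat in \<open>auto simp: restr_add restr_mons_mult B idl_kspan_multiples\<close>)
  have nzd: "polys.nonzerodivisor_mod ?Z ?A' ?y"
    unfolding polys.nonzerodivisor_mod_def
  proof (intro conjI ballI impI)
    fix g :: "'k mpoly" assume g: "g \<in> kspan (mons ?Z)" "?y * g \<in> ?A'"
    show "g \<in> ?A'"
      unfolding kspan_def
    proof (rule CollectI, rule subsetI)
      fix u assume u: "u \<in> Poly_Mapping.keys g"
      then have "{#y#} + u \<in> Poly_Mapping.keys (?y * g)"
        using keys_single_mult[of 1 "{#y#}" g] by (auto simp: mon_def)
      then have "{#y#} + u \<in> multiples ?Z U" using g by (auto simp: kspan_def)
      then obtain v where v: "v \<in> U" "v \<subseteq># {#y#} + u" by (auto simp: multiples_def)
      then have "y \<notin># v" using U y by (auto simp: mons_def)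
      then have "count v z \<le> count u z" for z
        using mset_subset_eq_count[OF v(2), of z] by (cases "z = y") (auto simp: not_in_iff)
      then have "v \<subseteq># u" by (simp add: subseteq_mset_def)
      then show "u \<in> multiples ?Z U" using v u g by (auto simp: multiples_def kspan_def)
    qed
  qed (use yZ in simp)
  show ?thesis
  proof
    assume "has_regular_seq TYPE('k) (insert y Z) U (Suc r)"
    then obtain fs :: "'k mpoly list" where fs: "length fs = Suc r" "set fs \<subseteq> kspan (mons ?Z - {{#}})"
        "polys.regular_mod ?Z ?A' fs"
      by (auto simp: has_regular_seq_def)
    obtain gs where gs: "length gs = r" "set gs \<subseteq> kspan (mons ?Z - {{#}})" "polys.regular_mod ?Z B gs"
      using polys.regular_exchange[OF noetherian_polys kspan_nonunits_idl idl_kspan_multiples fs(3,2,1) _ nzd]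
        fin yZ unfolding B_def by auto
    have "set (map ?\<pi> gs) \<subseteq> kspan (mons Z - {{#}})"
      using gs(2) by (fastforce simp: kspan_def)
    moreover have "polys.regular_mod Z ?A (map ?\<pi> gs)"
      using reg[of gs] gs kspan_mono[of "mons ?Z - {{#}}" "mons ?Z"] by blast
    ultimately show "has_regular_seq TYPE('k) Z U r"
      unfolding has_regular_seq_def using gs(1) by (intro exI[of _ "map ?\<pi> gs"]) simp
  next
    assume "has_regular_seq TYPE('k) Z U r"
    then obtain fs :: "'k mpoly list" where fs: "length fs = r" "set fs \<subseteq> kspan (mons Z - {{#}})"
        "polys.regular_mod Z ?A fs"
      by (auto simp: has_regular_seq_def)
    have id: "map ?\<pi> fs = fs"
      using fs(2) kspan_mono[of "mons Z - {{#}}" "mons Z"] by (intro map_idI restr_eq_self) blast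
    have "mons Z - {{#}} \<subseteq> mons ?Z - {{#}}" unfolding mons_def by blast
    then have fs': "set fs \<subseteq> kspan (mons ?Z - {{#}})"
      using fs(2) kspan_mono by blast
    then have "set fs \<subseteq> kspan (mons ?Z)"
      using kspan_mono[of "mons ?Z - {{#}}" "mons ?Z"] by blast
    from reg[OF this, unfolded id] fs(3) have "polys.regular_mod ?Z B fs" by blast
    then have "polys.regular_mod ?Z ?A' (?y # fs)"
      unfolding polys.regular_mod.simps B_def using nzd by blast
    moreover have "set (?y # fs) \<subseteq> kspan (mons ?Z - {{#}})" using fs' yZ by simp
    moreover have "length (?y # fs) = Suc r" using fs(1) by simp
    ultimately show "has_regular_seq TYPE('k) (insert y Z) U (Suc r)"
      unfolding has_regular_seq_def by blast
  qed
qed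

lemma has_regular_seq_extend:
  assumes "finite Z" "finite Y" "Y \<inter> Z = {}" "U \<subseteq> mons Z"
  shows "has_regular_seq TYPE('k::field) (Y \<union> Z) U (r + card Y) \<longleftrightarrow> has_regular_seq TYPE('k) Z U r"
  using assms(2,3)
proof induction
  case (insert y Y)
  have "U \<subseteq> mons (Y \<union> Z)" using assms(4) by (auto simp: mons_def)
  then show ?case
    using has_regular_seq_insert[of "Y \<union> Z" y U "r + card Y", where 'k = 'k] insert assms(1) by auto
qed simp

text \<open>
  The homomorphism that maps the variable \<open>\<phi> i\<close> to the variable \<open>i\<close> and all variables outside the range of \<open>\<phi>\<close>
  to zero.
\<close>

definition unrename :: "(nat \<Rightarrow> nat) \<Rightarrow> 'k::field mpoly \<Rightarrow> 'k mpoly" where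
  "unrename \<phi> = Poly_Mapping.map_key (image_mset \<phi>)"

lemma inj_image_mset: "inj \<phi> \<Longrightarrow> inj (image_mset \<phi>)"
  by (rule injI) (metis image_mset_cong id_apply multiset.map_comp multiset.map_id inv_o_cancel)

lemma image_mset_subseteq_iff:
  assumes "inj \<phi>"
  shows "image_mset \<phi> u \<subseteq># image_mset \<phi> v \<longleftrightarrow> u \<subseteq># v"
proof
  assume "image_mset \<phi> u \<subseteq># image_mset \<phi> v"
  then have "image_mset (inv_into UNIV \<phi>) (image_mset \<phi> u) \<subseteq># image_mset (inv_into UNIV \<phi>) (image_mset \<phi> v)"
    by (rule image_mset_subseteq_mono)
  then show "u \<subseteq># v" using assms by (simp add: multiset.map_comp)
qed (rule image_mset_subseteq_mono)

context
  fixes \<phi> :: "nat \<Rightarrow> nat"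
  assumes inj: "inj \<phi>"
begin

lemma lookup_unrename [simp]:
  "Poly_Mapping.lookup (unrename \<phi> p) u = Poly_Mapping.lookup p (image_mset \<phi> u)"
  unfolding unrename_def by (simp add: map_key.rep_eq[OF inj_image_mset[OF inj]])

lemma keys_unrename: "u \<in> Poly_Mapping.keys (unrename \<phi> p) \<longleftrightarrow> image_mset \<phi> u \<in> Poly_Mapping.keys p"
  by (simp add: in_keys_iff)

lemma unrename_add: "unrename \<phi> (p + q) = unrename \<phi> p + unrename \<phi> q"
  by (rule poly_mapping_eqI) (simp add: lookup_add)

lemma unrename_zero [simp]: "unrename \<phi> 0 = 0"
  by (rule poly_mapping_eqI) simp

lemma unrename_single:
  "unrename \<phi> (Poly_Mapping.single (image_mset \<phi> u) c) = Poly_Mapping.single u c"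
  by (rule poly_mapping_eqI) (auto simp: lookup_single when_def dest: injD[OF inj_image_mset[OF inj]])

lemma unrename_single_zero:
  "\<not> set_mset u \<subseteq> range \<phi> \<Longrightarrow> unrename \<phi> (Poly_Mapping.single u c) = 0"
  by (rule poly_mapping_eqI) (auto simp: lookup_single when_def)

lemma mset_in_range: "set_mset u \<subseteq> \<phi> ` Z \<Longrightarrow> \<exists>v\<in>mons Z. u = image_mset \<phi> v"
  by (rule bexI[of _ "image_mset (inv_into UNIV \<phi>) u"])
    (auto simp: multiset.map_comp mons_def inj inv_f_f[OF inj] image_iff subset_eq f_inv_into_f
      intro!: multiset.map_ident_strong[symmetric])

lemma unrename_mult: "unrename \<phi> (p * q) = unrename \<phi> p * unrename \<phi> q"
proof (induction p rule: mpoly_induct)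
  case (single u c)
  show ?case
  proof (induction q rule: mpoly_induct)
    case (single v d)
    show ?case
    proof (cases "set_mset u \<subseteq> range \<phi> \<and> set_mset v \<subseteq> range \<phi>")
      case True
      then obtain u' v' where "u = image_mset \<phi> u'" "v = image_mset \<phi> v'"
        using mset_in_range[of u UNIV] mset_in_range[of v UNIV] by auto
      then show ?thesis
        by (simp add: mult_single unrename_single flip: image_mset_union)
    next
      case False
      then have "\<not> set_mset (u + v) \<subseteq> range \<phi>" by auto
      then have "unrename \<phi> (Poly_Mapping.single (u + v) (c * d)) = 0" by (rule unrename_single_zero)
      moreover have "unrename \<phi> (Poly_Mapping.single u c) = 0 \<or> unrename \<phi> (Poly_Mapping.single v d) = 0"
        using False unrename_single_zero by blast
      ultimately show ?thesis by (auto simp: mult_single)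
    qed
  qed (auto simp: unrename_add distrib_left)
qed (auto simp: unrename_add distrib_right)

lemma unrename_surj:
  assumes "\<phi> ` Z \<subseteq> Z'"
  shows "(kspan (mons Z) :: 'k::field mpoly set) \<subseteq> unrename \<phi> ` kspan (mons Z')"
proof
  fix p :: "'k mpoly" assume p: "p \<in> kspan (mons Z)"
  show "p \<in> unrename \<phi> ` kspan (mons Z')"
  proof (induction p rule: mpoly_induct)
    case (single u c)
    then have "image_mset \<phi> u \<in> mons Z'" using p assms by (auto simp: kspan_def mons_def)
    then show ?case
      by (intro image_eqI[of _ _ "Poly_Mapping.single (image_mset \<phi> u) c"])
        (auto simp: unrename_single kspan_def)
  next
    case zero
    then show ?case by (intro image_eqI[of _ _ 0]) auto
  next
    case (add p q)
    then show ?case by (auto simp flip: unrename_add)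
  qed
qed

lemma unrename_mem_multiples:
  assumes "p \<in> kspan (mons (\<phi> ` Z))"
  shows "unrename \<phi> p \<in> kspan (multiples Z U) \<longleftrightarrow> p \<in> kspan (multiples (\<phi> ` Z) (image_mset \<phi> ` U))"
proof -
  have *: "u \<in> multiples Z U \<longleftrightarrow> image_mset \<phi> u \<in> multiples (\<phi> ` Z) (image_mset \<phi> ` U)" for u
    by (auto simp: multiples_def mons_def image_mset_subseteq_iff[OF inj] inj_image_subset_iff[OF inj])
  show ?thesis
  proof
    assume "unrename \<phi> p \<in> kspan (multiples Z U)"
    then have a: "image_mset \<phi> u \<in> Poly_Mapping.keys p \<Longrightarrow> u \<in> multiples Z U" for u
      by (auto simp: kspan_def keys_unrename)
    show "p \<in> kspan (multiples (\<phi> ` Z) (image_mset \<phi> ` U))"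
      unfolding kspan_def
    proof (rule CollectI, rule subsetI)
      fix w assume w: "w \<in> Poly_Mapping.keys p"
      then obtain u where "w = image_mset \<phi> u"
        using assms mset_in_range[of w Z] by (auto simp: kspan_def mons_def)
      then show "w \<in> multiples (\<phi> ` Z) (image_mset \<phi> ` U)" using a w * by auto
    qed
  next
    assume "p \<in> kspan (multiples (\<phi> ` Z) (image_mset \<phi> ` U))"
    then show "unrename \<phi> p \<in> kspan (multiples Z U)"
      using * by (auto simp: kspan_def keys_unrename)
  qed
qed

text \<open>
  On \<open>K[\<phi>(Z)]\<close> the homomorphism \<open>unrename \<phi>\<close> is an isomorphism onto \<open>K[Z]\<close>.
\<close>

lemma has_regular_seq_rename:
  "has_regular_seq TYPE('k::field) (\<phi> ` Z) (image_mset \<phi> ` U) r \<longleftrightarrow> has_regular_seq TYPE('k) Z U r"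
proof -
  let ?\<pi> = "unrename \<phi> :: 'k mpoly \<Rightarrow> 'k mpoly"
  let ?S = "kspan (mons (\<phi> ` Z)) :: 'k mpoly set"
  let ?A = "kspan (multiples (\<phi> ` Z) (image_mset \<phi> ` U)) :: 'k mpoly set"
  have surj: "?\<pi> ` ?S = kspan (mons Z)"
  proof
    show "?\<pi> ` ?S \<subseteq> kspan (mons Z)"
      by (force simp: kspan_def keys_unrename mons_def subset_eq inj_image_mem_iff[OF inj])
  qed (rule unrename_surj, simp)
  have A: "?A \<subseteq> ?S" using multiples_subset by (auto simp: kspan_def)
  have \<pi>A: "?\<pi> ` ?A = kspan (multiples Z U)"
  proof (intro equalityI subsetI)
    fix q :: "'k mpoly" assume q: "q \<in> kspan (multiples Z U)"
    then have "q \<in> kspan (mons Z)" using multiples_subset by (auto simp: kspan_def)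
    then obtain p where "p \<in> ?S" "q = ?\<pi> p" using surj by blast
    then show "q \<in> ?\<pi> ` ?A" using q unrename_mem_multiples by blast
  qed (use A unrename_mem_multiples in blast)
  have reg: "polys.regular_mod Z (kspan (multiples Z U)) (map ?\<pi> gs) \<longleftrightarrow> polys.regular_mod (\<phi> ` Z) ?A gs"
    if "set gs \<subseteq> ?S" for gs
    unfolding \<pi>A[symmetric]
  proof (rule regular_mod_hom[OF unital_subring_kspan_mons unital_subring_kspan_mons surj])
    show "b \<in> ?A" if "a \<in> ?A" "b \<in> ?S" "?\<pi> a = ?\<pi> b" for a b
      using that A unrename_mem_multiples by (metis subsetD)
  qed (use that in \<open>auto simp: unrename_add unrename_mult idl_kspan_multiples\<close>)
  have m: "p \<in> kspan (mons (\<phi> ` Z) - {{#}}) \<longleftrightarrow> ?\<pi> p \<in> kspan (mons Z - {{#}})" if "p \<in> ?S" for p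
  proof -
    have "?\<pi> p \<in> kspan (mons Z)" using surj that by blast
    then show ?thesis using that by (auto simp: kspan_def keys_unrename subset_eq)
  qed
  show ?thesis
  proof
    assume "has_regular_seq TYPE('k) (\<phi> ` Z) (image_mset \<phi> ` U) r"
    then obtain gs :: "'k mpoly list" where gs: "length gs = r" "set gs \<subseteq> kspan (mons (\<phi> ` Z) - {{#}})"
       "polys.regular_mod (\<phi> ` Z) ?A gs"
      by (auto simp: has_regular_seq_def)
    have gsS: "set gs \<subseteq> ?S" using gs(2) by (auto simp: kspan_def)
    then show "has_regular_seq TYPE('k) Z U r"
      unfolding has_regular_seq_def
    proof (intro exI conjI)
      show "set (map ?\<pi> gs) \<subseteq> kspan (mons Z - {{#}})"
        unfolding set_map using gs(2) gsS m by blast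
    qed (use gs reg[OF gsS] in simp_all)
  next
    assume "has_regular_seq TYPE('k) Z U r"
    then obtain fs :: "'k mpoly list" where fs: "length fs = r" "set fs \<subseteq> kspan (mons Z - {{#}})"
       "polys.regular_mod Z (kspan (multiples Z U)) fs"
      by (auto simp: has_regular_seq_def)
    define gs where "gs = map (inv_into ?S ?\<pi>) fs"
    have fsS: "set fs \<subseteq> ?\<pi> ` ?S"
      unfolding surj using fs(2) kspan_mono[of "mons Z - {{#}}" "mons Z"] by blast
    have gsS: "set gs \<subseteq> ?S"
      unfolding gs_def set_map using fsS inv_into_into by (metis image_subsetI subsetD)
    have \<pi>gs: "map ?\<pi> gs = fs"
      unfolding gs_def map_map o_def
      by (rule map_idI, rule f_inv_into_f) (use fsS in blast)
    have "set gs \<subseteq> kspan (mons (\<phi> ` Z) - {{#}})"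
    proof
      fix g assume g: "g \<in> set gs"
      then have "?\<pi> g \<in> set fs" unfolding \<pi>gs[symmetric] by simp
      then show "g \<in> kspan (mons (\<phi> ` Z) - {{#}})" using m[of g] g gsS fs(2) by blast
    qed
    moreover have "polys.regular_mod (\<phi> ` Z) ?A gs" using reg[OF gsS] fs(3) unfolding \<pi>gs by simp
    moreover have "length gs = r" using fs(1) by (simp add: gs_def)
    ultimately show "has_regular_seq TYPE('k) (\<phi> ` Z) (image_mset \<phi> ` U) r"
      unfolding has_regular_seq_def by blast
  qed
qed

end

section \<open>Depth of the quotient module\<close>

\<comment> \<open>keeps index sets in the form {1..N}\<close>
declare One_nat_def [simp del]

lemma carrier_T: "carrier (T N) = kspan (mons {1..N})"
  by (simp add: T_def carrier_polyring)

locale quotient_of_polys =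
  fixes N :: nat and J :: "'k::field mpoly set"
  assumes J: "polys.idl {1..N} J"
begin

abbreviation "S \<equiv> kspan (mons {1..N}) :: 'k mpoly set"
abbreviation "M \<equiv> quot_module N J"

definition coset :: "'k mpoly \<Rightarrow> 'k mpoly set" where
  "coset x = J +>\<^bsub>T N\<^esub> x"

lemma coset_eq: "coset x = (\<lambda>j. j + x) ` J"
  unfolding coset_def a_r_coset_def r_coset_def by (auto simp: T_def)

lemma coset_eq_iff: "coset x = coset y \<longleftrightarrow> x - y \<in> J"
proof
  assume "coset x = coset y"
  then have "0 + x \<in> coset y" using polys.idlD(2)[OF J] unfolding coset_eq by blast
  then show "x - y \<in> J" by (auto simp: coset_eq)
next
  assume *: "x - y \<in> J"
  show "coset x = coset y"
    unfolding coset_eq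
  proof (intro equalityI image_subsetI)
    fix j assume j: "j \<in> J"
    have "j + x = (j + (x - y)) + y" "j + y = (j - (x - y)) + x" by simp_all
    then show "j + x \<in> (\<lambda>j. j + y) ` J" "j + y \<in> (\<lambda>j. j + x) ` J"
      using polys.idlD(3)[OF J j *] polys.idl_diff[OF J j *] by blast+
  qed
qed

lemma ideal_J: "ideal J (T N)"
  unfolding T_def by (rule ideal_polyring[OF J])

lemma carrier_M: "carrier M = coset ` S"
  by (auto simp: quot_module_def Let_def FactRing_def A_RCOSETS_def' carrier_T coset_def)

lemma add_M: "x \<in> S \<Longrightarrow> y \<in> S \<Longrightarrow> coset x \<oplus>\<^bsub>M\<^esub> coset y = coset (x + y)"
  using ideal.a_rcos_sum[OF ideal_J, of x y]
  by (simp add: quot_module_def Let_def FactRing_def coset_def carrier_T) (simp add: T_def)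

lemma zero_M: "\<zero>\<^bsub>M\<^esub> = coset 0"
  by (simp add: quot_module_def Let_def FactRing_def coset_eq)

lemma smult_M: "f \<in> S \<Longrightarrow> x \<in> S \<Longrightarrow> f \<odot>\<^bsub>M\<^esub> coset x = coset (f * x)"
  using ideal.rcoset_mult_add[OF ideal_J, of f x]
  by (simp add: quot_module_def Let_def FactRing_def coset_def carrier_T) (simp add: T_def)

lemma abelian_monoid_M: "abelian_monoid M"
  by (rule abelian_monoidI) (auto simp: carrier_M add_M zero_M algebra_simps)

lemma finsum_M:
  "(\<And>j. j < n \<Longrightarrow> h j \<in> S) \<Longrightarrow> finsum M (\<lambda>j. coset (h j)) {..<n::nat} = coset (\<Sum>j<n. h j)"
proof (induction n)
  case 0
  then show ?case using abelian_monoid.finsum_empty[OF abelian_monoid_M] by (simp add: zero_M)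
next
  case (Suc n)
  have *: "(\<lambda>j. coset (h j)) \<in> {..<n} \<rightarrow> carrier M" "coset (h n) \<in> carrier M"
    using Suc.prems by (auto simp: carrier_M)
  have S: "(\<Sum>j<n. h j) \<in> S" using Suc.prems by (intro kspan_sum) auto
  show ?case
    using abelian_monoid.finsum_insert[OF abelian_monoid_M _ _ *] Suc.IH Suc.prems add_M[OF _ S, of "h n"]
    by (simp add: lessThan_Suc)
qed

lemma idl_foldl_mono: "A \<subseteq> foldl (polys.adjoin {1..N}) A fs"
proof (induction fs arbitrary: A)
  case (Cons f fs)
  then show ?case using polys.subset_adjoin[of _ A "{1..N}" f] by fastforce
qed simp

lemma mem_coset_image:
  assumes "polys.idl {1..N} A" "J \<subseteq> A"
  shows "coset x \<in> coset ` A \<longleftrightarrow> x \<in> A"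
proof
  assume "coset x \<in> coset ` A"
  then obtain a where a: "a \<in> A" "x - a \<in> J" by (auto simp: coset_eq_iff)
  then have "(x - a) + a \<in> A" using assms polys.idlD(3)[OF assms(1)] by blast
  then show "x \<in> A" by simp
qed simp

text \<open>
  The submodule \<open>(f\<^sub>1, \<dots>, f\<^sub>r)(T/J)\<close> is the image of the ideal \<open>J + (f\<^sub>1, \<dots>, f\<^sub>r)\<close>.
\<close>

lemma seq_mult_M:
  assumes fs: "set fs \<subseteq> S"
  shows "seq_mult M fs = coset ` foldl (polys.adjoin {1..N}) J fs"
proof (intro equalityI subsetI)
  let ?n = "length fs"
  have fsS: "fs ! j \<in> S" if "j < ?n" for j using fs that by auto
  fix C assume "C \<in> seq_mult M fs"
  then obtain g where g: "C = finsum M (\<lambda>j. fs ! j \<odot>\<^bsub>M\<^esub> g j) {..<?n}" "g \<in> {..<?n} \<rightarrow> carrier M"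
    by (auto simp: seq_mult_def)
  then have "\<forall>j\<in>{..<?n}. \<exists>h. h \<in> S \<and> g j = coset h" by (auto simp: carrier_M Pi_iff)
  then obtain h where h: "\<And>j. j < ?n \<Longrightarrow> h j \<in> S \<and> g j = coset (h j)" by (metis lessThan_iff)
  have "C = finsum M (\<lambda>j. coset (fs ! j * h j)) {..<?n}"
    unfolding g(1) using h fsS
    by (intro abelian_monoid.finsum_cong'[OF abelian_monoid_M]) (auto simp: smult_M carrier_M)
  also have "\<dots> = coset (\<Sum>j<?n. fs ! j * h j)" using h fsS by (intro finsum_M) auto
  also have "\<dots> \<in> coset ` foldl (polys.adjoin {1..N}) J fs"
    unfolding polys.foldl_adjoin_eq[OF fs]
    using h polys.idlD(2)[OF J] by (intro imageI CollectI exI[of _ 0] exI[of _ h]) auto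
  finally show "C \<in> coset ` foldl (polys.adjoin {1..N}) J fs" .
next
  let ?n = "length fs"
  have fsS: "fs ! j \<in> S" if "j < ?n" for j using fs that by auto
  fix C assume "C \<in> coset ` foldl (polys.adjoin {1..N}) J fs"
  then obtain a h where C: "C = coset (a + (\<Sum>j<?n. fs ! j * h j))" "a \<in> J" "h \<in> {..<?n} \<rightarrow> S"
    unfolding polys.foldl_adjoin_eq[OF fs] by blast
  have "C = coset (\<Sum>j<?n. fs ! j * h j)" using C by (simp add: coset_eq_iff)
  also have "\<dots> = finsum M (\<lambda>j. coset (fs ! j * h j)) {..<?n}"
    using C fsS by (intro finsum_M[symmetric]) auto
  also have "\<dots> = finsum M (\<lambda>j. fs ! j \<odot>\<^bsub>M\<^esub> coset (h j)) {..<?n}"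
    using C fsS by (intro abelian_monoid.finsum_cong'[OF abelian_monoid_M]) (auto simp: smult_M carrier_M Pi_iff)
  finally show "C \<in> seq_mult M fs" using C(3) unfolding seq_mult_def by (auto simp: carrier_M Pi_iff)
qed

lemma regular_seq_M:
  "regular_seq (T N) M fs \<longleftrightarrow> set fs \<subseteq> S \<and> polys.regular_mod {1..N} J fs \<and>
     foldl (polys.adjoin {1..N}) J fs \<noteq> S"
proof (cases "set fs \<subseteq> S")
  case True
  let ?F = "\<lambda>fs. foldl (polys.adjoin {1..N}) J fs"
  have id: "polys.idl {1..N} (?F (take i fs))" for i
    using True set_take_subset[of i fs] by (intro polys.idl_foldl J) auto
  have mem: "coset x \<in> coset ` ?F (take i fs) \<longleftrightarrow> x \<in> ?F (take i fs)" for x i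
    by (rule mem_coset_image[OF id idl_foldl_mono])
  have 1: "(fs ! i \<odot>\<^bsub>M\<^esub> coset g \<in> seq_mult M (take i fs) \<longrightarrow> coset g \<in> seq_mult M (take i fs)) \<longleftrightarrow>
     (fs ! i * g \<in> ?F (take i fs) \<longrightarrow> g \<in> ?F (take i fs))" if "i < length fs" "g \<in> S" for i g
  proof -
    have "fs ! i \<in> S" "set (take i fs) \<subseteq> S" using True that set_take_subset[of i fs] by auto
    then show ?thesis using that by (simp add: smult_M seq_mult_M mem)
  qed
  have "seq_mult M fs \<noteq> carrier M \<longleftrightarrow> ?F fs \<noteq> S"
  proof -
    have *: "coset x \<in> coset ` ?F fs \<longleftrightarrow> x \<in> ?F fs" for x
      using mem[of x "length fs"] by simp
    have "?F fs \<subseteq> S" using polys.idlD(1)[OF id[of "length fs"]] by auto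
    moreover have "S \<subseteq> ?F fs" if "coset ` ?F fs = coset ` S"
      unfolding subset_iff *[symmetric] that by blast
    ultimately show ?thesis unfolding seq_mult_M[OF True] carrier_M by blast
  qed
  then show ?thesis
    using True 1 unfolding regular_seq_def polys.regular_mod_iff_nth[OF True] carrier_T carrier_M ball_simps
    by blast
qed (auto simp: regular_seq_def carrier_T)

end

lemma genideal_xvar: "genideal (T N) (xvar ` {1..N}) = (kspan (mons {1..N} - {{#}}) :: 'k::field mpoly set)"
proof -
  have "(xvar :: nat \<Rightarrow> 'k mpoly) ` {1..N} = mon ` (\<lambda>i. {#i#}) ` {1..N}"
    by (auto simp: xvar_def)
  moreover have "multiples {1..N} ((\<lambda>i. {#i#}) ` {1..N}) = mons {1..N} - {{#}}"
  proof -
    have "(\<exists>g\<in>(\<lambda>i. {#i#}) ` {1..N}. g \<subseteq># u) \<longleftrightarrow> u \<noteq> {#}" if "u \<in> mons {1..N}" for u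
      using that by (cases u) (auto simp: mons_def)
    then show ?thesis unfolding multiples_def by blast
  qed
  moreover have "(\<lambda>i. {#i#}) ` {1..N} \<subseteq> mons {1..N}" by (auto simp: mons_def)
  ultimately show ?thesis unfolding T_def by (simp only: genideal_mon)
qed

lemma image_eq_singleton_iff: "a \<in> A \<Longrightarrow> f ` A = {f a} \<longleftrightarrow> (\<forall>x\<in>A. f x = f a)"
  by auto

text \<open>
  The properness condition on a regular sequence in the maximal ideal holds automatically unless \<open>1 \<in> J\<close>,
  because \<open>J\<close> and the sequence then lie in the maximal ideal.
\<close>

lemma depth_quot_module:
  "depth N (quot_module N (kspan (multiples {1..N} U) :: 'k::field mpoly set)) =
    (if {#} \<in> U then \<infinity> else SUP r\<in>{r. has_regular_seq TYPE('k) {1..N} U r}. enat r)"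
proof -
  let ?J = "kspan (multiples {1..N} U) :: 'k mpoly set"
  interpret quotient_of_polys N ?J by unfold_locales (rule idl_kspan_multiples)
  have "carrier M = {\<zero>\<^bsub>M\<^esub>} \<longleftrightarrow> (\<forall>x\<in>S. x \<in> ?J)"
  proof -
    have "coset x = coset 0 \<longleftrightarrow> x \<in> ?J" for x by (simp add: coset_eq_iff)
    then show ?thesis unfolding carrier_M zero_M image_eq_singleton_iff[OF polys.zero_mem] by simp
  qed
  also have "\<dots> \<longleftrightarrow> {#} \<in> U"
  proof
    assume "\<forall>x\<in>S. x \<in> ?J"
    then have "1 \<in> ?J" by blast
    then show "{#} \<in> U" by (auto simp: multiples_def)
  next
    assume "{#} \<in> U"
    then have "multiples {1..N} U = mons {1..N}"
      by (auto simp: multiples_def intro!: bexI[of _ "{#}"])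
    then show "\<forall>x\<in>S. x \<in> ?J" by simp
  qed
  finally have zero: "carrier M = {\<zero>\<^bsub>M\<^esub>} \<longleftrightarrow> {#} \<in> U" .
  show ?thesis
  proof (cases "{#} \<in> U")
    case False
    have m: "polys.idl {1..N} (kspan (mons {1..N} - {{#}}) :: 'k mpoly set)" by (rule kspan_nonunits_idl)
    have proper: "foldl (polys.adjoin {1..N}) A fs \<subseteq> kspan (mons {1..N} - {{#}})"
      if "A \<subseteq> kspan (mons {1..N} - {{#}})" "set fs \<subseteq> kspan (mons {1..N} - {{#}})" for A and fs :: "'k mpoly list"
      using that
    proof (induction fs arbitrary: A)
      case (Cons f fs)
      have "polys.adjoin {1..N} A f \<subseteq> kspan (mons {1..N} - {{#}})"
        using Cons.prems polys.idlD(3,4)[OF m] by (auto elim!: polys.adjoinE)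
      then show ?case using Cons by simp
    qed simp
    have JJ: "?J \<subseteq> kspan (mons {1..N} - {{#}})" using False by (auto simp: kspan_def multiples_def)
    have "{fs. regular_seq (T N) M fs \<and> set fs \<subseteq> genideal (T N) (xvar ` {1..N})} =
       {fs. set fs \<subseteq> kspan (mons {1..N} - {{#}}) \<and> polys.regular_mod {1..N} ?J fs}"
    proof -
      have "foldl (polys.adjoin {1..N}) ?J fs \<noteq> S" "set fs \<subseteq> S"
        if "set fs \<subseteq> kspan (mons {1..N} - {{#}})" for fs
      proof -
        have "1 \<notin> (kspan (mons {1..N} - {{#}}) :: 'k mpoly set)" by simp
        then show "foldl (polys.adjoin {1..N}) ?J fs \<noteq> S" using proper[OF JJ that] polys.one_mem by blast
        show "set fs \<subseteq> S" using that kspan_mono[of "mons {1..N} - {{#}}" "mons {1..N}"] by blast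
      qed
      then show ?thesis unfolding regular_seq_M genideal_xvar by blast
    qed
    then have "depth N M = (SUP fs\<in>{fs. set fs \<subseteq> kspan (mons {1..N} - {{#}}) \<and> polys.regular_mod {1..N} ?J fs}. enat (length fs))"
      unfolding depth_def using zero False by simp
    also have "\<dots> = (SUP r\<in>{r. has_regular_seq TYPE('k) {1..N} U r}. enat r)"
      by (rule arg_cong[of _ _ Sup]) (auto simp: has_regular_seq_def image_iff)
    finally show ?thesis using False by simp
  qed (use zero in \<open>simp add: depth_def\<close>)
qed

section \<open>Stanley decompositions as partitions of monomials\<close>

definition block :: "monom \<Rightarrow> nat set \<Rightarrow> monom set" where
  "block v W = (+) v ` mons W"

text \<open>
  Lists rather than sets of blocks correspond directly to the lists in Stanley decompositions; the length
  of the filtered list counts the blocks that contain \<open>u\<close>.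
\<close>

definition monomial_partition :: "nat set \<Rightarrow> monom set \<Rightarrow> (monom \<times> nat set) list \<Rightarrow> bool" where
  "monomial_partition Z E L \<longleftrightarrow> (\<forall>(v, W)\<in>set L. W \<subseteq> Z \<and> block v W \<subseteq> E) \<and>
     (\<forall>u\<in>E. length (filter (\<lambda>(v, W). u \<in> block v W) L) = 1)"

definition partition_depth :: "nat set \<Rightarrow> monom set \<Rightarrow> enat" where
  "partition_depth Z E = (SUP L\<in>{L. monomial_partition Z E L}. INF (v, W)\<in>set L. enat (card W))"

text \<open>
  This covers ideals and quotients at the same time.  The coordinate map \<open>\<kappa>\<close> identifies \<open>M\<close> with the span of
  the monomials in \<open>E\<close>, and a product is computed in the polynomial ring and then projected: for the ideal
  \<open>J\<close> the set \<open>E\<close> consists of the monomials in \<open>J\<close>, and for \<open>T/J\<close> of the monomials outside \<open>J\<close>.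
\<close>

locale graded_coordinates =
  fixes N :: nat and M :: "('k::field mpoly, 'm, 'b) module_scheme" and gr :: "(nat \<Rightarrow> int) \<Rightarrow> 'm set"
    and E :: "monom set" and \<kappa> :: "'m \<Rightarrow> 'k mpoly"
  assumes E: "E \<subseteq> mons {1..N}"
    and abelian_monoid_M: "abelian_monoid M"
    and bij: "bij_betw \<kappa> (carrier M) (kspan E)"
    and \<kappa>_zero: "\<kappa> \<zero>\<^bsub>M\<^esub> = 0"
    and \<kappa>_add: "\<And>x y. x \<in> carrier M \<Longrightarrow> y \<in> carrier M \<Longrightarrow> \<kappa> (x \<oplus>\<^bsub>M\<^esub> y) = \<kappa> x + \<kappa> y"
    and smult_closed: "\<And>f x. f \<in> kspan (mons {1..N}) \<Longrightarrow> x \<in> carrier M \<Longrightarrow> f \<odot>\<^bsub>M\<^esub> x \<in> carrier M"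
    and \<kappa>_smult: "\<And>f x. f \<in> kspan (mons {1..N}) \<Longrightarrow> x \<in> carrier M \<Longrightarrow> \<kappa> (f \<odot>\<^bsub>M\<^esub> x) = restr E (f * \<kappa> x)"
    and gr: "\<And>x a. x \<in> carrier M \<Longrightarrow> x \<in> gr a \<longleftrightarrow> \<kappa> x \<in> poly_part N a"
begin

lemma \<kappa>_inj: "x \<in> carrier M \<Longrightarrow> y \<in> carrier M \<Longrightarrow> \<kappa> x = \<kappa> y \<Longrightarrow> x = y"
  using bij by (auto simp: bij_betw_def inj_on_def)

lemma \<kappa>_mem: "x \<in> carrier M \<Longrightarrow> \<kappa> x \<in> kspan E"
  using bij by (auto simp: bij_betw_def)

lemma \<kappa>_surj: "p \<in> kspan E \<Longrightarrow> \<exists>x\<in>carrier M. \<kappa> x = p"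
  using bij by (auto simp: bij_betw_def image_iff) (metis imageE)

lemma zero_carrier: "\<zero>\<^bsub>M\<^esub> \<in> carrier M"
  using abelian_monoid_M by (rule abelian_monoid.zero_closed)

lemma \<kappa>_finsum:
  assumes "finite A" "\<And>i. i \<in> A \<Longrightarrow> y i \<in> carrier M"
  shows "\<kappa> (finsum M y A) = (\<Sum>i\<in>A. \<kappa> (y i)) \<and> finsum M y A \<in> carrier M"
  using assms
proof (induction A rule: finite_induct)
  case empty
  then show ?case using zero_carrier \<kappa>_zero by (simp add: abelian_monoid.finsum_empty[OF abelian_monoid_M])
next
  case (insert i A)
  have "finsum M y (insert i A) = y i \<oplus>\<^bsub>M\<^esub> finsum M y A"
    using insert by (intro abelian_monoid.finsum_insert[OF abelian_monoid_M]) auto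
  then show ?case using insert \<kappa>_add abelian_monoid.a_closed[OF abelian_monoid_M] by simp
qed

text \<open>
  A direct sum of spans of sets of monomials is the span of the disjoint union.  The summands are given by
  their coordinates.
\<close>

lemma direct_sum_iff_partition:
  assumes Y: "\<And>i. i < n \<Longrightarrow> Y i \<subseteq> carrier M" "\<And>i. i < n \<Longrightarrow> \<kappa> ` Y i = kspan (B i)"
    and B: "\<And>i. i < n \<Longrightarrow> B i \<subseteq> E"
  shows "(\<forall>x\<in>carrier M. \<exists>!y. y \<in> (\<Pi>\<^sub>E i\<in>{..<n::nat}. Y i) \<and> x = finsum M y {..<n}) \<longleftrightarrow>
    (\<forall>u\<in>E. \<exists>!i. i < n \<and> u \<in> B i)"
proof -
  have Y_iff: "x \<in> Y i \<longleftrightarrow> \<kappa> x \<in> kspan (B i)" if "i < n" "x \<in> carrier M" for x i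
  proof
    assume "\<kappa> x \<in> kspan (B i)"
    then have "\<kappa> x \<in> \<kappa> ` Y i" using Y(2)[OF that(1)] by simp
    then obtain x' where "x' \<in> Y i" "\<kappa> x = \<kappa> x'" by auto
    then show "x \<in> Y i" using \<kappa>_inj[OF that(2)] Y(1)[OF that(1)] by auto
  qed (use Y(2)[OF that(1)] in blast)
  have sum_iff: "x = finsum M y {..<n} \<longleftrightarrow> \<kappa> x = (\<Sum>i<n. \<kappa> (y i))"
    if "x \<in> carrier M" "\<And>i. i < n \<Longrightarrow> y i \<in> carrier M" for x y
    using \<kappa>_finsum[of "{..<n}" y] that \<kappa>_inj[of x "finsum M y {..<n}"] by auto
  show ?thesis
  proof (intro iffI ballI)
    fix u assume u: "u \<in> E"
      and dec: "\<forall>x\<in>carrier M. \<exists>!y. y \<in> (\<Pi>\<^sub>E i\<in>{..<n}. Y i) \<and> x = finsum M y {..<n}"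
    obtain x where x: "x \<in> carrier M" "\<kappa> x = mon u" using \<kappa>_surj[of "mon u"] u by auto
    have ex: "\<exists>i<n. u \<in> B i"
    proof -
      obtain y where y: "y \<in> (\<Pi>\<^sub>E i\<in>{..<n}. Y i)" "x = finsum M y {..<n}" using dec x by blast
      have "y i \<in> carrier M" "\<kappa> (y i) \<in> kspan (B i)" if "i < n" for i
        using y(1) Y(1)[OF that] Y(2)[OF that] that by (auto simp: PiE_iff)
      moreover from this have "mon u = (\<Sum>i<n. \<kappa> (y i))" using sum_iff x y(2) by metis
      then have "u \<in> Poly_Mapping.keys (\<Sum>i<n. \<kappa> (y i))"
        using keys_mon[of u, where 'k = 'k] by simp
      then have "\<exists>i<n. u \<in> Poly_Mapping.keys (\<kappa> (y i))"
        using keys_sum[of "\<lambda>i. \<kappa> (y i)" "{..<n}"] by auto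
      ultimately show ?thesis by (auto simp: kspan_def)
    qed
    have unique: "i = j" if ij: "i < n" "u \<in> B i" "j < n" "u \<in> B j" for i j
    proof (rule ccontr)
      assume ne: "i \<noteq> j"
      \<comment> \<open>two different ways to write x: the whole of x in the i-th or in the j-th summand\<close>
      define \<delta> where "\<delta> k = (\<lambda>l\<in>{..<n}. if l = k then x else \<zero>\<^bsub>M\<^esub>)" for k
      have *: "\<delta> k \<in> (\<Pi>\<^sub>E i\<in>{..<n}. Y i) \<and> x = finsum M (\<delta> k) {..<n}" if k: "k < n" "u \<in> B k" for k
      proof
        show "\<delta> k \<in> (\<Pi>\<^sub>E i\<in>{..<n}. Y i)"
          using k x zero_carrier by (auto simp: \<delta>_def Y_iff \<kappa>_zero)
        have "(\<Sum>l<n. \<kappa> (\<delta> k l)) = (\<Sum>l<n. if l = k then \<kappa> x else 0)"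
          by (intro sum.cong) (auto simp: \<delta>_def \<kappa>_zero)
        also have "\<dots> = \<kappa> x" using k by (simp add: sum.delta)
        finally show "x = finsum M (\<delta> k) {..<n}"
          using sum_iff[OF x(1), of "\<delta> k"] x zero_carrier by (auto simp: \<delta>_def)
      qed
      have "\<delta> i = \<delta> j" using dec x(1) *[OF ij(1,2)] *[OF ij(3,4)] by blast
      then have "\<delta> i i = \<delta> j i" by simp
      then have "x = \<zero>\<^bsub>M\<^esub>" using ne ij by (simp add: \<delta>_def)
      then show False using x \<kappa>_zero keys_mon[of u, where 'k = 'k] by auto
    qed
    show "\<exists>!i. i < n \<and> u \<in> B i" using ex unique by blast
  next
    fix x assume x: "x \<in> carrier M" and part: "\<forall>u\<in>E. \<exists>!i. i < n \<and> u \<in> B i"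
    have sum_restr: "p = (\<Sum>i<n. restr (B i) p)" if p: "p \<in> kspan E" for p :: "'k mpoly"
    proof (rule poly_mapping_eqI)
      fix u
      show "Poly_Mapping.lookup p u = Poly_Mapping.lookup (\<Sum>i<n. restr (B i) p) u"
      proof (cases "u \<in> E")
        case True
        then have "\<exists>!i. i < n \<and> u \<in> B i" using part by blast
        then obtain k where k: "k < n" "\<And>i. i < n \<Longrightarrow> u \<in> B i \<longleftrightarrow> i = k" by blast
        have "Poly_Mapping.lookup (\<Sum>i<n. restr (B i) p) u = (\<Sum>i<n. if i = k then Poly_Mapping.lookup p u else 0)"
          unfolding lookup_sum using k by (intro sum.cong) auto
        then show ?thesis using k(1) by (simp add: sum.delta)
      next
        case False
        then have "Poly_Mapping.lookup p u = 0" using p by (auto simp: kspan_def in_keys_iff)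
        then show ?thesis by (simp add: lookup_sum cong: if_cong)
      qed
    qed
    have "\<forall>i<n. \<exists>z. z \<in> Y i \<and> \<kappa> z = restr (B i) (\<kappa> x)"
    proof (intro allI impI)
      fix i assume i: "i < n"
      have "restr (B i) (\<kappa> x) \<in> \<kappa> ` Y i" unfolding Y(2)[OF i] by (rule restr_mem_kspan)
      then show "\<exists>z. z \<in> Y i \<and> \<kappa> z = restr (B i) (\<kappa> x)" by auto
    qed
    then obtain y where y: "\<And>i. i < n \<Longrightarrow> y i \<in> Y i" "\<And>i. i < n \<Longrightarrow> \<kappa> (y i) = restr (B i) (\<kappa> x)" by metis
    show "\<exists>!y. y \<in> (\<Pi>\<^sub>E i\<in>{..<n}. Y i) \<and> x = finsum M y {..<n}"
    proof (rule ex1I[of _ "restrict y {..<n}"])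
      have "x = finsum M (restrict y {..<n}) {..<n}"
        using sum_iff[OF x, of "restrict y {..<n}"] sum_restr[OF \<kappa>_mem[OF x]] y Y(1) by force
      then show "restrict y {..<n} \<in> (\<Pi>\<^sub>E i\<in>{..<n}. Y i) \<and> x = finsum M (restrict y {..<n}) {..<n}"
        using y(1) by auto
    next
      fix z assume z: "z \<in> (\<Pi>\<^sub>E i\<in>{..<n}. Y i) \<and> x = finsum M z {..<n}"
      have zi: "z i \<in> carrier M" "\<kappa> (z i) \<in> kspan (B i)" if "i < n" for i
        using z Y(1)[OF that] Y(2)[OF that] that by (auto simp: PiE_iff)
      have sum: "\<kappa> x = (\<Sum>i<n. \<kappa> (z i))" using sum_iff[of x z, OF x zi(1)] z by simp
      have "z i = y i" if i: "i < n" for i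
      proof -
        have "restr (B i) (\<kappa> x) = (\<Sum>j<n. restr (B i) (\<kappa> (z j)))"
          unfolding sum by (rule poly_mapping_eqI) (simp add: lookup_sum)
        also have "\<dots> = (\<Sum>j<n. if j = i then \<kappa> (z i) else 0)"
        proof (intro sum.cong refl)
          fix j assume j: "j \<in> {..<n}"
          have "B i \<inter> B j = {}" if "j \<noteq> i" using part B i j that by blast
          then show "restr (B i) (\<kappa> (z j)) = (if j = i then \<kappa> (z i) else 0)"
            using zi(2)[of j] zi(2)[OF i] j
            by (auto simp: restr_eq_self restr_eq_zero_iff kspan_def)
        qed
        also have "\<dots> = \<kappa> (z i)" using i by (simp add: sum.delta)
        finally show ?thesis using y(2)[OF i] \<kappa>_inj[OF zi(1)[OF i]] y(1)[OF i] Y(1)[OF i] by auto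
      qed
      then show "z = restrict y {..<n}" using z by (auto simp: PiE_iff extensional_def restrict_def)
    qed
  qed
qed

lemma mons_subset: "W \<subseteq> {1..N} \<Longrightarrow> mons W \<subseteq> mons {1..N}"
  by (auto simp: mons_def)

text \<open>
  Once no multiple of \<open>m\<close> by a monomial in \<open>W\<close> leaves \<open>E\<close>, the projection in \<open>\<kappa>_smult\<close> has no effect.
\<close>

lemma stanley_space_eq_block:
  assumes m: "m \<in> carrier M" "\<kappa> m = Poly_Mapping.single v c" "c \<noteq> 0" and W: "W \<subseteq> {1..N}" and blk: "block v W \<subseteq> E"
  shows "stanley_space M m W \<subseteq> carrier M" "\<kappa> ` stanley_space M m W = kspan (block v W)"
    "f \<in> carrier (polyring W) \<Longrightarrow> f \<odot>\<^bsub>M\<^esub> m = \<zero>\<^bsub>M\<^esub> \<Longrightarrow> f = 0"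
proof -
  have KW: "f \<in> kspan (mons {1..N})" if "f \<in> kspan (mons W)" for f :: "'k mpoly"
    using that kspan_mono[OF mons_subset[OF W]] by blast
  have keys: "Poly_Mapping.keys (f * Poly_Mapping.single v c) = (+) v ` Poly_Mapping.keys f" for f :: "'k mpoly"
    using keys_single_mult[OF m(3), of v f] by (simp add: mult.commute)
  have \<kappa>f: "\<kappa> (f \<odot>\<^bsub>M\<^esub> m) = f * Poly_Mapping.single v c" "f * Poly_Mapping.single v c \<in> kspan (block v W)"
    if f: "f \<in> kspan (mons W)" for f
  proof -
    show *: "f * Poly_Mapping.single v c \<in> kspan (block v W)"
      using f unfolding kspan_def mem_Collect_eq keys block_def by blast
    show "\<kappa> (f \<odot>\<^bsub>M\<^esub> m) = f * Poly_Mapping.single v c"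
      using \<kappa>_smult[OF KW[OF f] m(1)] restr_eq_self[OF kspan_mono[OF blk *]] m(2) by simp
  qed
  show "stanley_space M m W \<subseteq> carrier M"
    unfolding stanley_space_def carrier_polyring using smult_closed[OF KW m(1)] by blast
  show "\<kappa> ` stanley_space M m W = kspan (block v W)"
  proof (intro equalityI subsetI)
    fix p assume "p \<in> \<kappa> ` stanley_space M m W"
    then show "p \<in> kspan (block v W)" using \<kappa>f by (auto simp: stanley_space_def carrier_polyring)
  next
    fix p :: "'k mpoly" assume p: "p \<in> kspan (block v W)"
    have "\<exists>f\<in>kspan (mons W). p = f * Poly_Mapping.single v c"
    proof (induction p rule: mpoly_induct)
      case (single u d)
      then obtain w where "u = v + w" "w \<in> mons W" using p by (auto simp: kspan_def block_def)
      then show ?case using m(3)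
        by (intro bexI[of _ "Poly_Mapping.single w (d / c)"]) (auto simp: mult_single add.commute kspan_def)
    next
      case zero
      then show ?case by (intro bexI[of _ 0]) auto
    next
      case (add p q)
      then obtain f g where "f \<in> kspan (mons W)" "g \<in> kspan (mons W)"
        "p = f * Poly_Mapping.single v c" "q = g * Poly_Mapping.single v c" by blast
      then show ?case by (intro bexI[of _ "f + g"]) (auto simp: distrib_right)
    qed
    then obtain f where "f \<in> kspan (mons W)" "p = f * Poly_Mapping.single v c" by blast
    then show "p \<in> \<kappa> ` stanley_space M m W"
      using \<kappa>f(1) by (intro image_eqI[of _ _ "f \<odot>\<^bsub>M\<^esub> m"]) (auto simp: stanley_space_def carrier_polyring)
  qed
  assume f: "f \<in> carrier (polyring W)" "f \<odot>\<^bsub>M\<^esub> m = \<zero>\<^bsub>M\<^esub>"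
  then have "f * Poly_Mapping.single v c = 0" using \<kappa>f(1)[of f] \<kappa>_zero by (simp add: carrier_polyring)
  then show "f = 0" using keys[of f] by auto
qed

lemma ex1_iff_filter: "(\<exists>!i. i < length L \<and> P (L ! i)) \<longleftrightarrow> length (filter P L) = 1"
proof -
  have "(\<exists>!i. Q i) \<longleftrightarrow> card {i. Q i} = 1" for Q :: "nat \<Rightarrow> bool"
    unfolding One_nat_def card_1_singleton_iff by (auto simp: set_eq_iff Ex1_def)
  then show ?thesis unfolding length_filter_conv_card .
qed

lemma stanley_decomposition_blocks:
  assumes D: "\<And>m W. (m, W) \<in> set D \<Longrightarrow> m \<in> carrier M \<and> W \<subseteq> {1..N} \<and> block (lead (\<kappa> m)) W \<subseteq> E \<and>
      (\<exists>c. c \<noteq> 0 \<and> \<kappa> m = Poly_Mapping.single (lead (\<kappa> m)) c)"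
  shows "stanley_decomposition N M gr D \<longleftrightarrow>
    monomial_partition {1..N} E (map (\<lambda>(m, W). (lead (\<kappa> m), W)) D)"
proof -
  have 1: "(m, W) \<in> set D \<Longrightarrow> m \<in> carrier M \<and> (\<exists>a. m \<in> gr a) \<and> W \<subseteq> {1..N}" for m W
  proof -
    assume mW: "(m, W) \<in> set D"
    obtain c where c: "c \<noteq> 0" "\<kappa> m = Poly_Mapping.single (lead (\<kappa> m)) c" using D[OF mW] by blast
    have "\<kappa> m \<in> kspan (mons {1..N})" using \<kappa>_mem[of m] D[OF mW] kspan_mono[OF E] by blast
    moreover have "Poly_Mapping.keys (Poly_Mapping.single (lead (\<kappa> m)) c) = {lead (\<kappa> m)}"
      using c(1) by simp
    then have "Poly_Mapping.keys (\<kappa> m) = {lead (\<kappa> m)}" unfolding c(2)[symmetric] .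
    ultimately have "\<kappa> m \<in> poly_part N (\<lambda>i. int (count (lead (\<kappa> m)) i))"
      by (simp add: poly_part_def carrier_T)
    then show ?thesis using gr D[OF mW] by blast
  qed
  have blk: "stanley_space M m W \<subseteq> carrier M" "\<kappa> ` stanley_space M m W = kspan (block (lead (\<kappa> m)) W)"
    "\<forall>f\<in>carrier (polyring W). f \<odot>\<^bsub>M\<^esub> m = \<zero>\<^bsub>M\<^esub> \<longrightarrow> f = 0" "block (lead (\<kappa> m)) W \<subseteq> E"
    if mW: "(m, W) \<in> set D" for m W
  proof -
    obtain c where c: "c \<noteq> 0" "\<kappa> m = Poly_Mapping.single (lead (\<kappa> m)) c" using D[OF mW] by blast
    note s = stanley_space_eq_block[OF _ c(2,1), of W]
    show "stanley_space M m W \<subseteq> carrier M" "\<kappa> ` stanley_space M m W = kspan (block (lead (\<kappa> m)) W)"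
      "\<forall>f\<in>carrier (polyring W). f \<odot>\<^bsub>M\<^esub> m = \<zero>\<^bsub>M\<^esub> \<longrightarrow> f = 0" "block (lead (\<kappa> m)) W \<subseteq> E"
      using s D[OF mW] by blast+
  qed
  let ?B = "\<lambda>i. block (lead (\<kappa> (fst (D ! i)))) (snd (D ! i))"
  have nth: "(fst (D ! i), snd (D ! i)) \<in> set D" if "i < length D" for i using that by simp
  have "stanley_decomposition N M gr D \<longleftrightarrow> (\<forall>x\<in>carrier M. \<exists>!y.
        y \<in> (\<Pi>\<^sub>E i\<in>{..<length D}. stanley_space M (fst (D ! i)) (snd (D ! i))) \<and>
        x = finsum M y {..<length D})"
    unfolding stanley_decomposition_def using 1 blk(3) by blast
  also have "\<dots> \<longleftrightarrow> (\<forall>u\<in>E. \<exists>!i. i < length D \<and> u \<in> ?B i)"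
    by (rule direct_sum_iff_partition) (use blk nth in blast)+
  also have "\<dots> \<longleftrightarrow> (\<forall>u\<in>E. length (filter (\<lambda>(m, W). u \<in> block (lead (\<kappa> m)) W) D) = 1)"
    unfolding ex1_iff_filter[symmetric] by (simp add: case_prod_beta)
  also have "\<dots> \<longleftrightarrow> monomial_partition {1..N} E (map (\<lambda>(m, W). (lead (\<kappa> m), W)) D)"
  proof -
    have "W \<subseteq> {1..N} \<and> block v W \<subseteq> E" if "(v, W) \<in> set (map (\<lambda>(m, W). (lead (\<kappa> m), W)) D)" for v W
      using that D by auto
    then show ?thesis
      unfolding monomial_partition_def filter_map length_map o_def case_prod_beta fst_conv snd_conv by auto
  qed
  finally show ?thesis .
qed

lemma lead_single: "c \<noteq> 0 \<Longrightarrow> lead (Poly_Mapping.single v c) = v"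
  by (simp add: lead_def)

text \<open>
  The generator of a Stanley space is homogeneous and nonzero, hence a scalar multiple of a monomial \<open>v\<close>; and
  freeness forces \<open>v w \<in> E\<close> for all monomials \<open>w\<close> in \<open>W\<close>.  Conversely a block is the Stanley space of the
  element with coordinate \<open>v\<close>.  This correspondence keeps the sets \<open>W\<close>.
\<close>

theorem sdepth_eq_partition_depth: "sdepth N M gr = partition_depth {1..N} E"
proof -
  let ?f = "\<lambda>D. map (\<lambda>(m, W). (lead (\<kappa> m), W :: nat set)) D"
  have inf: "(INF (m, W)\<in>set D. enat (card W)) = (INF (v, W)\<in>set (?f D). enat (card W))" for D
    by (simp add: image_image case_prod_beta)
  have dec: "monomial_partition {1..N} E (?f D)" if D: "stanley_decomposition N M gr D" for D
  proof (rule stanley_decomposition_blocks[THEN iffD1, OF _ D])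
    fix m W assume mW: "(m, W) \<in> set D"
    have m: "m \<in> carrier M" "\<exists>a. m \<in> gr a" "W \<subseteq> {1..N}"
      and free: "\<And>f. f \<in> kspan (mons W) \<Longrightarrow> f \<odot>\<^bsub>M\<^esub> m = \<zero>\<^bsub>M\<^esub> \<Longrightarrow> f = 0"
      using D mW unfolding stanley_decomposition_def carrier_polyring by blast+
    have KW: "f \<in> kspan (mons {1..N})" if "f \<in> kspan (mons W)" for f :: "'k mpoly"
      using that kspan_mono[OF mons_subset[OF m(3)]] by blast
    have free': "restr E (mon w * \<kappa> m) \<noteq> 0" if w: "w \<in> mons W" for w
    proof
      assume 0: "restr E (mon w * \<kappa> m) = 0"
      have mw: "(mon w :: 'k mpoly) \<in> kspan (mons W)" using w by simp
      have "mon w \<odot>\<^bsub>M\<^esub> m = \<zero>\<^bsub>M\<^esub>"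
        using \<kappa>_inj[OF smult_closed[OF KW[OF mw] m(1)] zero_carrier] \<kappa>_smult[OF KW[OF mw] m(1)] 0 \<kappa>_zero by simp
      from free[OF mw this] show False using keys_mon[of w, where 'k = 'k] by simp
    qed
    have nz: "\<kappa> m \<noteq> 0" using free'[of "{#}"] by auto
    \<comment> \<open>homogeneity leaves room for one monomial only\<close>
    obtain a where "\<kappa> m \<in> poly_part N a" using m gr by blast
    then have "u = v" if "u \<in> Poly_Mapping.keys (\<kappa> m)" "v \<in> Poly_Mapping.keys (\<kappa> m)" for u v
      using that unfolding poly_part_def by (intro multiset_eqI) (metis (mono_tags, lifting) mem_Collect_eq of_nat_eq_iff)
    moreover have "Poly_Mapping.keys (\<kappa> m) \<noteq> {}" using nz by simp
    then obtain v where v: "v \<in> Poly_Mapping.keys (\<kappa> m)" by blast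
    ultimately have keys: "Poly_Mapping.keys (\<kappa> m) = {v}" by blast
    define c where "c = Poly_Mapping.lookup (\<kappa> m) v"
    have c: "c \<noteq> 0" using v by (simp add: c_def in_keys_iff)
    have \<kappa>m: "\<kappa> m = Poly_Mapping.single v c"
      using poly_eq_sum_single[of "\<kappa> m"] by (simp add: keys c_def)
    have lead: "lead (\<kappa> m) = v" using c by (simp add: \<kappa>m lead_single)
    have "block v W \<subseteq> E"
    proof
      fix u assume "u \<in> block v W"
      then obtain w where w: "u = v + w" "w \<in> mons W" by (auto simp: block_def)
      have "restr E (Poly_Mapping.single (w + v) c) \<noteq> 0" using free'[OF w(2)] by (simp add: \<kappa>m mon_def mult_single)
      then show "u \<in> E" using w by (auto simp: restr_single add.commute split: if_splits)
    qed
    then show "m \<in> carrier M \<and> W \<subseteq> {1..N} \<and> block (lead (\<kappa> m)) W \<subseteq> E \<and>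
      (\<exists>c. c \<noteq> 0 \<and> \<kappa> m = Poly_Mapping.single (lead (\<kappa> m)) c)"
      unfolding lead using m(1,3) c \<kappa>m by (auto intro!: exI[of _ c])
  qed
  have surj: "\<exists>D. stanley_decomposition N M gr D \<and> ?f D = L" if L: "monomial_partition {1..N} E L" for L
  proof -
    define g where "g v = (SOME m. m \<in> carrier M \<and> \<kappa> m = mon v)" for v
    have g: "g v \<in> carrier M \<and> \<kappa> (g v) = mon v" if "v \<in> E" for v
      unfolding g_def by (rule someI_ex) (use \<kappa>_surj[of "mon v"] that in auto)
    have lead_mon: "lead (mon v :: 'k mpoly) = v" for v by (simp add: mon_def lead_single)
    have LE: "W \<subseteq> {1..N} \<and> block v W \<subseteq> E \<and> v \<in> E" if "(v, W) \<in> set L" for v W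
    proof -
      have "v + {#} \<in> block v W" unfolding block_def by (intro imageI) simp
      then show ?thesis using L that unfolding monomial_partition_def by auto
    qed
    define D where "D = map (\<lambda>(v, W). (g v, W)) L"
    have "?f D = map (\<lambda>x. x) L"
      unfolding D_def map_map using LE g by (intro map_cong) (auto simp: lead_mon)
    then have fD: "?f D = L" by simp
    have "stanley_decomposition N M gr D"
    proof (rule stanley_decomposition_blocks[THEN iffD2])
      show "monomial_partition {1..N} E (?f D)" unfolding fD by (rule L)
      fix m W assume "(m, W) \<in> set D"
      then obtain v where v: "(v, W) \<in> set L" "m = g v" by (auto simp: D_def)
      have lead: "lead (\<kappa> m) = v" and \<kappa>m: "\<kappa> m = Poly_Mapping.single v 1" and "m \<in> carrier M"
        using g[of v] LE[OF v(1)] v(2) by (auto simp: lead_mon mon_def[symmetric])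
      then show "m \<in> carrier M \<and> W \<subseteq> {1..N} \<and> block (lead (\<kappa> m)) W \<subseteq> E \<and>
        (\<exists>c. c \<noteq> 0 \<and> \<kappa> m = Poly_Mapping.single (lead (\<kappa> m)) c)"
        unfolding lead using LE[OF v(1)] by (auto intro!: exI[of _ 1])
    qed
    then show ?thesis using fD by blast
  qed
  have "?f ` {D. stanley_decomposition N M gr D} = {L. monomial_partition {1..N} E L}"
    using dec surj by blast
  then have "{L. monomial_partition {1..N} E L} = ?f ` {D. stanley_decomposition N M gr D}" by simp
  then show ?thesis unfolding sdepth_def partition_depth_def inf by (simp add: image_image)
qed

end

lemma sdepth_ideal_module:
  fixes U :: "monom set" and N :: nat
  defines "J \<equiv> kspan (multiples {1..N} U) :: 'k::field mpoly set"
  shows "sdepth N (ideal_module N J) (ideal_part N J) = partition_depth {1..N} (multiples {1..N} U)"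
proof -
  have J: "polys.idl {1..N} J" unfolding J_def by (rule idl_kspan_multiples)
  interpret graded_coordinates N "ideal_module N J" "ideal_part N J" "multiples {1..N} U" "\<lambda>p. p"
  proof (rule graded_coordinates.intro)
    show "abelian_monoid (ideal_module N J)"
      by (rule abelian_monoidI) (use polys.idlD[OF J] in \<open>auto simp: ideal_module_def algebra_simps\<close>)
  next
    fix f x assume *: "f \<in> (kspan (mons {1..N}) :: 'k mpoly set)" "x \<in> carrier (ideal_module N J)"
    then have fx: "f * x \<in> J" using polys.idlD(4)[OF J] by (simp add: ideal_module_def)
    then show "f \<odot>\<^bsub>ideal_module N J\<^esub> x \<in> carrier (ideal_module N J)"
      by (simp add: ideal_module_def)
    show "f \<odot>\<^bsub>ideal_module N J\<^esub> x = restr (multiples {1..N} U) (f * x)"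
      using fx by (simp add: ideal_module_def J_def restr_eq_self)
  qed (auto simp: ideal_module_def J_def multiples_subset ideal_part_def bij_betw_def inj_on_def)
  show ?thesis by (rule sdepth_eq_partition_depth)
qed

text \<open>
  The coordinates of a coset are those of its unique representative supported on monomials outside \<open>J\<close>.
\<close>

lemma sdepth_quot_module:
  fixes U :: "monom set" and N :: nat
  defines "J \<equiv> kspan (multiples {1..N} U) :: 'k::field mpoly set"
  shows "sdepth N (quot_module N J) (quot_part N J) = partition_depth {1..N} (mons {1..N} - multiples {1..N} U)"
proof -
  interpret Q: quotient_of_polys N J by unfold_locales (simp add: J_def idl_kspan_multiples)
  let ?E = "mons {1..N} - multiples {1..N} U"
  define \<kappa> where "\<kappa> C = restr ?E (SOME p. p \<in> C)" for C :: "'k mpoly set"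
  have restr_eq: "restr ?E p = restr ?E q" if "p - q \<in> J" for p q :: "'k mpoly"
  proof -
    have "restr ?E (p - q) = 0" using that by (auto simp: restr_eq_zero_iff J_def kspan_def)
    moreover have "restr ?E ((p - q) + q) = restr ?E (p - q) + restr ?E q" by (rule restr_add)
    ultimately show ?thesis by simp
  qed
  have \<kappa>: "\<kappa> (Q.coset p) = restr ?E p" for p
  proof -
    have "0 + p \<in> Q.coset p" unfolding Q.coset_eq using polys.idlD(2)[OF Q.J] by blast
    then have "(SOME q. q \<in> Q.coset p) \<in> Q.coset p" by (rule someI)
    then show ?thesis unfolding \<kappa>_def by (intro restr_eq) (auto simp: Q.coset_eq)
  qed
  have diff: "p - restr ?E p \<in> J" if "p \<in> Q.S" for p
    using that by (auto simp: J_def kspan_def in_keys_iff lookup_minus split: if_splits)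
  have coset_restr: "Q.coset (restr ?E p) = Q.coset p" if "p \<in> Q.S" for p
    using diff[OF that] by (simp add: Q.coset_eq_iff[of p, symmetric])
  have restr_S: "restr ?E p \<in> Q.S" for p :: "'k mpoly"
    using restr_mem_kspan[of ?E p] kspan_mono[of ?E "mons {1..N}"] by blast
  interpret graded_coordinates N "quot_module N J" "quot_part N J" ?E \<kappa>
  proof (rule graded_coordinates.intro)
    show "?E \<subseteq> mons {1..N}" by blast
    show "abelian_monoid (quot_module N J)" by (rule Q.abelian_monoid_M)
    show "bij_betw \<kappa> (carrier (quot_module N J)) (kspan ?E)"
      unfolding bij_betw_def
    proof (rule conjI[OF inj_onI equalityI[OF subsetI subsetI]])
      fix C D assume "C \<in> carrier (quot_module N J)" "D \<in> carrier (quot_module N J)" "\<kappa> C = \<kappa> D"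
      then show "C = D" unfolding Q.carrier_M using coset_restr \<kappa> by (metis imageE)
    next
      fix p assume "p \<in> \<kappa> ` carrier (quot_module N J)"
      then show "p \<in> kspan ?E" unfolding \<kappa>_def using restr_mem_kspan by blast
    next
      fix p :: "'k mpoly" assume p: "p \<in> kspan ?E"
      then have "p \<in> Q.S" using kspan_mono[of ?E "mons {1..N}"] by blast
      then show "p \<in> \<kappa> ` carrier (quot_module N J)"
        unfolding Q.carrier_M image_image \<kappa> using restr_eq_self[OF p] by (metis image_eqI)
    qed
    show "\<kappa> \<zero>\<^bsub>quot_module N J\<^esub> = 0" by (simp add: Q.zero_M \<kappa>)
  next
    fix x y assume "x \<in> carrier (quot_module N J)" "y \<in> carrier (quot_module N J)"
    then show "\<kappa> (x \<oplus>\<^bsub>quot_module N J\<^esub> y) = \<kappa> x + \<kappa> y"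
      by (auto simp: Q.carrier_M Q.add_M \<kappa> restr_add)
  next
    fix f :: "'k mpoly" and x assume *: "f \<in> kspan (mons {1..N})" "x \<in> carrier (quot_module N J)"
    then obtain p where p: "p \<in> Q.S" "x = Q.coset p" by (auto simp: Q.carrier_M)
    have "f * p - f * restr ?E p \<in> J"
      using polys.idlD(4)[OF Q.J *(1) diff[OF p(1)]] by (simp add: algebra_simps)
    from restr_eq[OF this] show "\<kappa> (f \<odot>\<^bsub>quot_module N J\<^esub> x) = restr ?E (f * \<kappa> x)"
      using * p by (simp add: Q.smult_M \<kappa>)
    show "f \<odot>\<^bsub>quot_module N J\<^esub> x \<in> carrier (quot_module N J)"
      using * p by (auto simp: Q.smult_M Q.carrier_M)
  next
    fix x a assume "x \<in> carrier (quot_module N J)"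
    then obtain p where p: "p \<in> Q.S" "x = Q.coset p" by (auto simp: Q.carrier_M)
    show "x \<in> quot_part N J a \<longleftrightarrow> \<kappa> x \<in> poly_part N a"
    proof
      assume "x \<in> quot_part N J a"
      then obtain q where "q \<in> poly_part N a" "x = Q.coset q" by (auto simp: quot_part_def Q.coset_def)
      then show "\<kappa> x \<in> poly_part N a" using restr_S by (auto simp: \<kappa> poly_part_def carrier_T)
    next
      assume "\<kappa> x \<in> poly_part N a"
      then show "x \<in> quot_part N J a"
        unfolding quot_part_def Q.coset_def[symmetric] using p coset_restr \<kappa> by (metis image_eqI)
    qed
  qed
  show ?thesis by (rule sdepth_eq_partition_depth)
qed

section \<open>Partitions of monomials and new variables\<close>

lemma finite_submultisets: "finite {v. v \<subseteq># (g :: 'a multiset)}"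
proof (induction g)
  case (add x g)
  have "{v. v \<subseteq># add_mset x g} \<subseteq> {v. v \<subseteq># g} \<union> add_mset x ` {v. v \<subseteq># g}"
  proof
    fix v assume v: "v \<in> {v. v \<subseteq># add_mset x g}"
    show "v \<in> {v. v \<subseteq># g} \<union> add_mset x ` {v. v \<subseteq># g}"
    proof (cases "x \<in># v")
      case True
      then obtain w where "v = add_mset x w" by (metis multi_member_split)
      then show ?thesis using v by auto
    next
      case False
      have "count v y \<le> count g y" for y
        using v False mset_subset_eq_count[of v "add_mset x g" y] by (cases "y = x") (auto simp: not_in_iff)
      then show ?thesis by (simp add: subseteq_mset_def)
    qed
  qed
  then show ?case using add by (meson finite_UnI finite_imageI finite_subset)
qed simp

lemma mem_truncation_block:
  assumes "v \<in> mons Z" "v \<subseteq># g"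
  shows "u \<in> block v {i\<in>Z. count v i = count g i} \<longleftrightarrow> u \<in> mons Z \<and> u \<inter># g = v"
proof
  assume "u \<in> block v {i\<in>Z. count v i = count g i}"
  then obtain w where w: "u = v + w" "w \<in> mons {i\<in>Z. count v i = count g i}" by (auto simp: block_def)
  have "count (u \<inter># g) i = count v i" for i
  proof (cases "i \<in># w")
    case True
    then have "count v i = count g i" using w(2) by (auto simp: mons_def)
    then show ?thesis by (simp add: w(1))
  next
    case False
    then show ?thesis using mset_subset_eq_count[OF assms(2), of i] by (simp add: w(1) not_in_iff)
  qed
  then show "u \<in> mons Z \<and> u \<inter># g = v" using w assms by (auto intro: multiset_eqI simp: mons_def)
next
  assume u: "u \<in> mons Z \<and> u \<inter># g = v"
  then have "v \<subseteq># u" by auto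
  have "u - v \<in> mons {i\<in>Z. count v i = count g i}"
    unfolding mons_def
  proof (rule CollectI, rule subsetI)
    fix i assume i: "i \<in># u - v"
    then have "count v i < count u i" by (simp add: in_diff_count)
    moreover have "count v i = min (count u i) (count g i)" using u by auto
    moreover have "i \<in> Z" using u in_diffD[OF i] by (auto simp: mons_def)
    ultimately show "i \<in> {i\<in>Z. count v i = count g i}" by (auto simp: min_def split: if_splits)
  qed
  then show "u \<in> block v {i\<in>Z. count v i = count g i}"
    unfolding block_def using \<open>v \<subseteq># u\<close> by (intro image_eqI[of _ _ "u - v"]) auto
qed

text \<open>
  If all generators divide \<open>g\<close>, membership of \<open>u\<close> depends only on the truncation \<open>u \<inter># g\<close> of its exponents, and
  the monomials with a given truncation \<open>v\<close> form a block, in the variables in which \<open>v\<close> has reached \<open>g\<close>.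
  Existence matters because the supremum over no partition at all would be zero.
\<close>

lemma ex_monomial_partition:
  assumes E: "E \<subseteq> mons Z" and trunc: "\<And>u. u \<in> mons Z \<Longrightarrow> u \<in> E \<longleftrightarrow> u \<inter># g \<in> E"
  shows "\<exists>L. monomial_partition Z E L"
proof -
  let ?W = "\<lambda>v. {i\<in>Z. count v i = count g i}"
  have "finite {v \<in> E. v \<subseteq># g}" using finite_submultisets[of g] by (rule rev_finite_subset) auto
  then obtain xs where xs: "set xs = {v \<in> E. v \<subseteq># g}" "distinct xs"
    using finite_distinct_list by blast
  have blk: "u \<in> block v (?W v) \<longleftrightarrow> u \<in> mons Z \<and> u \<inter># g = v" if "v \<in> set xs" for u v
    using mem_truncation_block[of v Z g u] that xs(1) E by auto
  have "monomial_partition Z E (map (\<lambda>v. (v, ?W v)) xs)"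
    unfolding monomial_partition_def
  proof (intro conjI ballI)
    fix x assume "x \<in> set (map (\<lambda>v. (v, ?W v)) xs)"
    then obtain v where v: "x = (v, ?W v)" "v \<in> set xs" by auto
    have vE: "v \<in> E" using v(2) unfolding xs(1) by simp
    have "block v (?W v) \<subseteq> E"
    proof
      fix u assume "u \<in> block v (?W v)"
      then have u: "u \<in> mons Z" "u \<inter># g = v" using blk[OF v(2)] by simp_all
      then show "u \<in> E" using trunc[OF u(1)] vE by simp
    qed
    then show "case x of (v, W) \<Rightarrow> W \<subseteq> Z \<and> block v W \<subseteq> E" using v by auto
  next
    fix u assume u: "u \<in> E"
    then have uZ: "u \<in> mons Z" using E by blast
    have "u \<inter># g \<in> E" using trunc[OF uZ] u by blast
    then have "u \<inter># g \<in> set xs" unfolding xs(1) by simp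
    have "filter (\<lambda>(v, W). u \<in> block v W) (map (\<lambda>v. (v, ?W v)) xs) =
        map (\<lambda>v. (v, ?W v)) (filter (\<lambda>v. u \<in> block v (?W v)) xs)"
      by (simp add: filter_map o_def)
    also have "filter (\<lambda>v. u \<in> block v (?W v)) xs = filter (\<lambda>v. v = u \<inter># g) xs"
      using blk uZ by (intro filter_cong) auto
    finally have "length (filter (\<lambda>(v, W). u \<in> block v W) (map (\<lambda>v. (v, ?W v)) xs)) =
        card (set (filter (\<lambda>v. v = u \<inter># g) xs))"
      unfolding distinct_card[OF distinct_filter[OF xs(2)]] by simp
    also have "set (filter (\<lambda>v. v = u \<inter># g) xs) = {u \<inter># g}" using \<open>u \<inter># g \<in> set xs\<close> by auto
    finally show "length (filter (\<lambda>(v, W). u \<in> block v W) (map (\<lambda>v. (v, ?W v)) xs)) = 1" by simp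
  qed
  then show ?thesis by blast
qed

lemma ex_monomial_partition_multiples:
  assumes "finite U" "U \<subseteq> mons Z"
  shows "\<exists>L. monomial_partition Z (multiples Z U) L"
    "\<exists>L. monomial_partition Z (mons Z - multiples Z U) L"
proof -
  let ?g = "\<Sum>v\<in>U. v"
  have "v \<subseteq># ?g" if "v \<in> U" for v
    using assms(1) that by (simp add: sum.remove)
  then have *: "u \<in> multiples Z U \<longleftrightarrow> u \<inter># ?g \<in> multiples Z U" if "u \<in> mons Z" for u
    using that mons_subset_mset[OF that, of "u \<inter># ?g"] by (auto simp: multiples_def)
  then show "\<exists>L. monomial_partition Z (multiples Z U) L"
    by (intro ex_monomial_partition[of _ _ ?g] multiples_subset)
  show "\<exists>L. monomial_partition Z (mons Z - multiples Z U) L"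
  proof (rule ex_monomial_partition[of _ _ ?g])
    show "u \<in> mons Z - multiples Z U \<longleftrightarrow> u \<inter># ?g \<in> mons Z - multiples Z U" if u: "u \<in> mons Z" for u
      using *[OF u] u mons_subset_mset[OF u, of "u \<inter># ?g"] by simp
  qed simp
qed

lemma filter_mset_add_filter_not: "u = filter_mset P u + filter_mset (\<lambda>i. \<not> P i) u"
  by (simp add: multiset_partition)

lemma filter_mset_mons: "u \<in> mons Z \<Longrightarrow> filter_mset (\<lambda>i. i \<in> Z) u = u"
  by (auto simp: mons_def filter_mset_eq_conv)

lemma mem_block_Un:
  assumes v: "v \<in> mons Z" and W: "W \<subseteq> Z" and YZ: "Y \<inter> Z = {}"
  shows "u \<in> block v (W \<union> Y) \<longleftrightarrow> u \<in> mons (Y \<union> Z) \<and> filter_mset (\<lambda>i. i \<in> Z) u \<in> block v W"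
proof
  assume "u \<in> block v (W \<union> Y)"
  then obtain w where w: "u = v + w" "w \<in> mons (W \<union> Y)" by (auto simp: block_def)
  have "filter_mset (\<lambda>i. i \<in> Z) u = v + filter_mset (\<lambda>i. i \<in> Z) w"
    by (simp add: w(1) filter_mset_mons[OF v])
  moreover have "filter_mset (\<lambda>i. i \<in> Z) w \<in> mons W" using w(2) YZ by (auto simp: mons_def)
  moreover have "u \<in> mons (Y \<union> Z)" using w v W by (auto simp: mons_def)
  ultimately show "u \<in> mons (Y \<union> Z) \<and> filter_mset (\<lambda>i. i \<in> Z) u \<in> block v W"
    by (auto simp: block_def)
next
  assume u: "u \<in> mons (Y \<union> Z) \<and> filter_mset (\<lambda>i. i \<in> Z) u \<in> block v W"
  then obtain w where w: "filter_mset (\<lambda>i. i \<in> Z) u = v + w" "w \<in> mons W" by (auto simp: block_def)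
  have "u = v + (w + filter_mset (\<lambda>i. i \<notin> Z) u)"
    using filter_mset_add_filter_not[of u "\<lambda>i. i \<in> Z"] by (simp add: w(1) add.assoc)
  moreover have "w + filter_mset (\<lambda>i. i \<notin> Z) u \<in> mons (W \<union> Y)"
    using w(2) u by (auto simp: mons_def)
  ultimately show "u \<in> block v (W \<union> Y)" unfolding block_def by blast
qed

text \<open>
  If \<open>E\<close> consists of the monomials of \<open>K[Z]\<close> inside (or outside) an ideal generated by monomials, this set
  consists of those of \<open>K[Y \<union> Z]\<close> inside (or outside) the extended ideal.
\<close>

definition extend_set :: "nat set \<Rightarrow> nat set \<Rightarrow> monom set \<Rightarrow> monom set" where
  "extend_set Y Z E = {u \<in> mons (Y \<union> Z). filter_mset (\<lambda>i. i \<in> Z) u \<in> E}"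

lemma self_mem_block: "v \<in> block v W"
  unfolding block_def using image_eqI[of v "(+) v" "{#}"] by simp

lemma monomial_partition_extend:
  assumes L: "monomial_partition Z E L" and E: "E \<subseteq> mons Z" and YZ: "Y \<inter> Z = {}"
  shows "monomial_partition (Y \<union> Z) (extend_set Y Z E) (map (\<lambda>(v, W). (v, W \<union> Y)) L)"
  unfolding monomial_partition_def
proof (intro conjI ballI)
  have W: "W \<subseteq> Z \<and> block v W \<subseteq> E \<and> v \<in> mons Z" if "(v, W) \<in> set L" for v W
    using L that E self_mem_block[of v W] unfolding monomial_partition_def by blast
  have blk: "u \<in> block v (W \<union> Y) \<longleftrightarrow> u \<in> mons (Y \<union> Z) \<and> filter_mset (\<lambda>i. i \<in> Z) u \<in> block v W"
    if "(v, W) \<in> set L" for u v W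
    by (rule mem_block_Un) (use W[OF that] YZ in auto)
  {
    fix x assume "x \<in> set (map (\<lambda>(v, W). (v, W \<union> Y)) L)"
    then obtain v W' where v: "x = (v, W' \<union> Y)" "(v, W') \<in> set L" by auto
    have "block v (W' \<union> Y) \<subseteq> extend_set Y Z E"
      using blk[OF v(2)] W[OF v(2)] by (auto simp: extend_set_def)
    then show "case x of (v, W) \<Rightarrow> W \<subseteq> Y \<union> Z \<and> block v W \<subseteq> extend_set Y Z E"
      using v W[OF v(2)] by auto
  next
    fix u assume u: "u \<in> extend_set Y Z E"
    have "filter (\<lambda>(v, W). u \<in> block v W) (map (\<lambda>(v, W). (v, W \<union> Y)) L) =
      map (\<lambda>(v, W). (v, W \<union> Y)) (filter (\<lambda>(v, W). u \<in> block v (W \<union> Y)) L)"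
      by (simp add: filter_map o_def case_prod_unfold)
    also have "filter (\<lambda>(v, W). u \<in> block v (W \<union> Y)) L =
      filter (\<lambda>(v, W). filter_mset (\<lambda>i. i \<in> Z) u \<in> block v W) L"
      using blk u by (intro filter_cong) (auto simp: extend_set_def)
    finally show "length (filter (\<lambda>(v, W). u \<in> block v W) (map (\<lambda>(v, W). (v, W \<union> Y)) L)) = 1"
      using L u by (auto simp: monomial_partition_def extend_set_def)
  }
qed

text \<open>
  The intersections of the blocks with the monomials of \<open>K[Z]\<close>.  A block that begins outside \<open>K[Z]\<close> contains none
  of them.
\<close>

lemma monomial_partition_restrict:
  assumes L: "monomial_partition (Y \<union> Z) (extend_set Y Z E) L" and E: "E \<subseteq> mons Z"
  shows "monomial_partition Z E (map (\<lambda>(v, W). (v, W \<inter> Z)) (filter (\<lambda>(v, W). v \<in> mons Z) L))"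
    (is "monomial_partition Z E (map ?f (filter ?Q L))")
  unfolding monomial_partition_def
proof (intro conjI ballI)
  fix x assume "x \<in> set (map ?f (filter ?Q L))"
  then obtain v W where v: "x = (v, W \<inter> Z)" "(v, W) \<in> set L" "v \<in> mons Z" by auto
  have "block v (W \<inter> Z) \<subseteq> E"
  proof
    fix u assume u: "u \<in> block v (W \<inter> Z)"
    then have "u \<in> mons Z" using v(3) by (auto simp: block_def mons_def)
    have "u \<in> block v W" using u by (auto simp: block_def mons_def)
    then have "u \<in> extend_set Y Z E" using L v(2) by (auto simp: monomial_partition_def)
    then show "u \<in> E" using filter_mset_mons[OF \<open>u \<in> mons Z\<close>] by (simp add: extend_set_def)
  qed
  then show "case x of (v, W) \<Rightarrow> W \<subseteq> Z \<and> block v W \<subseteq> E" using v by auto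
next
  fix u assume u: "u \<in> E"
  then have uZ: "u \<in> mons Z" using E by auto
  have "u \<in> extend_set Y Z E" using u filter_mset_mons[OF uZ] uZ by (auto simp: extend_set_def mons_def)
  then have one: "length (filter (\<lambda>(v, W). u \<in> block v W) L) = 1" using L by (auto simp: monomial_partition_def)
  have "filter (\<lambda>(v, W). u \<in> block v W) (map ?f (filter ?Q L)) =
      map ?f (filter (\<lambda>(v, W). v \<in> mons Z \<and> u \<in> block v (W \<inter> Z)) L)"
    by (simp add: filter_map o_def case_prod_unfold conj_commute)
  also have "filter (\<lambda>(v, W). v \<in> mons Z \<and> u \<in> block v (W \<inter> Z)) L = filter (\<lambda>(v, W). u \<in> block v W) L"
  proof -
    have "v \<in> mons Z \<and> u \<in> block v (W \<inter> Z) \<longleftrightarrow> u \<in> block v W" for v W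
      using uZ by (auto simp: block_def mons_def)
    then show ?thesis by simp
  qed
  finally show "length (filter (\<lambda>(v, W). u \<in> block v W) (map ?f (filter ?Q L))) = 1" using one by simp
qed

lemma Inf_enat_mem: "A \<noteq> {} \<Longrightarrow> Inf A \<in> (A :: enat set)"
  unfolding Inf_enat_def by (auto intro: LeastI)

lemma SUP_enat_add_le:
  assumes "A \<noteq> {}" "\<And>x. x \<in> A \<Longrightarrow> f x + enat k \<le> B"
  shows "(SUP x\<in>A. f x) + enat k \<le> B"
proof (cases B)
  case (enat b)
  obtain x where "x \<in> A" using assms(1) by blast
  then have kb: "k \<le> b" using assms(2)[of x] enat by (cases "f x") auto
  have "f x \<le> enat (b - k)" if "x \<in> A" for x
    using assms(2)[OF that] enat by (cases "f x") auto
  then have "(SUP x\<in>A. f x) \<le> enat (b - k)" by (rule SUP_least)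
  then show ?thesis using enat kb by (cases "SUP x\<in>A. f x") auto
qed simp

theorem partition_depth_extend:
  assumes E: "E \<subseteq> mons Z" and YZ: "Y \<inter> Z = {}" "finite Y" "finite Z"
    and ex: "\<exists>L. monomial_partition Z E L"
  shows "partition_depth (Y \<union> Z) (extend_set Y Z E) = partition_depth Z E + enat (card Y)"
proof (rule antisym)
  show "partition_depth Z E + enat (card Y) \<le> partition_depth (Y \<union> Z) (extend_set Y Z E)"
    unfolding partition_depth_def[of Z]
  proof (rule SUP_enat_add_le)
    show "{L. monomial_partition Z E L} \<noteq> {}" using ex by blast
    fix L assume L: "L \<in> {L. monomial_partition Z E L}"
    let ?L = "map (\<lambda>(v, W). (v, W \<union> Y)) L"
    have "(INF (v, W)\<in>set L. enat (card W)) + enat (card Y) \<le> (INF (v, W)\<in>set ?L. enat (card W))"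
    proof (rule INF_greatest)
      fix x assume "x \<in> set ?L"
      then obtain v W where v: "x = (v, W \<union> Y)" "(v, W) \<in> set L" by auto
      then have "W \<subseteq> Z" using L by (auto simp: monomial_partition_def)
      then have "card (W \<union> Y) = card W + card Y"
        using YZ by (intro card_Un_disjoint) (auto dest: finite_subset)
      moreover have "(INF (v, W)\<in>set L. enat (card W)) \<le> enat (card W)"
        using v(2) by (intro INF_lower2[of "(v, W)"]) auto
      ultimately show "(INF (v, W)\<in>set L. enat (card W)) + enat (card Y) \<le> (case x of (v, W) \<Rightarrow> enat (card W))"
        using v by (simp add: add_right_mono flip: plus_enat_simps(1))
    qed
    also have "\<dots> \<le> partition_depth (Y \<union> Z) (extend_set Y Z E)"
      unfolding partition_depth_def using monomial_partition_extend[OF _ E YZ(1)] L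
      by (intro SUP_upper) blast
    finally show "(INF (v, W)\<in>set L. enat (card W)) + enat (card Y) \<le> partition_depth (Y \<union> Z) (extend_set Y Z E)" .
  qed
next
  show "partition_depth (Y \<union> Z) (extend_set Y Z E) \<le> partition_depth Z E + enat (card Y)"
    unfolding partition_depth_def[of "Y \<union> Z"]
  proof (rule SUP_least)
    fix L assume L: "L \<in> {L. monomial_partition (Y \<union> Z) (extend_set Y Z E) L}"
    let ?L = "map (\<lambda>(v, W). (v, W \<inter> Z)) (filter (\<lambda>(v, W). v \<in> mons Z) L)"
    have part: "monomial_partition Z E ?L" using monomial_partition_restrict[of Y Z E L] L E by blast
    have "(INF (v, W)\<in>set L. enat (card W)) \<le> (INF (v, W)\<in>set ?L. enat (card W)) + enat (card Y)"
    proof (cases "?L = []")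
      case True
      then show ?thesis unfolding True by (simp add: top_enat_def)
    next
      case False
      then have "(INF (v, W)\<in>set ?L. enat (card W)) \<in> (\<lambda>(v, W). enat (card W)) ` set ?L"
        by (intro Inf_enat_mem) (simp only: image_is_empty set_empty not_False_eq_True)
      then obtain v W where v: "(v, W) \<in> set L" "(INF (v, W)\<in>set ?L. enat (card W)) = enat (card (W \<inter> Z))" by auto
      have "W \<subseteq> Y \<union> Z" using L v(1) by (auto simp: monomial_partition_def)
      then have "card W \<le> card ((W \<inter> Z) \<union> Y)" using YZ by (intro card_mono) (auto dest: finite_subset)
      also have "\<dots> \<le> card (W \<inter> Z) + card Y" by (rule card_Un_le)
      finally have "enat (card W) \<le> (INF (v, W)\<in>set ?L. enat (card W)) + enat (card Y)" unfolding v(2) by simp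
      then show ?thesis using v(1) by (intro INF_lower2[of "(v, W)"]) auto
    qed
    also have "(INF (v, W)\<in>set ?L. enat (card W)) \<le> partition_depth Z E"
      unfolding partition_depth_def using part by (intro SUP_upper) blast
    finally show "(INF (v, W)\<in>set L. enat (card W)) \<le> partition_depth Z E + enat (card Y)"
      by (simp add: add_right_mono)
  qed
qed

lemma image_mset_inv_into: "inj_on \<phi> Z \<Longrightarrow> u \<in> mons Z \<Longrightarrow> image_mset (inv_into Z \<phi>) (image_mset \<phi> u) = u"
  by (auto simp: multiset.map_comp mons_def intro!: multiset.map_ident_strong)

lemma mons_image: "mons (\<phi> ` Z) = image_mset \<phi> ` mons Z"
proof (intro equalityI subsetI)
  fix u assume u: "u \<in> mons (\<phi> ` Z)"
  have "u = image_mset \<phi> (image_mset (inv_into Z \<phi>) u)"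
    using u by (auto simp: multiset.map_comp mons_def f_inv_into_f intro!: multiset.map_ident_strong[symmetric])
  moreover have "image_mset (inv_into Z \<phi>) u \<in> mons Z" using u by (auto simp: mons_def intro: inv_into_into)
  ultimately show "u \<in> image_mset \<phi> ` mons Z" by blast
qed (auto simp: mons_def subset_iff)

lemma inj_on_image_mset: "inj_on \<phi> Z \<Longrightarrow> inj_on (image_mset \<phi>) (mons Z)"
  by (rule inj_on_inverseI[of _ "image_mset (inv_into Z \<phi>)"]) (rule image_mset_inv_into)

lemma partition_depth_rename_le:
  assumes \<phi>: "inj_on \<phi> Z" and E: "E \<subseteq> mons Z"
  shows "partition_depth Z E \<le> partition_depth (\<phi> ` Z) (image_mset \<phi> ` E)"
  unfolding partition_depth_def[of Z]
proof (rule SUP_least)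
  fix L assume "L \<in> {L. monomial_partition Z E L}"
  then have L: "monomial_partition Z E L" by simp
  have W: "W \<subseteq> Z \<and> block v W \<subseteq> E" if "(v, W) \<in> set L" for v W
    using L that unfolding monomial_partition_def by blast
  let ?f = "\<lambda>(v, W). (image_mset \<phi> v, \<phi> ` W)"
  have blk: "block (image_mset \<phi> v) (\<phi> ` W) = image_mset \<phi> ` block v W" for v W
    unfolding block_def mons_image by (auto simp: image_image)
  have "monomial_partition (\<phi> ` Z) (image_mset \<phi> ` E) (map ?f L)"
    unfolding monomial_partition_def
  proof (intro conjI ballI)
    fix x assume "x \<in> set (map ?f L)"
    then obtain v W where v: "x = (image_mset \<phi> v, \<phi> ` W)" "(v, W) \<in> set L" by auto
    then show "case x of (v, W) \<Rightarrow> W \<subseteq> \<phi> ` Z \<and> block v W \<subseteq> image_mset \<phi> ` E"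
      using W[OF v(2)] by (auto simp: blk)
  next
    fix u assume "u \<in> image_mset \<phi> ` E"
    then obtain w where w: "u = image_mset \<phi> w" "w \<in> E" by auto
    have "filter (\<lambda>(v, W). u \<in> block v W) (map ?f L) =
        map ?f (filter (\<lambda>(v, W). u \<in> block (image_mset \<phi> v) (\<phi> ` W)) L)"
      by (simp add: filter_map o_def case_prod_unfold)
    also have "filter (\<lambda>(v, W). u \<in> block (image_mset \<phi> v) (\<phi> ` W)) L = filter (\<lambda>(v, W). w \<in> block v W) L"
    proof (rule filter_cong[OF refl])
      fix x assume x: "x \<in> set L"
      have "block (fst x) (snd x) \<subseteq> mons Z" using W[of "fst x" "snd x"] x E by auto
      then show "(case x of (v, W) \<Rightarrow> u \<in> block (image_mset \<phi> v) (\<phi> ` W)) = (case x of (v, W) \<Rightarrow> w \<in> block v W)"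
        unfolding blk w(1) case_prod_beta
        using inj_on_image_mem_iff[OF inj_on_image_mset[OF \<phi>], of w "block (fst x) (snd x)"] w(2) E by auto
    qed
    finally show "length (filter (\<lambda>(v, W). u \<in> block v W) (map ?f L)) = 1"
      using L w(2) by (auto simp: monomial_partition_def)
  qed
  then have "(INF (v, W)\<in>set (map ?f L). enat (card W)) \<le> partition_depth (\<phi> ` Z) (image_mset \<phi> ` E)"
    unfolding partition_depth_def by (intro SUP_upper) blast
  moreover have "(INF (v, W)\<in>set (map ?f L). enat (card W)) = (INF (v, W)\<in>set L. enat (card W))"
    unfolding set_map image_image
  proof (rule INF_cong[OF refl])
    fix x assume "x \<in> set L"
    then have "inj_on \<phi> (snd x)" using W[of "fst x" "snd x"] inj_on_subset[OF \<phi>] by auto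
    then show "(case ?f x of (v, W) \<Rightarrow> enat (card W)) = (case x of (v, W) \<Rightarrow> enat (card W))"
      by (simp add: case_prod_beta card_image)
  qed
  ultimately show "(INF (v, W)\<in>set L. enat (card W)) \<le> partition_depth (\<phi> ` Z) (image_mset \<phi> ` E)" by simp
qed

text \<open>
  The reverse inequality is the direct one for the inverse of \<open>\<phi>\<close> on \<open>\<phi>(Z)\<close>.
\<close>

lemma partition_depth_rename:
  assumes \<phi>: "inj_on \<phi> Z" and E: "E \<subseteq> mons Z"
  shows "partition_depth (\<phi> ` Z) (image_mset \<phi> ` E) = partition_depth Z E"
proof (rule antisym)
  let ?\<psi> = "inv_into Z \<phi>"
  have "partition_depth (\<phi> ` Z) (image_mset \<phi> ` E) \<le>
      partition_depth (?\<psi> ` \<phi> ` Z) (image_mset ?\<psi> ` image_mset \<phi> ` E)"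
    using E by (intro partition_depth_rename_le inj_on_inv_into) (auto simp: mons_image)
  also have "?\<psi> ` \<phi> ` Z = Z" using \<phi> by (simp add: inv_into_image_cancel)
  also have "image_mset ?\<psi> ` image_mset \<phi> ` E = E"
    unfolding image_image using image_mset_inv_into[OF \<phi>] E by (simp add: subset_iff cong: image_cong)
  finally show "partition_depth (\<phi> ` Z) (image_mset \<phi> ` E) \<le> partition_depth Z E" .
qed (rule partition_depth_rename_le[OF assms])

lemma extend_set_multiples:
  assumes "U \<subseteq> mons Z"
  shows "extend_set Y Z (multiples Z U) = multiples (Y \<union> Z) U"
    "extend_set Y Z (mons Z - multiples Z U) = mons (Y \<union> Z) - multiples (Y \<union> Z) U"
proof -
  have *: "g \<subseteq># filter_mset (\<lambda>i. i \<in> Z) u \<longleftrightarrow> g \<subseteq># u" if "g \<in> U" for g u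
  proof
    assume "g \<subseteq># u"
    then have "filter_mset (\<lambda>i. i \<in> Z) g \<subseteq># filter_mset (\<lambda>i. i \<in> Z) u" by (rule multiset_filter_mono)
    then show "g \<subseteq># filter_mset (\<lambda>i. i \<in> Z) u" using filter_mset_mons[of g Z] that assms by auto
  qed (meson multiset_filter_subset subset_mset.order_trans)
  have **: "filter_mset (\<lambda>i. i \<in> Z) u \<in> mons Z" for u by (auto simp: mons_def)
  show "extend_set Y Z (multiples Z U) = multiples (Y \<union> Z) U"
    "extend_set Y Z (mons Z - multiples Z U) = mons (Y \<union> Z) - multiples (Y \<union> Z) U"
    using * ** by (auto simp: extend_set_def multiples_def)
qed

lemma image_multiples:
  assumes \<phi>: "inj \<phi>"
  shows "image_mset \<phi> ` multiples Z U = multiples (\<phi> ` Z) (image_mset \<phi> ` U)"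
  unfolding multiples_def mons_image using image_mset_subseteq_iff[OF \<phi>] by blast

lemma image_mons_diff:
  assumes \<phi>: "inj \<phi>"
  shows "image_mset \<phi> ` (mons Z - multiples Z U) = mons (\<phi> ` Z) - multiples (\<phi> ` Z) (image_mset \<phi> ` U)"
  unfolding image_set_diff[OF inj_image_mset[OF \<phi>]] image_multiples[OF \<phi>] mons_image ..

section \<open>Powers of the operator \<open>\<sigma>\<close>\<close>

text \<open>
  A closed formula for \<open>\<sigma>\<^sup>t\<close>; positions are counted from zero.
\<close>

definition spread :: "nat \<Rightarrow> monom \<Rightarrow> monom" where
  "spread t u = mset (map (\<lambda>k. sorted_list_of_multiset u ! k + k * t) [0..<size u])"

lemma length_sorted_list [simp]: "length (sorted_list_of_multiset u) = size u"
  by (metis mset_sorted_list_of_multiset size_mset)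

lemma size_spread [simp]: "size (spread t u) = size u"
  by (simp add: spread_def)

lemma sorted_list_spread:
  "sorted_list_of_multiset (spread t u) = map (\<lambda>k. sorted_list_of_multiset u ! k + k * t) [0..<size u]"
proof -
  have "sorted (map (\<lambda>k. sorted_list_of_multiset u ! k + k * t) [0..<size u])"
    unfolding sorted_iff_nth_mono
    by (auto intro!: add_mono mult_right_mono sorted_nth_mono)
  then show ?thesis unfolding spread_def sorted_list_of_multiset_mset by (rule sorted_sort_id)
qed

lemma spread_zero [simp]: "spread 0 u = u"
proof -
  have "map (\<lambda>k. sorted_list_of_multiset u ! k) [0..<length (sorted_list_of_multiset u)] = sorted_list_of_multiset u"
    by (rule map_nth)
  then show ?thesis by (simp add: spread_def)
qed

lemma sigma_spread: "sigma (spread t u) = spread (Suc t) u"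
  unfolding sigma_def sorted_list_spread size_spread unfolding spread_def
  by (rule arg_cong[of _ _ mset], rule nth_equalityI) auto

lemma sigma_funpow: "(sigma ^^ t) u = spread t u"
  by (induction t) (simp_all add: sigma_spread)

lemma mem_spread: "x \<in># spread t u \<longleftrightarrow> (\<exists>k<size u. x = sorted_list_of_multiset u ! k + k * t)"
  by (auto simp: spread_def)

lemma sorted_list_nth_mem: "k < size u \<Longrightarrow> sorted_list_of_multiset u ! k \<in># u"
  using nth_mem[of k "sorted_list_of_multiset u"] by simp

lemma spread_mons:
  assumes u: "u \<in> mons {1..n}" "size u \<le> d" and "a \<le> s" "n \<le> s"
  shows "spread a u \<in> mons {1..s * d}"
  unfolding mons_def
proof (rule CollectI, rule subsetI)
  fix x assume "x \<in># spread a u"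
  then obtain k where k: "k < size u" "x = sorted_list_of_multiset u ! k + k * a" by (auto simp: mem_spread)
  have *: "1 \<le> sorted_list_of_multiset u ! k" "sorted_list_of_multiset u ! k \<le> n"
    using sorted_list_nth_mem[OF k(1)] u(1) by (auto simp: mons_def)
  have "x \<le> s + k * s" unfolding k(2) using * assms by (intro add_mono mult_left_mono) auto
  also have "\<dots> = s * Suc k" by simp
  also have "\<dots> \<le> s * d" using k(1) u(2) by (intro mult_left_mono) auto
  finally show "x \<in> {1..s * d}" using * k(2) by simp
qed

lemma block_index_unique:
  fixes x y :: nat
  assumes "1 \<le> x" "x \<le> t" "1 \<le> y" "y \<le> t" "x + k * t = y + l * t"
  shows "k = l \<and> x = y"
proof -
  have *: "\<not> k < l" if "1 \<le> y" "x \<le> t" "x + k * t = y + l * t" for x y k l :: nat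
  proof
    assume "k < l"
    then obtain e where "l = k + Suc e" using less_iff_Suc_add by auto
    then have "l * t = k * t + t + e * t" by (simp add: algebra_simps)
    then show False using that by simp
  qed
  have "k = l" using *[of y x k l] *[of x y l k] assms by simp
  then show ?thesis using assms by simp
qed

text \<open>
  An index \<open>i + k t\<close> with \<open>1 \<le> i \<le> n \<le> t\<close> determines \<open>i\<close> and \<open>k\<close>.  So the sorted list of \<open>u\<close> is an initial segment of
  that of \<open>v\<close>.
\<close>

lemma spread_subset_imp_subset:
  assumes u: "u \<in> mons {1..n}" and v: "v \<in> mons {1..n}" and "n \<le> t"
    and sub: "spread t u \<subseteq># spread t v"
  shows "u \<subseteq># v"
proof -
  let ?x = "sorted_list_of_multiset u" and ?y = "sorted_list_of_multiset v"
  have *: "k < size v \<and> ?x ! k = ?y ! k" if k: "k < size u" for k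
  proof -
    have "?x ! k + k * t \<in># spread t v"
      using mset_subset_eqD[OF sub, of "?x ! k + k * t"] k by (auto simp: mem_spread)
    then obtain l where l: "l < size v" "?x ! k + k * t = ?y ! l + l * t" by (auto simp: mem_spread)
    have "?x ! k \<in> {1..n}" "?y ! l \<in> {1..n}"
      using sorted_list_nth_mem[OF k] sorted_list_nth_mem[OF l(1)] u v by (auto simp: mons_def)
    then have "k = l \<and> ?x ! k = ?y ! l"
      using block_index_unique[of "?x ! k" t "?y ! l" k l] l(2) \<open>n \<le> t\<close> by auto
    then show ?thesis using l(1) by auto
  qed
  have "size u \<le> size v"
    using *[of "size u - 1"] by (cases "size u") auto
  then have "?x = take (size u) ?y" using * by (intro nth_equalityI) auto
  then have "?y = ?x @ drop (size u) ?y" by (metis append_take_drop_id)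
  then have "mset ?y = mset ?x + mset (drop (size u) ?y)" by (metis mset_append)
  then show "u \<subseteq># v" by (metis mset_sorted_list_of_multiset mset_subset_eq_add_left)
qed

lemma multiples_self: "U \<subseteq> mons Z \<Longrightarrow> U \<subseteq> multiples Z U"
  by (auto simp: multiples_def)

lemma multiples_mono: "U \<subseteq> V \<Longrightarrow> multiples Z U \<subseteq> multiples Z V"
  by (auto simp: multiples_def)

definition minimal_mons :: "monom set \<Rightarrow> monom set" where
  "minimal_mons U = {u \<in> U. \<forall>v\<in>U. v \<subseteq># u \<longrightarrow> v = u}"

lemma min_gens_kspan:
  assumes "U \<subseteq> mons Z"
  shows "min_gens (kspan (multiples Z U) :: 'k::field mpoly set) = minimal_mons U"
proof -
  have U: "v \<in> multiples Z U" if "v \<in> U" for v using that multiples_self[OF assms] by blast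
  have "min_gens (kspan (multiples Z U) :: 'k mpoly set) =
      {u \<in> multiples Z U. \<forall>v\<in>multiples Z U. v \<subseteq># u \<longrightarrow> v = u}"
    unfolding min_gens_def mon_dvd_iff mon_mem_kspan by blast
  also have "\<dots> = minimal_mons U"
  proof (intro equalityI subsetI)
    fix u assume u: "u \<in> {u \<in> multiples Z U. \<forall>v\<in>multiples Z U. v \<subseteq># u \<longrightarrow> v = u}"
    then obtain g where "g \<in> U" "g \<subseteq># u" by (auto simp: multiples_def)
    then have "u \<in> U" using u U by auto
    then show "u \<in> minimal_mons U" using u U by (auto simp: minimal_mons_def)
  next
    fix u assume u: "u \<in> minimal_mons U"
    have "v = u" if v: "v \<in> multiples Z U" "v \<subseteq># u" for v
    proof -
      obtain g where g: "g \<in> U" "g \<subseteq># v" using v(1) by (auto simp: multiples_def)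
      then have "g = u" using u v(2) by (auto simp: minimal_mons_def)
      then show ?thesis using g(2) v(2) by simp
    qed
    then show "u \<in> {u \<in> multiples Z U. \<forall>v\<in>multiples Z U. v \<subseteq># u \<longrightarrow> v = u}"
      using u U by (auto simp: minimal_mons_def)
  qed
  finally show ?thesis .
qed

lemma ex_minimal_below: "u \<in> U \<Longrightarrow> \<exists>g\<in>minimal_mons U. g \<subseteq># u"
proof (induction "size u" arbitrary: u rule: less_induct)
  case less
  show ?case
  proof (cases "u \<in> minimal_mons U")
    case False
    then obtain v where v: "v \<in> U" "v \<subseteq># u" "v \<noteq> u" using less.prems by (auto simp: minimal_mons_def)
    then have "size v < size u" by (simp add: mset_subset_size subset_mset.less_le)
    then show ?thesis using less.hyps[of v] v by (meson subset_mset.order_trans)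
  qed auto
qed

lemma multiples_minimal: "multiples Z (minimal_mons U) = multiples Z U"
proof -
  have "\<exists>g\<in>minimal_mons U. g \<subseteq># u" if "v \<in> U" "v \<subseteq># u" for u v
    using ex_minimal_below[OF that(1)] that(2) subset_mset.order_trans by blast
  moreover have "minimal_mons U \<subseteq> U" by (auto simp: minimal_mons_def)
  ultimately show ?thesis unfolding multiples_def by blast
qed

lemma monomial_ideal_min_gens:
  assumes "monomial_ideal n (I :: 'k::field mpoly set)"
  shows "I = kspan (multiples {1..n} (min_gens I))" "min_gens I \<subseteq> mons {1..n}"
    "u \<in> min_gens I \<Longrightarrow> v \<in> min_gens I \<Longrightarrow> u \<subseteq># v \<Longrightarrow> u = v"
proof -
  obtain U where U: "U \<subseteq> mons {1..n}" "I = genideal (T n) (mon ` U)"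
    using assms by (auto simp: monomial_ideal_def mons_def)
  have I: "I = kspan (multiples {1..n} U)" unfolding U(2) T_def by (rule genideal_mon[OF U(1)])
  have G: "min_gens I = minimal_mons U" unfolding I by (rule min_gens_kspan[OF U(1)])
  show "I = kspan (multiples {1..n} (min_gens I))" unfolding G multiples_minimal by (rule I)
  show "min_gens I \<subseteq> mons {1..n}" unfolding G using U(1) by (auto simp: minimal_mons_def)
  show "u \<in> min_gens I \<Longrightarrow> v \<in> min_gens I \<Longrightarrow> u \<subseteq># v \<Longrightarrow> u = v"
    unfolding G by (auto simp: minimal_mons_def)
qed

text \<open>
  The elements of \<open>G\<close> whose images are still minimal generators before the \<open>a\<close>-th application of \<open>\<sigma>\<close>.  This
  recursion does not refer to the ring in which the ideals are formed, so that the iterations for \<open>J n\<close> and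
  \<open>J t\<close> can be compared although they take place in different rings.
\<close>

fun surviving_gens :: "monom set \<Rightarrow> nat \<Rightarrow> monom set" where
  "surviving_gens G 0 = G"
| "surviving_gens G (Suc a) = {v \<in> surviving_gens G a. spread a v \<in> minimal_mons (spread a ` surviving_gens G a)}"

lemma surviving_gens_subset: "surviving_gens G a \<subseteq> G"
  by (induction a) auto

lemma surviving_gens_stable:
  assumes G: "G \<subseteq> mons {1..n}" "\<And>u v. u \<in> G \<Longrightarrow> v \<in> G \<Longrightarrow> u \<subseteq># v \<Longrightarrow> u = v" and "n \<le> a"
  shows "surviving_gens G a = surviving_gens G n"
  using \<open>n \<le> a\<close>
proof (induction rule: dec_induct)
  case (step a)
  have "w = v" if vw: "v \<in> G" "w \<in> G" "spread a w \<subseteq># spread a v" for v w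
    using spread_subset_imp_subset[of w n v a] vw G step.hyps(1) by blast
  then have "surviving_gens G (Suc a) = surviving_gens G a"
    using surviving_gens_subset[of G a] by (fastforce simp: minimal_mons_def)
  then show ?case using step.IH by simp
qed simp

lemma sigma_ideal_kspan:
  assumes "U \<subseteq> mons Z" "sigma ` minimal_mons U \<subseteq> mons {1..N}"
  shows "sigma_ideal N (kspan (multiples Z U) :: 'k::field mpoly set) = kspan (multiples {1..N} (sigma ` minimal_mons U))"
  unfolding sigma_ideal_def min_gens_kspan[OF assms(1)] T_def by (rule genideal_mon[OF assms(2)])

text \<open>
  The exceptional case \<open>a = 0\<close> is the ideal \<open>I\<close> itself, which lives in \<open>T\<^sub>n\<close>.
\<close>

lemma sigma_ideal_funpow:
  fixes I :: "'k::field mpoly set"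
  assumes I: "monomial_ideal n I" and d: "\<And>u. u \<in> min_gens I \<Longrightarrow> size u \<le> d" and "n \<le> s"
  shows "a \<le> s \<Longrightarrow> (sigma_ideal (s * d) ^^ a) I =
    kspan (multiples (if a = 0 then {1..n} else {1..s * d}) (spread a ` surviving_gens (min_gens I) a))"
proof (induction a)
  case 0
  then show ?case using monomial_ideal_min_gens(1)[OF I] by simp
next
  case (Suc a)
  let ?V = "surviving_gens (min_gens I) a" and ?Z = "if a = 0 then {1..n} else {1..s * d}"
  have VG: "v \<in> mons {1..n} \<and> size v \<le> d" if "v \<in> ?V" for v
    using that surviving_gens_subset[of "min_gens I" a] monomial_ideal_min_gens(2)[OF I] d by auto
  have 1: "spread a ` ?V \<subseteq> mons ?Z"
    using VG spread_mons[of _ n d a s] Suc.prems \<open>n \<le> s\<close> by auto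
  have 2: "sigma ` minimal_mons (spread a ` ?V) = spread (Suc a) ` surviving_gens (min_gens I) (Suc a)"
  proof -
    have "minimal_mons (spread a ` ?V) = spread a ` surviving_gens (min_gens I) (Suc a)"
      by (auto simp: minimal_mons_def)
    then show ?thesis by (simp add: image_image sigma_spread del: surviving_gens.simps)
  qed
  have 3: "spread (Suc a) ` surviving_gens (min_gens I) (Suc a) \<subseteq> mons {1..s * d}"
  proof (rule image_subsetI)
    fix v assume "v \<in> surviving_gens (min_gens I) (Suc a)"
    then have "v \<in> ?V" by simp
    then show "spread (Suc a) v \<in> mons {1..s * d}" using VG spread_mons[of v n d "Suc a" s] Suc.prems \<open>n \<le> s\<close> by auto
  qed
  have "(sigma_ideal (s * d) ^^ Suc a) I = sigma_ideal (s * d) (kspan (multiples ?Z (spread a ` ?V)))"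
    using Suc by simp
  also have "\<dots> = kspan (multiples {1..s * d} (spread (Suc a) ` surviving_gens (min_gens I) (Suc a)))"
    unfolding 2[symmetric] by (rule sigma_ideal_kspan[OF 1]) (use 2 3 in simp)
  finally show ?case by simp
qed

lemma sigma_ideal_iterated_eq:
  fixes I :: "'k::field mpoly set"
  assumes I: "monomial_ideal n I" and d: "\<And>u. u \<in> min_gens I \<Longrightarrow> size u \<le> d" and "n \<le> s"
  shows "sigma_ideal_iterated (s * d) s I =
    kspan (multiples {1..s * d} (spread s ` surviving_gens (min_gens I) n))"
proof -
  have "surviving_gens (min_gens I) s = surviving_gens (min_gens I) n"
    by (rule surviving_gens_stable[OF monomial_ideal_min_gens(2,3)[OF I] \<open>n \<le> s\<close>])
  moreover have "(if s = 0 then {1..n} else {1..s * d}) = {1..s * d}" using \<open>n \<le> s\<close> by auto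
  moreover have "(sigma_ideal (s * d) ^^ s) I =
      kspan (multiples (if s = 0 then {1..n} else {1..s * d}) (spread s ` surviving_gens (min_gens I) s))"
    by (rule sigma_ideal_funpow[OF I d \<open>n \<le> s\<close> order_refl])
  ultimately show ?thesis unfolding sigma_ideal_iterated_def by (simp only:)
qed

lemma sigma_ideal_direct_eq:
  fixes I :: "'k::field mpoly set"
  assumes I: "monomial_ideal n I" and d: "\<And>u. u \<in> min_gens I \<Longrightarrow> size u \<le> d" and "n \<le> s"
  shows "sigma_ideal_direct (s * d) s I = kspan (multiples {1..s * d} (spread s ` min_gens I))"
proof -
  have "spread s ` min_gens I \<subseteq> mons {1..s * d}"
    using spread_mons[OF _ d order_refl \<open>n \<le> s\<close>] monomial_ideal_min_gens(2)[OF I] by auto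
  moreover have "(sigma ^^ s) = spread s" by (rule ext) (rule sigma_funpow)
  ultimately show ?thesis unfolding sigma_ideal_direct_def T_def by (simp only: genideal_mon)
qed

lemma finite_min_gens:
  assumes "monomial_ideal n I"
  shows "finite (min_gens I)"
  using monomial_ideal_min_gens(2,3)[OF assms] by (intro finite_antichain[of "{1..n}"]) auto

section \<open>Relabelling the blocks of variables\<close>

text \<open>
  The map \<open>i + k n \<mapsto> i + k t\<close> for \<open>1 \<le> i \<le> n\<close>.  The values for \<open>n = 0\<close> and at \<open>0\<close> make it injective on
  all natural numbers if \<open>n \<le> t\<close>.
\<close>

definition block_map :: "nat \<Rightarrow> nat \<Rightarrow> nat \<Rightarrow> nat" where
  "block_map n t j = (if n = 0 \<or> j = 0 then j else (j - 1) mod n + 1 + (j - 1) div n * t)"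

lemma block_map_eq:
  assumes i: "1 \<le> i" "i \<le> n"
  shows "block_map n t (i + k * n) = i + k * t"
proof -
  have *: "i + k * n - 1 = (i - 1) + k * n" using i by simp
  have "(i - 1 + k * n) mod n = i - 1" using i by (simp only: mod_mult_self1) (simp add: mod_less)
  moreover have "(i - 1 + k * n) div n = k" using i by (subst div_mult_self1) auto
  ultimately show ?thesis unfolding block_map_def * using i by (simp only:) simp
qed

lemma block_decomposition:
  assumes "1 \<le> j" "n \<noteq> (0::nat)"
  obtains i k where "1 \<le> i" "i \<le> n" "j = i + k * n"
proof (rule that[of "(j - 1) mod n + 1" "(j - 1) div n"])
  have "(j - 1) mod n + (j - 1) div n * n = j - 1" by simp
  then show "j = (j - 1) mod n + 1 + (j - 1) div n * n" using assms by linarith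
  show "(j - 1) mod n + 1 \<le> n" using mod_less_divisor[of n "j - 1"] assms(2) by linarith
qed simp

lemma block_index_less:
  assumes "1 \<le> i" "i \<le> (n::nat)"
  shows "i + k * n \<le> n * d \<longleftrightarrow> k < d"
proof
  assume "k < d"
  then have "n * Suc k \<le> n * d" by (intro mult_left_mono) auto
  then show "i + k * n \<le> n * d" using assms by (simp add: algebra_simps)
next
  assume "i + k * n \<le> n * d"
  then have "k * n < n * d" using assms(1) by linarith
  then show "k < d" by (simp add: mult.commute[of n d])
qed

context
  fixes n t :: nat
  assumes nt: "n \<le> t"
begin

lemma inj_block_map: "inj (block_map n t)"
proof (cases "n = 0")
  case False
  show ?thesis
  proof (rule injI)
    fix j j' assume eq: "block_map n t j = block_map n t j'"
    show "j = j'"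
    proof (cases "j = 0 \<or> j' = 0")
      case True
      then show ?thesis using eq False by (auto simp: block_map_def split: if_splits)
    next
      case nz: False
      then obtain i k i' k' where *: "1 \<le> i" "i \<le> n" "j = i + k * n" "1 \<le> i'" "i' \<le> n" "j' = i' + k' * n"
        using block_decomposition[of j n] block_decomposition[of j' n] False by (metis Suc_leI neq0_conv One_nat_def)
      then show ?thesis using eq block_index_unique[of i t i' k k'] nt by (simp add: block_map_eq)
    qed
  qed
qed (simp add: inj_def block_map_def)

lemma block_map_range:
  "block_map n t ` {1..n * d} = {i + k * t | i k. 1 \<le> i \<and> i \<le> n \<and> k < d}"
proof (intro equalityI subsetI)
  fix x assume "x \<in> block_map n t ` {1..n * d}"
  then obtain j where j: "1 \<le> j" "j \<le> n * d" "x = block_map n t j" by auto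
  then have "n \<noteq> 0" by (cases n) auto
  then obtain i k where "1 \<le> i" "i \<le> n" "j = i + k * n" using block_decomposition j(1) by metis
  then show "x \<in> {i + k * t | i k. 1 \<le> i \<and> i \<le> n \<and> k < d}"
    using j block_index_less[of i n k d] block_map_eq[of i n t k] by auto
next
  fix x assume "x \<in> {i + k * t | i k. 1 \<le> i \<and> i \<le> n \<and> k < d}"
  then obtain i k where *: "1 \<le> i" "i \<le> n" "k < d" "x = i + k * t" by auto
  then have "i + k * n \<in> {1..n * d}" using block_index_less[of i n k d] by simp
  then show "x \<in> block_map n t ` {1..n * d}" using block_map_eq[of i n t k] *
    by (intro image_eqI[of _ _ "i + k * n"]) auto
qed

lemma block_map_subset: "block_map n t ` {1..n * d} \<subseteq> {1..t * d}"
  unfolding block_map_range using block_index_less[of _ t _ d] nt by (fastforce simp: mult.commute)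

lemma block_map_mem: "block_map n t j \<in> {1..t * d} \<Longrightarrow> j \<in> {1..n * d} \<or> n = 0"
proof (rule ccontr)
  assume j: "block_map n t j \<in> {1..t * d}" and no: "\<not> (j \<in> {1..n * d} \<or> n = 0)"
  then have "1 \<le> j" by (cases j) (auto simp: block_map_def)
  then obtain i k where *: "1 \<le> i" "i \<le> n" "j = i + k * n" using block_decomposition no by metis
  then have "k < d" using j block_index_less[of i t k d] nt by (simp add: block_map_eq)
  then show False using no * block_index_less[of i n k d] by simp
qed

lemma new_variables:
  "{1..t * d} - block_map n t ` {1..n * d} = {s * t + r | s r. s < d \<and> n + 1 \<le> r \<and> r \<le> t}"
proof (intro equalityI subsetI)
  fix x assume x: "x \<in> {1..t * d} - block_map n t ` {1..n * d}"
  then have "t \<noteq> 0" by (cases t) auto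
  then obtain i k where ik: "1 \<le> i" "i \<le> t" "x = i + k * t" using block_decomposition x by (metis DiffD1 atLeastAtMost_iff)
  then have "k < d" using x block_index_less[of i t k d] by simp
  moreover have "\<not> i \<le> n" using x ik calculation unfolding block_map_range by auto
  ultimately show "x \<in> {s * t + r | s r. s < d \<and> n + 1 \<le> r \<and> r \<le> t}" using ik
    by (intro CollectI exI[of _ k] exI[of _ i]) simp
next
  fix x assume "x \<in> {s * t + r | s r. s < d \<and> n + 1 \<le> r \<and> r \<le> t}"
  then obtain s r where "x = s * t + r" "s < d" "n + 1 \<le> r" "r \<le> t" by auto
  then have sr: "x = r + s * t" "s < d" "n + 1 \<le> r" "r \<le> t" by simp_all
  have "x \<in> {1..t * d}" using sr block_index_less[of r t s d] by simp
  moreover have "x \<notin> block_map n t ` {1..n * d}"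
  proof
    assume "x \<in> block_map n t ` {1..n * d}"
    then obtain i k where "1 \<le> i" "i \<le> n" "x = i + k * t" unfolding block_map_range by auto
    then show False using block_index_unique[of i t r k s] sr nt by auto
  qed
  ultimately show "x \<in> {1..t * d} - block_map n t ` {1..n * d}" by blast
qed

lemma card_new_variables: "card ({1..t * d} - block_map n t ` {1..n * d}) = (t - n) * d"
  using card_Diff_subset[OF _ block_map_subset, of d] card_image[OF inj_on_subset[OF inj_block_map], of "{1..n * d}"]
  by (simp add: diff_mult_distrib)

lemma block_map_spread:
  assumes "u \<in> mons {1..n}"
  shows "image_mset (block_map n t) (spread n u) = spread t u"
proof -
  have "block_map n t (sorted_list_of_multiset u ! k + k * n) = sorted_list_of_multiset u ! k + k * t"
    if "k < size u" for k
    using sorted_list_nth_mem[OF that] assms by (intro block_map_eq) (auto simp: mons_def)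
  then show ?thesis unfolding spread_def mset_map[symmetric] map_map by (intro arg_cong[of _ _ mset] map_cong) auto
qed

end

text \<open>
  The composition of \<open>unrename \<phi>\<close> with the projection is a surjection from \<open>T\<^sub>N\<close>; it kills the variables that are
  not of the form \<open>\<phi> i\<close> together with the renamed ideal.  The isomorphism is the inverse of the one that it
  induces.
\<close>

lemma quot_alg_iso_rename:
  fixes U :: "monom set" and \<phi> :: "nat \<Rightarrow> nat"
  assumes \<phi>: "inj \<phi>" and sub: "\<phi> ` {1..m} \<subseteq> {1..N}" and pre: "\<And>j. \<phi> j \<in> {1..N} \<Longrightarrow> j \<in> {1..m}"
    and U: "U \<subseteq> mons {1..m}"
  shows "quot_alg_iso m (kspan (multiples {1..m} U) :: 'k::field mpoly set) N
    (kspan (multiples {1..N} (image_mset \<phi> ` U \<union> (\<lambda>i. {#i#}) ` ({1..N} - \<phi> ` {1..m}))))"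
proof -
  let ?J = "kspan (multiples {1..m} U) :: 'k mpoly set"
  let ?V = "image_mset \<phi> ` U \<union> (\<lambda>i. {#i#}) ` ({1..N} - \<phi> ` {1..m})"
  let ?K = "kspan (multiples {1..N} ?V) :: 'k mpoly set"
  let ?R = "T N :: 'k mpoly ring" and ?Q = "T m Quot ?J"
  interpret Q: quotient_of_polys m ?J by unfold_locales (rule idl_kspan_multiples)
  have ringT: "ring (T k :: 'k mpoly ring)" for k
    unfolding T_def by (rule cring.axioms(1)[OF cring_polyring])
  have ringQ: "ring ?Q" by (rule ideal.quotient_is_ring[OF Q.ideal_J])
  define h where "h p = Q.coset (unrename \<phi> p)" for p
  have pre': "u \<in> mons {1..m}" if "image_mset \<phi> u \<in> mons {1..N}" for u
    using that pre by (auto simp: mons_def)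
  have unr: "unrename \<phi> p \<in> Q.S" if "p \<in> kspan (mons {1..N})" for p
    using that pre' by (auto simp: kspan_def keys_unrename[OF \<phi>])
  have unr_one: "unrename \<phi> (cst c) = (cst c :: 'k mpoly)" for c
    using unrename_single[OF \<phi>, of "{#}" c] by (simp add: cst_def)
  have one_cst: "(1 :: 'k mpoly) = cst 1" using mon_empty by (metis cst_def mon_def)
  have "unrename \<phi> \<in> ring_hom ?R (T m)"
  proof (rule ring_hom_memI)
    show "unrename \<phi> \<one>\<^bsub>?R\<^esub> = \<one>\<^bsub>T m\<^esub>" using unr_one[of 1] by (simp add: T_def one_cst)
  qed (use unr in \<open>auto simp: carrier_T T_def unrename_add[OF \<phi>] unrename_mult[OF \<phi>] carrier_polyring\<close>)
  then have "h \<in> ring_hom ?R ?Q"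
    using ring_hom_trans[OF _ ideal.rcos_ring_hom[OF Q.ideal_J]] by (simp add: h_def[abs_def] Q.coset_def o_def)
  then interpret h: ring_hom_ring ?R ?Q h by (rule ring_hom_ringI2[OF ringT ringQ])
  have carrier_Q: "carrier ?Q = Q.coset ` Q.S"
    using Q.carrier_M by (simp add: quot_module_def Let_def)
  have surj: "h ` carrier ?R = carrier ?Q"
  proof
    show "h ` carrier ?R \<subseteq> carrier ?Q" using h.hom_closed by blast
    show "carrier ?Q \<subseteq> h ` carrier ?R"
      unfolding carrier_Q carrier_T h_def using unrename_surj[OF \<phi> sub, where 'k = 'k] by blast
  qed
  have zero_Q: "\<zero>\<^bsub>?Q\<^esub> = Q.coset 0" using Q.zero_M by (simp add: quot_module_def Let_def)
  have mem: "image_mset \<phi> u \<in> multiples {1..N} ?V \<longleftrightarrow> u \<in> multiples {1..m} U" if u: "u \<in> mons {1..m}" for u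
  proof -
    have "image_mset \<phi> u \<in> mons {1..N}" using u sub by (auto simp: mons_def)
    moreover have "i \<notin># image_mset \<phi> u" if "i \<in> {1..N} - \<phi> ` {1..m}" for i
      using that u by (auto simp: mons_def)
    ultimately show ?thesis using u by (auto simp: multiples_def bex_Un image_mset_subseteq_iff[OF \<phi>])
  qed
  have kernel: "a_kernel ?R ?Q h = ?K"
  proof -
    have "unrename \<phi> p \<in> ?J \<longleftrightarrow> p \<in> ?K" if p: "p \<in> kspan (mons {1..N})" for p
    proof
      assume J: "unrename \<phi> p \<in> ?J"
      show "p \<in> ?K"
        unfolding kspan_def
      proof (rule CollectI, rule subsetI)
        fix w assume w: "w \<in> Poly_Mapping.keys p"
        then have wN: "w \<in> mons {1..N}" using p by (auto simp: kspan_def)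
        show "w \<in> multiples {1..N} ?V"
        proof (cases "set_mset w \<subseteq> \<phi> ` {1..m}")
          case True
          then obtain u where u: "u \<in> mons {1..m}" "w = image_mset \<phi> u" using mset_in_range[OF \<phi>] by blast
          then have "u \<in> multiples {1..m} U" using J w by (auto simp: kspan_def keys_unrename[OF \<phi>])
          then show ?thesis using mem[OF u(1)] u(2) by simp
        next
          case False
          then obtain i where "i \<in># w" "i \<in> {1..N} - \<phi> ` {1..m}" using wN unfolding mons_def by blast
          then show ?thesis using wN unfolding multiples_def by (auto simp: bex_Un)
        qed
      qed
    next
      assume K: "p \<in> ?K"
      show "unrename \<phi> p \<in> ?J"
        unfolding kspan_def
      proof (rule CollectI, rule subsetI)
        fix u assume "u \<in> Poly_Mapping.keys (unrename \<phi> p)"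
        then have w: "image_mset \<phi> u \<in> Poly_Mapping.keys p" by (simp add: keys_unrename[OF \<phi>])
        then have "image_mset \<phi> u \<in> mons {1..N}" "image_mset \<phi> u \<in> multiples {1..N} ?V"
          using p K by (auto simp: kspan_def)
        then show "u \<in> multiples {1..m} U" using mem[OF pre'] by blast
      qed
    qed
    moreover have "?K \<subseteq> kspan (mons {1..N})" using kspan_mono[OF multiples_subset] by blast
    ultimately show ?thesis
      unfolding a_kernel_def' zero_Q h_def carrier_T Q.coset_eq_iff diff_zero by blast
  qed
  let ?f = "\<lambda>C. the_elem (h ` C)"
  have f: "?f \<in> ring_iso (?R Quot ?K) ?Q" using h.FactRing_iso_set[OF surj] unfolding kernel .
  have K: "ideal ?K ?R" using h.kernel_is_ideal unfolding kernel .
  have g: "inv_into (carrier (?R Quot ?K)) ?f \<in> ring_iso ?Q (?R Quot ?K)"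
    by (rule ring_iso_set_sym[OF ideal.quotient_is_ring[OF K] f])
  have "inv_into (carrier (?R Quot ?K)) ?f (?J +>\<^bsub>T m\<^esub> cst c) = ?K +>\<^bsub>?R\<^esub> cst c" for c
  proof (rule inv_into_f_eq)
    show "inj_on ?f (carrier (?R Quot ?K))" using f by (simp add: ring_iso_def bij_betw_def)
    have c: "cst c \<in> carrier ?R" by (auto simp: carrier_T cst_def kspan_def)
    then show "?K +>\<^bsub>?R\<^esub> cst c \<in> carrier (?R Quot ?K)" by (auto simp: FactRing_def A_RCOSETS_def')
    show "?f (?K +>\<^bsub>?R\<^esub> cst c) = ?J +>\<^bsub>T m\<^esub> cst c"
      using h.the_elem_simp[OF c] unfolding kernel by (simp add: h_def unr_one Q.coset_def)
  qed
  then show ?thesis unfolding quot_alg_iso_def using g by blast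
qed

text \<open>
  The lengths \<open>r < c\<close> do not exceed the right-hand side, which is at least \<open>c\<close> because of \<open>P 0\<close>.
\<close>

lemma SUP_enat_shift:
  assumes P: "\<And>r. P' (r + c) \<longleftrightarrow> P r" and "P 0"
  shows "(SUP r\<in>{r. P' r}. enat r) = (SUP r\<in>{r. P r}. enat r) + enat c"
proof (rule antisym)
  show "(SUP r\<in>{r. P r}. enat r) + enat c \<le> (SUP r\<in>{r. P' r}. enat r)"
  proof (rule SUP_enat_add_le)
    show "{r. P r} \<noteq> {}" using \<open>P 0\<close> by blast
    fix r assume "r \<in> {r. P r}"
    then have "P' (r + c)" using P by simp
    then show "enat r + enat c \<le> (SUP r\<in>{r. P' r}. enat r)" by (intro SUP_upper2[of "r + c"]) auto
  qed
  show "(SUP r\<in>{r. P' r}. enat r) \<le> (SUP r\<in>{r. P r}. enat r) + enat c"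
  proof (rule SUP_least)
    fix r assume r: "r \<in> {r. P' r}"
    show "enat r \<le> (SUP r\<in>{r. P r}. enat r) + enat c"
    proof (cases "c \<le> r")
      case True
      then have "P (r - c)" using r P[of "r - c"] by simp
      then have "enat (r - c) + enat c \<le> (SUP r\<in>{r. P r}. enat r) + enat c"
        by (intro add_right_mono SUP_upper) simp
      then show ?thesis using True by simp
    next
      case False
      then have "enat r \<le> enat c" by simp
      also have "\<dots> \<le> (SUP r\<in>{r. P r}. enat r) + enat c" by simp
      finally show ?thesis .
    qed
  qed
qed

lemma ereal_of_enat_diff: "b = a + enat c \<Longrightarrow> ereal_of_enat a = ereal_of_enat b - ereal (real c)"
  by (cases a) auto

section \<open>Comparison of \<open>I\<^bsup>\<sigma>^n\<^esup>\<close> and \<open>I\<^bsup>\<sigma>^t\<^esup>\<close>\<close>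

theorem corollary1p5:
  fixes I :: "'k::field mpoly set" and J :: "nat \<Rightarrow> 'k mpoly set" and n d t :: nat
  assumes "monomial_ideal n I" and "I \<noteq> {0}"
    and "d = ideal_deg I" and "n \<le> t"
    and "J \<in> {\<lambda>s. sigma_ideal_iterated (s * d) s I, \<lambda>s. sigma_ideal_direct (s * d) s I}"
  shows "quot_alg_iso (n * d) (J n)
           (t * d) (genideal (T (t * d))
              (J t \<union> {xvar (s * t + r) |s r. s < d \<and> n + 1 \<le> r \<and> r \<le> t}))
    \<and> ereal_of_enat (depth (n * d) (quot_module (n * d) (J n))) =
           ereal_of_enat (depth (t * d) (quot_module (t * d) (J t))) - ereal (real ((t - n) * d))
    \<and> ereal_of_enat (sdepth (n * d) (quot_module (n * d) (J n)) (quot_part (n * d) (J n))) =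
           ereal_of_enat (sdepth (t * d) (quot_module (t * d) (J t)) (quot_part (t * d) (J t)))
             - ereal (real ((t - n) * d))
    \<and> ereal_of_enat (sdepth (n * d) (ideal_module (n * d) (J n)) (ideal_part (n * d) (J n))) =
           ereal_of_enat (sdepth (t * d) (ideal_module (t * d) (J t)) (ideal_part (t * d) (J t)))
             - ereal (real ((t - n) * d))"
proof -
  let ?G = "min_gens I" and ?\<phi> = "block_map n t"
  note G = monomial_ideal_min_gens[OF assms(1)]
  have fin: "finite ?G" by (rule finite_min_gens[OF assms(1)])
  have size: "size u \<le> d" if "u \<in> ?G" for u
    unfolding assms(3) ideal_deg_def using fin that by (intro Max_ge) auto
  obtain V where V: "V \<subseteq> ?G" and J: "\<And>s. n \<le> s \<Longrightarrow> J s = kspan (multiples {1..s * d} (spread s ` V))"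
  proof (cases "J = (\<lambda>s. sigma_ideal_direct (s * d) s I)")
    case True
    then show ?thesis using that[of ?G] sigma_ideal_direct_eq[OF assms(1) size] by blast
  next
    case False
    then have "J = (\<lambda>s. sigma_ideal_iterated (s * d) s I)" using assms(5) by blast
    then show ?thesis
      using that[OF surviving_gens_subset] sigma_ideal_iterated_eq[OF assms(1) size] by blast
  qed
  define U where "U = spread n ` V"
  let ?Z = "{1..n * d}"
  let ?Y = "{1..t * d} - ?\<phi> ` ?Z"
  let ?c = "(t - n) * d"
  have UZ: "U \<subseteq> mons ?Z" and finU: "finite U"
    unfolding U_def using V G(2) size fin spread_mons[of _ n d n n] by (auto intro: finite_subset)
  have \<phi>: "inj ?\<phi>" by (rule inj_block_map[OF assms(4)])
  have \<phi>U: "spread t ` V = image_mset ?\<phi> ` U"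
    unfolding U_def image_image using V G(2) block_map_spread[OF assms(4)] by (intro image_cong) auto
  have Jn: "J n = kspan (multiples ?Z U)" using J[of n] by (simp add: U_def)
  have Jt: "J t = kspan (multiples {1..t * d} (image_mset ?\<phi> ` U))" using J[OF assms(4)] by (simp add: \<phi>U)
  have YZ: "?Y \<union> ?\<phi> ` ?Z = {1..t * d}" using block_map_subset[OF assms(4), of d] by blast
  have card: "card ?Y = ?c" by (rule card_new_variables[OF assms(4)])
  have \<phi>UZ: "image_mset ?\<phi> ` U \<subseteq> mons (?\<phi> ` ?Z)" using UZ by (auto simp: mons_image)
  have disj: "?Y \<inter> ?\<phi> ` ?Z = {}" by blast

  \<comment> \<open>for n = 0 there are no variables, I is generated by 1, and everything takes place in T 0\<close>
  have d0: "d = 0" if n0: "n = 0"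
  proof -
    have "mons {1..n} = {{#}}" using n0 by (auto simp: mons_def)
    then have "?G = {{#}}"
      using G assms(2) by (cases "?G = {}") (auto simp: multiples_def kspan_def)
    then show "d = 0" by (simp add: assms(3) ideal_deg_def)
  qed
  have iso: "quot_alg_iso (n * d) (J n) (t * d) (genideal (T (t * d))
      (J t \<union> {xvar (s * t + r) |s r. s < d \<and> n + 1 \<le> r \<and> r \<le> t}))"
  proof -
    have pre: "j \<in> ?Z" if "?\<phi> j \<in> {1..t * d}" for j
      using block_map_mem[OF assms(4) that] d0 that by auto
    let ?W = "image_mset ?\<phi> ` U \<union> (\<lambda>i. {#i#}) ` ?Y"
    have W: "?W \<subseteq> mons {1..t * d}" using \<phi>UZ YZ by (fastforce simp: mons_def)
    interpret R: cring "T (t * d) :: 'k mpoly ring" unfolding T_def by (rule cring_polyring)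
    have vars: "{xvar (s * t + r) |s r. s < d \<and> n + 1 \<le> r \<and> r \<le> t} = (mon ` (\<lambda>i. {#i#}) ` ?Y :: 'k mpoly set)"
      unfolding new_variables[OF assms(4)] by (auto simp: xvar_def image_iff)
    have gen: "genideal (T (t * d)) (mon ` ?W) = (kspan (multiples {1..t * d} ?W) :: 'k mpoly set)"
      unfolding T_def by (rule genideal_mon[OF W])
    have "genideal (T (t * d)) (J t \<union> {xvar (s * t + r) |s r. s < d \<and> n + 1 \<le> r \<and> r \<le> t}) =
        (kspan (multiples {1..t * d} ?W) :: 'k mpoly set)"
    proof
      have id: "ideal (kspan (multiples {1..t * d} ?W) :: 'k mpoly set) (T (t * d))"
        unfolding T_def by (rule ideal_polyring[OF idl_kspan_multiples])
      have "J t \<subseteq> kspan (multiples {1..t * d} ?W)"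
        unfolding Jt by (rule subsetI, rule kspan_mono[OF multiples_mono]) auto
      moreover have "mon ` (\<lambda>i. {#i#}) ` ?Y \<subseteq> (kspan (multiples {1..t * d} ?W) :: 'k mpoly set)"
        using multiples_self[OF W] by auto
      ultimately show "genideal (T (t * d)) (J t \<union> {xvar (s * t + r) |s r. s < d \<and> n + 1 \<le> r \<and> r \<le> t})
          \<subseteq> kspan (multiples {1..t * d} ?W)"
        unfolding vars by (intro R.genideal_minimal id) blast
      have "mon ` image_mset ?\<phi> ` U \<subseteq> J t"
        unfolding Jt using multiples_self[of "image_mset ?\<phi> ` U" "{1..t * d}"] W by auto
      then have "mon ` ?W \<subseteq> J t \<union> (mon ` (\<lambda>i. {#i#}) ` ?Y :: 'k mpoly set)" by blast
      moreover have "J t \<union> (mon ` (\<lambda>i. {#i#}) ` ?Y :: 'k mpoly set) \<subseteq> carrier (T (t * d))"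
        unfolding Jt carrier_T using W kspan_mono[OF multiples_subset] by auto
      ultimately show "kspan (multiples {1..t * d} ?W) \<subseteq>
          genideal (T (t * d)) (J t \<union> {xvar (s * t + r) |s r. s < d \<and> n + 1 \<le> r \<and> r \<le> t})"
        unfolding vars gen[symmetric] by (rule R.subset_Idl_subset[rotated])
    qed
    then show ?thesis
      unfolding Jn using quot_alg_iso_rename[OF \<phi> block_map_subset[OF assms(4)] pre UZ] by simp
  qed
  have depth: "depth (t * d) (quot_module (t * d) (J t)) = depth (n * d) (quot_module (n * d) (J n)) + enat ?c"
  proof -
    have reg: "has_regular_seq TYPE('k) {1..t * d} (image_mset ?\<phi> ` U) (r + ?c) \<longleftrightarrow> has_regular_seq TYPE('k) ?Z U r" for r
      using has_regular_seq_extend[of "?\<phi> ` ?Z" ?Y "image_mset ?\<phi> ` U" r, where 'k = 'k] \<phi>UZ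
        has_regular_seq_rename[OF \<phi>, of ?Z U r, where 'k = 'k]
      unfolding YZ card by auto
    have "{#} \<in> image_mset ?\<phi> ` U \<longleftrightarrow> {#} \<in> U" by (auto simp: image_iff)
    moreover have "has_regular_seq TYPE('k) ?Z U 0" by (auto simp: has_regular_seq_def)
    ultimately show ?thesis
      unfolding Jn Jt depth_quot_module 
      using SUP_enat_shift[of "has_regular_seq TYPE('k) {1..t * d} (image_mset ?\<phi> ` U)" ?c
        "has_regular_seq TYPE('k) ?Z U", OF reg] by simp
  qed
  have pd: "partition_depth {1..t * d} (extend_set ?Y (?\<phi> ` ?Z) (image_mset ?\<phi> ` E)) = partition_depth ?Z E + enat ?c"
    if E: "E \<subseteq> mons ?Z" and ex: "\<exists>L. monomial_partition (?\<phi> ` ?Z) (image_mset ?\<phi> ` E) L" for E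
  proof -
    have "image_mset ?\<phi> ` E \<subseteq> mons (?\<phi> ` ?Z)" using E by (auto simp: mons_image)
    from partition_depth_extend[OF this disj _ _ ex] show ?thesis
      unfolding YZ card using partition_depth_rename[OF inj_on_subset[OF \<phi>] E] by simp
  qed
  have ex: "\<exists>L. monomial_partition (?\<phi> ` ?Z) (image_mset ?\<phi> ` multiples ?Z U) L"
     "\<exists>L. monomial_partition (?\<phi> ` ?Z) (image_mset ?\<phi> ` (mons ?Z - multiples ?Z U)) L"
    unfolding image_multiples[OF \<phi>] image_mons_diff[OF \<phi>]
    using ex_monomial_partition_multiples[OF _ \<phi>UZ] finU by auto
  have "sdepth (t * d) (quot_module (t * d) (J t)) (quot_part (t * d) (J t)) =
      sdepth (n * d) (quot_module (n * d) (J n)) (quot_part (n * d) (J n)) + enat ?c"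
    unfolding Jn Jt sdepth_quot_module
    using pd[OF _ ex(2)] unfolding image_mons_diff[OF \<phi>] extend_set_multiples[OF \<phi>UZ] YZ by blast
  moreover have "sdepth (t * d) (ideal_module (t * d) (J t)) (ideal_part (t * d) (J t)) =
      sdepth (n * d) (ideal_module (n * d) (J n)) (ideal_part (n * d) (J n)) + enat ?c"
    unfolding Jn Jt sdepth_ideal_module
    using pd[OF multiples_subset ex(1)] unfolding image_multiples[OF \<phi>] extend_set_multiples[OF \<phi>UZ] YZ .
  ultimately show ?thesis using iso depth by (intro conjI ereal_of_enat_diff)
qed

end
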